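(* Let $x=(x_1,x_2,x_3,\dots)$ be countably many variables. Then, as identities of formal power series in $x$ (with coefficients that are rational functions of $q$; equivalently for complex $|q|<1$), \[ \sum_{\substack{\lambda\\ \text{2-core}(\lambda)=0}} q^{b(\lambda)}\frac{\prod_{h\in\mathcal{H}^{\mathrm{o}}_\lambda}(1-q^h)}{\prod_{h\in\mathcal{H}^{\mathrm{e}}_\lambda}(1-q^h)} s_\lambda(x)=\prod_{i\geq 1}\frac{(qx_i^2;q^2)_\infty}{(x_i^2;q^2)_\infty} \prod_{i<j}\frac{1}{1-x_ix_j}, \] and \[ \sum_{\substack{\lambda\\ \text{2-core}(\lambda)=0}} q^{b(\lambda')} \frac{\prod_{h\in\mathcal{H}^{\mathrm{o}}_\lambda}(1-q^h)}{\prod_{h\in\mathcal{H}^{\mathrm{e}}_\lambda}(1-q^h)}s_\lambda(x)= \prod_{i\geq 1}\frac{(q^2x_i^2;q^2)_\infty}{(qx_i^2;q^2)_\infty} \prod_{i<j}\frac{1}{1-x_ix_j}. \] Both sums run over all partitions $\lambda$ with empty $2$-core.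
   Context: A partition $\lambda=(\lambda_1\ge\lambda_2\ge\cdots)$ is identified with its Young diagram $\{(i,j): 1\le j\le\lambda_i\}$; $\lambda'$ is the conjugate partition. For a box $s=(i,j)\in\lambda$ the hook length is $h(s)=\lambda_i-j+\lambda'_j-i+1$. $\mathcal{H}_\lambda$ is the multiset of hook lengths of $\lambda$, and $\mathcal{H}^{\mathrm{e}}_\lambda$, $\mathcal{H}^{\mathrm{o}}_\lambda$ are its submultisets of even, resp. odd, hook lengths. A partition has empty $2$-core, written $\text{2-core}(\lambda)=0$, if its Young diagram can be tiled by dominoes ($1\times 2$ or $2\times1$ rectangles). The statistic $b$ is \[ b(\lambda):=\sum_{(i,j)\in\lambda}(-1)^{\lambda_i+\lambda_j'-i-j+1}(\lambda_i-i). \] $(a;q)_\infty:=\prod_{k\ge0}(1-aq^k)$. $s_\lambda(x)$ denotes the Schur function in the variables $x_1,x_2,\dots$. *)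

theory Defs
  imports
    "HOL-Analysis.Analysis"
    "HOL-Library.Multiset"
    "HOL-Library.Disjoint_Sets"
    "HOL-Library.Poly_Mapping"
begin

section \<open>Formal power series in countably many variables\<close>

text \<open>
  The variables are indexed by all natural numbers, so \<open>mvar i\<close> stands for $x_{i+1}$.
  A monomial is given by its finitely supported exponent vector; a series is an arbitrary
  family of coefficients.
\<close>

typedef 'a mfps = "UNIV :: ((nat \<Rightarrow>\<^sub>0 nat) \<Rightarrow> 'a) set"
  morphisms mcoeff Abs_mfps
  by simp

setup_lifting type_definition_mfps

lemma mfps_eqI: "(\<And>m. mcoeff f m = mcoeff g m) \<Longrightarrow> f = g"
  by (simp add: ext mcoeff_inject[symmetric])

lemma mcoeff_Abs [simp]: "mcoeff (Abs_mfps f) = f"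
  by (simp add: Abs_mfps_inverse)

lemma finite_monomial_le:
  "finite {a :: nat \<Rightarrow>\<^sub>0 nat. \<forall>k. Poly_Mapping.lookup a k \<le> Poly_Mapping.lookup m k}" (is "finite ?A")
proof (rule finite_imageD)
  let ?r = "\<lambda>a :: nat \<Rightarrow>\<^sub>0 nat. restrict (Poly_Mapping.lookup a) (Poly_Mapping.keys m)"
  have "?r ` ?A \<subseteq> (\<Pi>\<^sub>E k\<in>Poly_Mapping.keys m. {..Poly_Mapping.lookup m k})"
    by auto
  then show "finite (?r ` ?A)"
    by (rule finite_subset) (auto intro: finite_PiE)
  show "inj_on ?r ?A"
  proof (rule inj_onI, rule poly_mapping_eqI)
    fix a b :: "nat \<Rightarrow>\<^sub>0 nat" and k
    assume ab: "a \<in> ?A" "b \<in> ?A" and eq: "?r a = ?r b"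
    show "Poly_Mapping.lookup a k = Poly_Mapping.lookup b k"
    proof (cases "k \<in> Poly_Mapping.keys m")
      case True
      then show ?thesis using fun_cong[OF eq, of k] by simp
    next
      case False
      then have "Poly_Mapping.lookup m k = 0" by (simp add: in_keys_iff)
      then have "Poly_Mapping.lookup a k \<le> 0" "Poly_Mapping.lookup b k \<le> 0" using ab by (metis mem_Collect_eq)+
      then show ?thesis by simp
    qed
  qed
qed

definition monomial_splits :: "(nat \<Rightarrow>\<^sub>0 nat) \<Rightarrow> ((nat \<Rightarrow>\<^sub>0 nat) \<times> (nat \<Rightarrow>\<^sub>0 nat)) set" where
  "monomial_splits m = {(a, b). a + b = m}"

lemma finite_monomial_splits [simp]: "finite (monomial_splits m)"
proof (rule finite_subset)
  show "monomial_splits m \<subseteq>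
    {a. \<forall>k. Poly_Mapping.lookup a k \<le> Poly_Mapping.lookup m k} \<times>
    {a. \<forall>k. Poly_Mapping.lookup a k \<le> Poly_Mapping.lookup m k}"
    by (auto simp: monomial_splits_def lookup_add)
qed (simp add: finite_monomial_le)

instantiation mfps :: (comm_ring_1) comm_ring_1
begin

lift_definition zero_mfps :: "'a mfps" is "\<lambda>_. 0" .
lift_definition one_mfps :: "'a mfps" is "\<lambda>m. if m = 0 then 1 else 0" .
lift_definition plus_mfps :: "'a mfps \<Rightarrow> 'a mfps \<Rightarrow> 'a mfps" is "\<lambda>f g m. f m + g m" .
lift_definition minus_mfps :: "'a mfps \<Rightarrow> 'a mfps \<Rightarrow> 'a mfps" is "\<lambda>f g m. f m - g m" .
lift_definition uminus_mfps :: "'a mfps \<Rightarrow> 'a mfps" is "\<lambda>f m. - f m" .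
lift_definition times_mfps :: "'a mfps \<Rightarrow> 'a mfps \<Rightarrow> 'a mfps"
  is "\<lambda>f g m. \<Sum>(a, b)\<in>monomial_splits m. f a * g b" .

instance
proof
  fix f g h :: "'a mfps"
  show "f * g * h = f * (g * h)"
  proof (rule mfps_eqI)
    fix m
    have "mcoeff (f * g * h) m = (\<Sum>((a, b), (c, d))\<in>(SIGMA p:monomial_splits m. monomial_splits (fst p)).
            mcoeff f c * mcoeff g d * mcoeff h b)"
      by (simp add: times_mfps.rep_eq sum_distrib_right case_prod_unfold sum.Sigma)
    also have "\<dots> = (\<Sum>((a, b), (c, d))\<in>(SIGMA p:monomial_splits m. monomial_splits (snd p)).
            mcoeff f a * (mcoeff g c * mcoeff h d))"
      by (rule sum.reindex_bij_witness[where
            i = "\<lambda>((a, b), (c, d)). ((a + c, d), (a, c))" and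
            j = "\<lambda>((a, b), (c, d)). ((c, d + b), (d, b))"])
         (auto simp: monomial_splits_def add.assoc mult.assoc)
    also have "\<dots> = mcoeff (f * (g * h)) m"
      by (simp add: times_mfps.rep_eq sum_distrib_left case_prod_unfold sum.Sigma)
    finally show "mcoeff (f * g * h) m = mcoeff (f * (g * h)) m" .
  qed
  show "f * g = g * f"
  proof (rule mfps_eqI)
    fix m
    show "mcoeff (f * g) m = mcoeff (g * f) m"
      unfolding times_mfps.rep_eq
      by (rule sum.reindex_bij_witness[where i = prod.swap and j = prod.swap])
         (auto simp: monomial_splits_def ac_simps)
  qed
  show "1 * f = f"
  proof (rule mfps_eqI)
    fix m
    have "mcoeff (1 * f) m = (\<Sum>(a, b)\<in>{(0, m)}. mcoeff 1 a * mcoeff f b)"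
      unfolding times_mfps.rep_eq
    proof (rule sum.mono_neutral_right)
      show "{(0, m)} \<subseteq> monomial_splits m"
        by (simp add: monomial_splits_def)
      show "\<forall>p\<in>monomial_splits m - {(0, m)}. (case p of (a, b) \<Rightarrow> mcoeff 1 a * mcoeff f b) = 0"
      proof
        fix p assume "p \<in> monomial_splits m - {(0, m)}"
        then have "fst p \<noteq> 0"
          by (auto simp: monomial_splits_def)
        then show "(case p of (a, b) \<Rightarrow> mcoeff 1 a * mcoeff f b) = 0"
          by (simp add: one_mfps.rep_eq case_prod_unfold)
      qed
    qed simp
    then show "mcoeff (1 * f) m = mcoeff f m"
      by (simp add: one_mfps.rep_eq)
  qed
  show "(f + g) * h = f * h + g * h"
    by (rule mfps_eqI)
       (simp add: times_mfps.rep_eq plus_mfps.rep_eq distrib_right sum.distrib case_prod_unfold)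
  show "(0 :: 'a mfps) \<noteq> 1"
    by (metis one_mfps.rep_eq zero_mfps.rep_eq zero_neq_one)
qed (auto intro!: mfps_eqI simp: plus_mfps.rep_eq minus_mfps.rep_eq uminus_mfps.rep_eq zero_mfps.rep_eq)

end

text \<open>The inverse is the ring-theoretic one, with value 0 on non-units.\<close>

instantiation mfps :: (comm_ring_1) inverse
begin

definition inverse_mfps :: "'a mfps \<Rightarrow> 'a mfps" where
  "inverse f = (if \<exists>g. f * g = 1 then THE g. f * g = 1 else 0)" for f :: "'a mfps"

definition divide_mfps :: "'a mfps \<Rightarrow> 'a mfps \<Rightarrow> 'a mfps" where
  "f div g = f * inverse g" for f g :: "'a mfps"

instance ..

end

text \<open>The topology is that of coefficientwise convergence.\<close>

instantiation mfps :: (topological_space) topological_space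
begin

definition open_mfps :: "'a mfps set \<Rightarrow> bool" where
  "open U \<longleftrightarrow> open (mcoeff ` U)"

instance
proof
  have bij: "bij (mcoeff :: 'a mfps \<Rightarrow> _)"
    by (metis bijI' mcoeff_Abs mcoeff_inject)
  then have inj: "inj (mcoeff :: 'a mfps \<Rightarrow> _)"
    by (rule bij_is_inj)
  show "open (UNIV :: 'a mfps set)"
    using bij by (simp add: open_mfps_def bij_is_surj)
  show "open (S \<inter> T)" if "open S" "open T" for S T :: "'a mfps set"
    using that inj by (auto simp: open_mfps_def image_Int)
  show "open (\<Union>K)" if "\<forall>S\<in>K. open S" for K :: "'a mfps set set"
    using that by (auto simp: open_mfps_def image_Union)
qed

end

instance mfps :: (t2_space) t2_space
proof
  fix f g :: "'a mfps"
  assume "f \<noteq> g"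
  then obtain m where "mcoeff f m \<noteq> mcoeff g m"
    using mfps_eqI by blast
  then obtain U V where UV: "open U" "open V" "mcoeff f m \<in> U" "mcoeff g m \<in> V" "U \<inter> V = {}"
    by (meson hausdorff)
  have op: "open {f. mcoeff f m \<in> W}" if "open W" for W :: "'a set"
  proof -
    have "mcoeff ` {f. mcoeff f m \<in> W} = (\<lambda>c. c m) -` W"
      by (auto simp: image_iff) (metis mcoeff_Abs)
    moreover have "open ((\<lambda>c :: (nat \<Rightarrow>\<^sub>0 nat) \<Rightarrow> 'a. c m) -` W)"
      using that by (intro open_vimage continuous_on_product_coordinates)
    ultimately show ?thesis
      by (simp add: open_mfps_def)
  qed
  show "\<exists>U V. open U \<and> open V \<and> f \<in> U \<and> g \<in> V \<and> U \<inter> V = {}"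
    using UV op[OF UV(1)] op[OF UV(2)]
    by (intro exI[of _ "{f. mcoeff f m \<in> U}"] exI[of _ "{f. mcoeff f m \<in> V}"]) auto
qed

definition mconst :: "'a::zero \<Rightarrow> 'a mfps" where
  "mconst c = Abs_mfps (\<lambda>m. if m = 0 then c else 0)"

definition mvar :: "nat \<Rightarrow> 'a::zero_neq_one mfps" where
  "mvar i = Abs_mfps (\<lambda>m. if m = Poly_Mapping.single i 1 then 1 else 0)"

text \<open>Unordered infinite product, the multiplicative analogue of \<^const>\<open>infsum\<close>.\<close>

definition infprod :: "('i \<Rightarrow> 'b::{comm_monoid_mult,t2_space}) \<Rightarrow> 'i set \<Rightarrow> 'b" where
  "infprod f A = Lim (finite_subsets_at_top A) (prod f)"

definition qpochhammer_inf :: "'a::{t2_space,comm_ring_1} \<Rightarrow> 'a \<Rightarrow> 'a" where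
  "qpochhammer_inf a q = prodinf (\<lambda>k. 1 - a * q ^ k)"


section \<open>Partitions\<close>

text \<open>
  A partition is the weakly decreasing list of its nonzero parts. Rows, columns and parts are
  numbered from 1, and \<open>part la i\<close> is 0 beyond the last row.
\<close>

definition is_partition :: "nat list \<Rightarrow> bool" where
  "is_partition la \<longleftrightarrow> sorted_wrt (\<ge>) la \<and> 0 \<notin> set la"

definition part :: "nat list \<Rightarrow> nat \<Rightarrow> nat" where
  "part la i = (if 1 \<le> i \<and> i \<le> length la then la ! (i - 1) else 0)"

definition conjugate :: "nat list \<Rightarrow> nat list" where
  "conjugate la = map (\<lambda>j. card {i. 1 \<le> i \<and> j \<le> part la i}) [1..<part la 1 + 1]"

definition diagram :: "nat list \<Rightarrow> (nat \<times> nat) set" where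
  "diagram la = {(i, j). 1 \<le> i \<and> 1 \<le> j \<and> j \<le> part la i}"

text \<open>
  The subtractions are arranged so that they do not truncate on boxes of the diagram, where
  \<open>j \<le> part la i\<close> and \<open>i \<le> part (conjugate la) j\<close>. The same remark applies to the exponent of
  \<open>-1\<close> in \<open>b_stat\<close> below.
\<close>

definition hook :: "nat list \<Rightarrow> nat \<times> nat \<Rightarrow> nat" where
  "hook la = (\<lambda>(i, j). (part la i - j) + (part (conjugate la) j - i) + 1)"

definition hook_lengths :: "nat list \<Rightarrow> nat multiset" where
  "hook_lengths la = image_mset (hook la) (mset_set (diagram la))"

definition even_hook_lengths :: "nat list \<Rightarrow> nat multiset" where
  "even_hook_lengths la = filter_mset even (hook_lengths la)"

definition odd_hook_lengths :: "nat list \<Rightarrow> nat multiset" where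
  "odd_hook_lengths la = filter_mset odd (hook_lengths la)"

definition b_stat :: "nat list \<Rightarrow> int" where
  "b_stat la = (\<Sum>(i, j)\<in>diagram la.
     (-1) ^ (part la i + part (conjugate la) j + 1 - i - j) * (int (part la i) - int i))"

definition is_domino :: "(nat \<times> nat) set \<Rightarrow> bool" where
  "is_domino d \<longleftrightarrow> (\<exists>i j. d = {(i, j), (i, j + 1)} \<or> d = {(i, j), (i + 1, j)})"

definition empty_2core :: "nat list \<Rightarrow> bool" where
  "empty_2core la \<longleftrightarrow> (\<exists>P. partition_on (diagram la) P \<and> (\<forall>d\<in>P. is_domino d))"


section \<open>Schur functions\<close>

text \<open>
  Semistandard Young tableaux: rows weakly increasing, columns strictly increasing. In accordance
  with the numbering of the variables, entries are natural numbers including 0, and an entry \<open>k\<close>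
  contributes the variable \<open>mvar k\<close>. Outside the diagram a tableau is \<open>undefined\<close>, so that
  distinct tableaux are distinct functions.
\<close>

definition ssyt :: "nat list \<Rightarrow> (nat \<times> nat \<Rightarrow> nat) set" where
  "ssyt la = {T \<in> extensional (diagram la).
     (\<forall>i j. (i, j) \<in> diagram la \<and> (i, j + 1) \<in> diagram la \<longrightarrow> T (i, j) \<le> T (i, j + 1)) \<and>
     (\<forall>i j. (i, j) \<in> diagram la \<and> (i + 1, j) \<in> diagram la \<longrightarrow> T (i, j) < T (i + 1, j))}"

definition content :: "nat list \<Rightarrow> (nat \<times> nat \<Rightarrow> nat) \<Rightarrow> (nat \<Rightarrow>\<^sub>0 nat)" where
  "content la T = (\<Sum>s\<in>diagram la. Poly_Mapping.single (T s) 1)"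

text \<open>The coefficient of $x^m$ in $s_\lambda = \sum_T x^T$.\<close>

definition schur :: "nat list \<Rightarrow> 'a::comm_ring_1 mfps" where
  "schur la = Abs_mfps (\<lambda>m. of_nat (card {T \<in> ssyt la. content la T = m}))"

end

(*
  Restrict the identity to the first n variables, n even, and multiply it by the Vandermonde
  product. By the bialternant formula it then says that the coefficient of x^l in
  prod_i g(x_i) * prod_{i<j} (x_i - x_j) / (1 - x_i x_j) vanishes unless half of the l_i are even and
  is then, up to a factor depending on each single l_i, the product over i<j of
  (q^{l_i} - q^{l_j})^(+1 or -1), with +1 for pairs of equal and -1 for pairs of different parity.
  Indeed the hook lengths and the statistic b can be read off the beta numbers
  l_i = lambda_i + n - i, and the 2-core of lambda is empty if and only if half of them are even.
  Both these coefficients and the explicit products satisfy the expansion of a Pfaffian along its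
  first row, which is a partial fraction identity in either case. This reduces the claim to
  two variables, where it is a recurrence for q-binomial coefficients. The case q = 0 follows by
  continuity.
*)
theory Submission
imports
  Defs
  "HOL-Computational_Algebra.Polynomial_Factorial"
  "Jordan_Normal_Form.Determinant"
begin

hide_const (open) Conjugate.conjugate

text \<open>A Pfaffian is never defined. It enters only through its first-row expansion, so two
  families agree as soon as both satisfy that expansion. On the side of the series the entries are
  g(x_i) g(x_j) (x_i - x_j)/(1 - x_i x_j). In every term of the expansion each variable occurs in
  exactly one entry, hence the coefficient of x^l in the Pfaffian is the Pfaffian of the
  coefficients. These vanish for exponents a, b of equal parity and have the form W(a) W(b)/(u_b -
  u_a) otherwise, so their Pfaffian is, up to sign and the factors W, a Cauchy determinant with the
  even exponents as rows and the odd ones as columns. This explains both the balance condition and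
  the product of differences. The choice u_l = q^l separates the parities only for q \<noteq> 0,
  because all positive powers of 0 coincide; at q = 0 the closed form breaks down while the
  coefficients of the product stay continuous. Finally, the Vandermonde product can be cancelled
  because the series form an integral domain, and even n suffice because every monomial involves
  finitely many variables.\<close>

abbreviation lookup :: "('a \<Rightarrow>\<^sub>0 'b::zero) \<Rightarrow> 'a \<Rightarrow> 'b" where "lookup \<equiv> Poly_Mapping.lookup"
abbreviation keys :: "('a \<Rightarrow>\<^sub>0 'b::zero) \<Rightarrow> 'a set" where "keys \<equiv> Poly_Mapping.keys"

section \<open>Coefficients and truncations of power series\<close>

lemma mcoeff_zero [simp]: "mcoeff 0 m = 0" by (simp add: zero_mfps.rep_eq)
lemma mcoeff_one: "mcoeff 1 m = (if m = 0 then 1 else 0)" by (simp add: one_mfps.rep_eq)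
lemma mcoeff_plus [simp]: "mcoeff (f + g) m = mcoeff f m + mcoeff g m" by (simp add: plus_mfps.rep_eq)
lemma mcoeff_minus [simp]: "mcoeff (f - g) m = mcoeff f m - mcoeff g m" by (simp add: minus_mfps.rep_eq)
lemma mcoeff_uminus [simp]: "mcoeff (- f) m = - mcoeff f m" by (simp add: uminus_mfps.rep_eq)
lemma mcoeff_times: "mcoeff (f * g) m = (\<Sum>(a, b)\<in>monomial_splits m. mcoeff f a * mcoeff g b)"
  by (simp add: times_mfps.rep_eq)
lemma mcoeff_sum [simp]: "mcoeff (sum f A) m = (\<Sum>i\<in>A. mcoeff (f i) m)"
  by (induction A rule: infinite_finite_induct) auto

lemma keys_add_nat: "Poly_Mapping.keys (a + b) = keys a \<union> keys (b :: nat \<Rightarrow>\<^sub>0 nat)"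
  by (auto simp: in_keys_iff lookup_add)

lemma monomial_splits_iff: "(a, b) \<in> monomial_splits m \<longleftrightarrow> a + b = m"
  by (simp add: monomial_splits_def)

definition mrestr :: "nat set \<Rightarrow> (nat \<Rightarrow>\<^sub>0 nat) \<Rightarrow> (nat \<Rightarrow>\<^sub>0 nat)" where
  "mrestr A m = Abs_poly_mapping (\<lambda>k. lookup m k when k \<in> A)"

lemma lookup_mrestr: "lookup (mrestr A m) k = (lookup m k when k \<in> A)"
proof -
  have "finite {k. (lookup m k when k \<in> A) \<noteq> 0}"
    by (rule finite_subset[OF _ finite_keys[of m]]) (auto simp: in_keys_iff when_def)
  then show ?thesis
    unfolding mrestr_def by (subst Abs_poly_mapping_inverse) auto
qed

lemma keys_mrestr: "keys (mrestr A m) = keys m \<inter> A"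
  by (auto simp: in_keys_iff lookup_mrestr when_def split: if_splits)

definition vars_in :: "nat set \<Rightarrow> 'a::zero mfps \<Rightarrow> bool" where
  "vars_in A f \<longleftrightarrow> (\<forall>m. mcoeff f m \<noteq> 0 \<longrightarrow> keys m \<subseteq> A)"

lemma vars_inD: "vars_in A f \<Longrightarrow> \<not> keys m \<subseteq> A \<Longrightarrow> mcoeff f m = 0"
  by (auto simp: vars_in_def)

lemma vars_inI: "(\<And>m. \<not> keys m \<subseteq> A \<Longrightarrow> mcoeff f m = 0) \<Longrightarrow> vars_in A f"
  by (auto simp: vars_in_def)

lemma vars_in_mono: "vars_in A f \<Longrightarrow> A \<subseteq> B \<Longrightarrow> vars_in B f"
  by (auto simp: vars_in_def)

text \<open>A monomial splits in only one way into a part over \<open>A\<close> and a part over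
  \<open>B\<close>, so the convolution has at most one nonzero term. This is what turns coefficients
  of a product of Pfaffian entries in separate variables into products of coefficients.\<close>

lemma mcoeff_times_disjoint:
  fixes f g :: "'a::comm_ring_1 mfps"
  assumes f: "vars_in A f" and g: "vars_in B g" and AB: "A \<inter> B = {}"
  shows "mcoeff (f * g) m =
    (if keys m \<subseteq> A \<union> B then mcoeff f (mrestr A m) * mcoeff g (mrestr B m) else 0)"
proof -
  have eq: "a = mrestr A m \<and> b = mrestr B m"
    if "a + b = m" "mcoeff f a * mcoeff g b \<noteq> 0" for a b
  proof -
    have ka: "keys a \<subseteq> A" and kb: "keys b \<subseteq> B"
      using that(2) vars_inD[OF f, of a] vars_inD[OF g, of b] by fastforce+
    have "lookup a k = (lookup m k when k \<in> A) \<and> lookup b k = (lookup m k when k \<in> B)" for k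
    proof -
      have "k \<notin> A \<Longrightarrow> lookup a k = 0" "k \<notin> B \<Longrightarrow> lookup b k = 0" "k \<notin> A \<or> k \<notin> B"
        using ka kb AB by (auto simp: in_keys_iff)
      moreover have "lookup m k = lookup a k + lookup b k" using that(1) by (auto simp: lookup_add)
      ultimately show ?thesis by (auto simp: when_def)
    qed
    then show ?thesis by (auto intro!: poly_mapping_eqI simp: lookup_mrestr)
  qed
  show ?thesis
  proof (cases "keys m \<subseteq> A \<union> B")
    case True
    have sp: "mrestr A m + mrestr B m = m"
      using True AB by (intro poly_mapping_eqI) (auto simp: lookup_add lookup_mrestr when_def in_keys_iff)
    have "mcoeff (f * g) m = (\<Sum>(a, b)\<in>{(mrestr A m, mrestr B m)}. mcoeff f a * mcoeff g b)"
      unfolding mcoeff_times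
    proof (rule sum.mono_neutral_right)
      show "\<forall>p\<in>monomial_splits m - {(mrestr A m, mrestr B m)}. (case p of (a, b) \<Rightarrow> mcoeff f a * mcoeff g b) = 0"
      proof
        fix p assume p: "p \<in> monomial_splits m - {(mrestr A m, mrestr B m)}"
        obtain a b where pe: "p = (a, b)" by force
        have "a + b = m" using p pe by (simp add: monomial_splits_iff)
        moreover have "\<not> (a = mrestr A m \<and> b = mrestr B m)" using p pe by blast
        ultimately have "mcoeff f a * mcoeff g b = 0" using eq[of a b] by blast
        then show "(case p of (a, b) \<Rightarrow> mcoeff f a * mcoeff g b) = 0" using pe by simp
      qed
    qed (use sp in \<open>auto simp: monomial_splits_iff\<close>)
    then show ?thesis using True by simp
  next
    case False
    have "(case p of (a, b) \<Rightarrow> mcoeff f a * mcoeff g b) = 0" if "p \<in> monomial_splits m" for p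
    proof (rule ccontr)
      assume *: "\<not> ?thesis"
      obtain a b where p: "p = (a, b)" by force
      from * p that eq[of a b] have ab: "a = mrestr A m" "b = mrestr B m" "a + b = m"
        by (auto simp: monomial_splits_iff)
      then have "keys m = keys a \<union> keys b" using keys_add_nat[of a b] by simp
      then show False using ab False by (auto simp: keys_mrestr)
    qed
    then show ?thesis using False by (simp add: mcoeff_times)
  qed
qed

lemma vars_in_1 [simp]: "vars_in A (1 :: 'a::comm_ring_1 mfps)"
  by (auto simp: vars_in_def mcoeff_one split: if_splits)

lemma vars_in_minus: "vars_in A f \<Longrightarrow> vars_in A g \<Longrightarrow> vars_in A (f - g)"
  for f g :: "'a::comm_ring_1 mfps"
  by (rule vars_inI) (simp add: vars_inD)

lemma vars_in_times:
  fixes f g :: "'a::comm_ring_1 mfps"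
  assumes "vars_in A f" "vars_in A g"
  shows "vars_in A (f * g)"
proof (rule vars_inI)
  fix m :: "nat \<Rightarrow>\<^sub>0 nat" assume m: "\<not> keys m \<subseteq> A"
  have "mcoeff f a * mcoeff g b = 0" if "a + b = m" for a b
  proof -
    have "\<not> keys a \<subseteq> A \<or> \<not> keys b \<subseteq> A" using m keys_add_nat[of a b] that by auto
    then show ?thesis using vars_inD[OF assms(1), of a] vars_inD[OF assms(2), of b] by force
  qed
  then show "mcoeff (f * g) m = 0"
    by (auto simp: mcoeff_times monomial_splits_iff intro!: sum.neutral)
qed

lemma vars_in_prod:
  fixes f :: "'i \<Rightarrow> 'a::comm_ring_1 mfps"
  shows "(\<And>i. i \<in> I \<Longrightarrow> vars_in A (f i)) \<Longrightarrow> vars_in A (prod f I)"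
  by (induction I rule: infinite_finite_induct) (auto intro: vars_in_times)

lemma mcoeff_mvar: "mcoeff (mvar i) m = (if m = Poly_Mapping.single i 1 then 1 else 0)"
  by (simp add: mvar_def)

lemma vars_in_mvar: "i \<in> A \<Longrightarrow> vars_in A (mvar i :: 'a::comm_ring_1 mfps)"
  by (auto simp: vars_in_def mcoeff_mvar split: if_splits)

lemma mcoeff_mconst: "mcoeff (mconst c) m = (if m = 0 then c else 0)"
  by (simp add: mconst_def)

lemma mcoeff_single_times:
  fixes f g :: "'a::comm_ring_1 mfps"
  assumes "\<And>m. mcoeff g m = (if m = a then c else 0)"
  shows "mcoeff (g * f) m = (if \<exists>b. a + b = m then c * mcoeff f (m - a) else 0)"
proof (cases "\<exists>b. a + b = m")
  case True
  then obtain b where b: "a + b = m" by auto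
  then have mb: "m - a = b" by auto
  have "mcoeff (g * f) m = (\<Sum>(u, v)\<in>{(a, b)}. mcoeff g u * mcoeff f v)"
    unfolding mcoeff_times
    by (rule sum.mono_neutral_right) (use b in \<open>auto simp: monomial_splits_iff assms split: if_splits\<close>)
  then show ?thesis using True mb assms by simp
next
  case False
  then show ?thesis
    unfolding mcoeff_times by (auto intro!: sum.neutral simp: monomial_splits_iff assms)
qed

lemma mcoeff_mconst_times [simp]: "mcoeff (mconst c * f) m = c * mcoeff f (m :: nat \<Rightarrow>\<^sub>0 nat)"
  for f :: "'a::comm_ring_1 mfps"
  by (subst mcoeff_single_times[where a = 0 and c = c]) (auto simp: mcoeff_mconst)

lemma single_1_add_iff: "(\<exists>b. Poly_Mapping.single i 1 + b = m) \<longleftrightarrow> lookup m i \<ge> (1::nat)"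
proof
  assume "\<exists>b. Poly_Mapping.single i 1 + b = m"
  then show "lookup m i \<ge> (1::nat)" by (auto simp: lookup_add)
next
  assume "lookup m i \<ge> (1::nat)"
  then have "Poly_Mapping.single i 1 + (m - Poly_Mapping.single i 1) = m"
    by (intro poly_mapping_eqI) (auto simp: lookup_add lookup_minus lookup_single when_def)
  then show "\<exists>b. Poly_Mapping.single i 1 + b = m" by blast
qed

lemma mcoeff_mvar_times:
  fixes f :: "'a::comm_ring_1 mfps"
  shows "mcoeff (mvar i * f) m = (if lookup m i \<ge> 1 then mcoeff f (m - Poly_Mapping.single i 1) else 0)"
  using mcoeff_single_times[of "mvar i" "Poly_Mapping.single i 1" 1 f m] single_1_add_iff[of i m]
  by (simp add: mcoeff_mvar)

text \<open>In infinitely many variables the lexicographic order is not well-founded: the unit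
  vectors at 0, 1, 2, ... form a descending chain. With \<open>n\<close> variables it embeds into
  the lexicographic order on lists of length \<open>n\<close>.\<close>

lemma wf_monomials_lex:
  "wf {(a :: nat \<Rightarrow>\<^sub>0 nat, b). a < b \<and> keys a \<subseteq> {..<n} \<and> keys b \<subseteq> {..<n}}" (is "wf ?R")
proof (rule wf_subset)
  let ?l = "\<lambda>a :: nat \<Rightarrow>\<^sub>0 nat. map (lookup a) [0..<n]"
  show "wf (inv_image (lexn less_than n) ?l)"
    by (intro wf_inv_image wf_lexn wf_less_than)
  show "?R \<subseteq> inv_image (lexn less_than n) ?l"
  proof clarify
    fix a b :: "nat \<Rightarrow>\<^sub>0 nat" assume ab: "a < b" "keys a \<subseteq> {..<n}" "keys b \<subseteq> {..<n}"
    from ab(1) have "less_fun (lookup a) (lookup b)" by (simp add: less_poly_mapping.rep_eq)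
    then obtain k where k: "lookup a k < lookup b k" "\<And>k'. k' < k \<Longrightarrow> lookup a k' = lookup b k'"
      by (auto simp: less_fun_def)
    then have "k < n" using ab(3) by (metis gr_implies_not0 in_keys_iff lessThan_iff subsetD)
    have n: "[0..<n] = [0..<k] @ k # [Suc k..<n]"
      using \<open>k < n\<close> upt_add_eq_append[of 0 k "n - k"] by (simp add: upt_conv_Cons)
    have la: "?l a = map (lookup a) [0..<k] @ lookup a k # map (lookup a) [Suc k..<n]"
      by (simp add: n)
    have "map (lookup b) [0..<k] = map (lookup a) [0..<k]" using k(2) by auto
    then have lb: "?l b = map (lookup a) [0..<k] @ lookup b k # map (lookup b) [Suc k..<n]"
      by (simp add: n)
    show "(a, b) \<in> inv_image (lexn less_than n) ?l"
      using k(1) \<open>k < n\<close> unfolding in_inv_image lexn_conv la lb by auto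
  qed
qed

text \<open>Substitution of 0 for the variables outside \<open>A\<close>; it respects products by
  \<open>mtrunc_times\<close>.\<close>

definition mtrunc :: "nat set \<Rightarrow> 'a::zero mfps \<Rightarrow> 'a mfps" where
  "mtrunc A f = Abs_mfps (\<lambda>m. if keys m \<subseteq> A then mcoeff f m else 0)"

lemma mcoeff_mtrunc: "mcoeff (mtrunc A f) m = (if keys m \<subseteq> A then mcoeff f m else 0)"
  by (simp add: mtrunc_def)

lemma vars_in_mtrunc: "vars_in A (mtrunc A f)"
  by (auto simp: vars_in_def mcoeff_mtrunc split: if_splits)

lemma mtrunc_ident: "vars_in A f \<Longrightarrow> mtrunc A f = f"
  by (rule mfps_eqI) (auto simp: vars_in_def mcoeff_mtrunc)

lemma mtrunc_times: "mtrunc A (f * g) = mtrunc A f * mtrunc A (g :: 'a::comm_ring_1 mfps)"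
proof (rule mfps_eqI)
  fix m
  show "mcoeff (mtrunc A (f * g)) m = mcoeff (mtrunc A f * mtrunc A g) m"
  proof (cases "keys m \<subseteq> A")
    case True
    then have "keys a \<subseteq> A \<and> keys b \<subseteq> A" if "a + b = m" for a b
      using that keys_add_nat[of a b] by auto
    then show ?thesis
      using True by (auto simp: mcoeff_mtrunc mcoeff_times monomial_splits_iff intro!: sum.cong)
  next
    case False
    then show ?thesis
      using vars_in_times[OF vars_in_mtrunc[of A f] vars_in_mtrunc[of A g]]
      by (auto simp: mcoeff_mtrunc vars_in_def)
  qed
qed

lemma mtrunc_1 [simp]: "mtrunc A (1 :: 'a::comm_ring_1 mfps) = 1"
  by (rule mtrunc_ident) simp

lemma mtrunc_prod: "mtrunc A (prod f I) = (\<Prod>i\<in>I. mtrunc A (f i :: 'a::comm_ring_1 mfps))"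
  by (induction I rule: infinite_finite_induct) (auto simp: mtrunc_times)

text \<open>The product of the terms of \<open>f\<close> and \<open>g\<close> that are lexicographically least does not cancel;
  truncation to finitely many variables guarantees that least terms exist.\<close>

instance mfps :: (idom) idom
proof
  fix f g :: "'a mfps"
  assume "f \<noteq> 0" "g \<noteq> 0"
  then obtain a b where ab: "mcoeff f a \<noteq> 0" "mcoeff g b \<noteq> 0"
    by (metis mcoeff_zero mfps_eqI)
  obtain n where n: "keys a \<union> keys b \<subseteq> {..<n}"
    by (meson finite_Un finite_keys finite_nat_iff_bounded)
  have ex: "\<exists>a. mcoeff f a \<noteq> 0 \<and> keys a \<subseteq> {..<n} \<and>
      (\<forall>a'. mcoeff f a' \<noteq> 0 \<longrightarrow> keys a' \<subseteq> {..<n} \<longrightarrow> a \<le> a')"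
    if "mcoeff f a \<noteq> 0" "keys a \<subseteq> {..<n}" for f :: "'a mfps" and a
  proof -
    let ?S = "{a. mcoeff f a \<noteq> 0 \<and> keys a \<subseteq> {..<n}}"
    have "a \<in> ?S" using that by simp
    from wf_monomials_lex[of n, unfolded wf_eq_minimal, THEN spec, THEN spec, THEN mp, OF this]
    obtain z where "z \<in> ?S"
      and z: "\<forall>y. (y, z) \<in> {(a :: nat \<Rightarrow>\<^sub>0 nat, b). a < b \<and> keys a \<subseteq> {..<n} \<and> keys b \<subseteq> {..<n}} \<longrightarrow> y \<notin> ?S"
      by (rule bexE)
    then have "mcoeff f z \<noteq> 0" "keys z \<subseteq> {..<n}" by simp_all
    moreover have "z \<le> a'" if "mcoeff f a' \<noteq> 0" "keys a' \<subseteq> {..<n}" for a'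
      using z[rule_format, of a'] that \<open>keys z \<subseteq> {..<n}\<close> not_le by blast
    ultimately show ?thesis by blast
  qed
  obtain a where a: "mcoeff f a \<noteq> 0" "keys a \<subseteq> {..<n}"
    "\<And>a'. mcoeff f a' \<noteq> 0 \<Longrightarrow> keys a' \<subseteq> {..<n} \<Longrightarrow> a \<le> a'"
    using ex[OF ab(1)] n by auto
  obtain b where b: "mcoeff g b \<noteq> 0" "keys b \<subseteq> {..<n}"
    "\<And>a'. mcoeff g a' \<noteq> 0 \<Longrightarrow> keys a' \<subseteq> {..<n} \<Longrightarrow> b \<le> a'"
    using ex[OF ab(2)] n by auto
  have "mcoeff (f * g) (a + b) = (\<Sum>(u, v)\<in>{(a, b)}. mcoeff f u * mcoeff g v)"
    unfolding mcoeff_times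
  proof (rule sum.mono_neutral_right)
    have "mcoeff f u * mcoeff g v = 0" if uv: "(u, v) \<in> monomial_splits (a + b)" "(u, v) \<noteq> (a, b)" for u v
    proof -
      have e: "u + v = a + b" using uv by (simp add: monomial_splits_iff)
      then have k: "keys u \<subseteq> {..<n}" "keys v \<subseteq> {..<n}"
        using a(2) b(2) keys_add_nat[of u v] keys_add_nat[of a b] by auto
      show "mcoeff f u * mcoeff g v = 0"
      proof (rule ccontr)
        assume "mcoeff f u * mcoeff g v \<noteq> 0"
        then have "a \<le> u" "b \<le> v" using a(3) b(3) k by auto
        have "v \<le> b"
        proof (rule ccontr)
          assume "\<not> v \<le> b"
          then have "a + b < a + v" by (simp add: add_strict_left_mono)
          also have "a + v \<le> u + v" using \<open>a \<le> u\<close> by (rule add_right_mono)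
          finally show False using e by simp
        qed
        with \<open>b \<le> v\<close> have "v = b" by simp
        with e have "u = a" by simp
        then show False using uv \<open>v = b\<close> by auto
      qed
    qed
    then show "\<forall>p\<in>monomial_splits (a + b) - {(a, b)}. (case p of (u, v) \<Rightarrow> mcoeff f u * mcoeff g v) = 0"
      by (intro ballI) (metis (no_types, lifting) Diff_iff case_prod_conv insertI1 surj_pair)
  qed (auto simp: monomial_splits_iff)
  then have "mcoeff (f * g) (a + b) \<noteq> 0" using a(1) b(1) by simp
  then show "f * g \<noteq> 0" by auto
qed

section \<open>Partial fractions and Pfaffian expansions\<close>

text \<open>The sum is the divided difference of \<open>p\<close> on \<open>S\<close>, that is, the
  coefficient of X^(card S - 1) in the Lagrange interpolant \<open>r\<close>. The interpolant is
  \<open>p\<close> itself, whose degree is too small for that coefficient. Both partial fraction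
  identities below are instances.\<close>

lemma sum_divided_difference_eq_0:
  fixes S :: "'a::field set"
  assumes S: "finite S" and p: "degree p + 1 < card S"
  shows "(\<Sum>s\<in>S. poly p s / (\<Prod>t\<in>S - {s}. s - t)) = 0"
proof -
  let ?B = "\<lambda>s. \<Prod>t\<in>S - {s}. [:- t, 1:]"
  define c where "c s = poly p s / (\<Prod>t\<in>S - {s}. s - t)" for s
  define r where "r = (\<Sum>s\<in>S. Polynomial.smult (c s) (?B s))"
  have degB: "degree (?B s) = card S - 1" if "s \<in> S" for s
    using that S by (subst degree_prod_sum_eq) auto
  have lcB: "coeff (?B s) (card S - 1) = 1" if "s \<in> S" for s
    using lead_coeff_prod[of "\<lambda>t. [:- t, 1:]" "S - {s}"] degB[OF that] by simp
  have polyB: "poly (?B s) u = (\<Prod>t\<in>S - {s}. u - t)" for s u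
    by (simp add: poly_prod)
  have "poly r u = poly p u" if u: "u \<in> S" for u
  proof -
    have "poly r u = (\<Sum>s\<in>S. c s * (\<Prod>t\<in>S - {s}. u - t))"
      by (simp add: r_def poly_sum polyB)
    also have "\<dots> = (\<Sum>s\<in>{u}. c s * (\<Prod>t\<in>S - {s}. u - t))"
      using S u by (intro sum.mono_neutral_right) (auto intro!: prod_zero)
    also have "\<dots> = poly p u"
      using S by (simp add: c_def prod_zero_iff)
    finally show ?thesis .
  qed
  moreover have "degree r < card S"
  proof -
    have "degree r \<le> card S - 1"
      unfolding r_def using degB by (intro degree_sum_le S) (auto intro: order_trans[OF degree_smult_le])
    then show ?thesis using p by simp
  qed
  ultimately have "r = p"
  proof (intro poly_eqI_degree[of S])
  qed (use p in auto)
  then have "coeff r (card S - 1) = 0" using p by (simp add: coeff_eq_0)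
  moreover have "coeff r (card S - 1) = (\<Sum>s\<in>S. c s)"
    unfolding r_def coeff_sum by (intro sum.cong refl) (simp only: coeff_smult lcB mult_1_right)
  ultimately show ?thesis by (simp add: c_def)
qed

section \<open>Products over pairs and their expansion along one index\<close>

definition pairs :: "nat set \<Rightarrow> (nat \<times> nat) set" where
  "pairs J = {(i, j). i \<in> J \<and> j \<in> J \<and> i < j}"

lemma finite_pairs [simp]: "finite J \<Longrightarrow> finite (pairs J)"
  by (rule finite_subset[of _ "J \<times> J"]) (auto simp: pairs_def)

definition pair_prod :: "(nat \<Rightarrow> nat \<Rightarrow> 'a::comm_monoid_mult) \<Rightarrow> nat set \<Rightarrow> 'a" where
  "pair_prod th J = (\<Prod>(i, j)\<in>pairs J. th i j)"

text \<open>The sign of moving \<open>j\<close> to the front of \<open>J\<close> listed in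
  increasing order, which is the alternating sign in the row expansion of a Pfaffian.\<close>

definition pos_sign :: "nat set \<Rightarrow> nat \<Rightarrow> 'a::comm_ring_1" where
  "pos_sign J j = (- 1) ^ card {i \<in> J. i < j}"

lemma pos_sign_square [simp]: "pos_sign J j * pos_sign J j = 1"
  by (simp add: pos_sign_def flip: power_add mult_2)

text \<open>All factors involving \<open>j\<close> are oriented as \<open>th j i\<close>; each of
  those with \<open>i < j\<close> costs one sign.\<close>

lemma pair_prod_remove:
  fixes th :: "nat \<Rightarrow> nat \<Rightarrow> 'a::comm_ring_1"
  assumes J: "finite J" "j \<in> J" and anti: "\<And>i j. i \<in> J \<Longrightarrow> j \<in> J \<Longrightarrow> i < j \<Longrightarrow> th j i = - th i j"
  shows "pair_prod th J = pos_sign J j * (\<Prod>i\<in>J - {j}. th j i) * pair_prod th (J - {j})"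
proof -
  let ?L = "{i \<in> J. i < j}" and ?R = "{i \<in> J. j < i}"
  have p: "pairs J = ((\<lambda>i. (i, j)) ` ?L \<union> (\<lambda>i. (j, i)) ` ?R) \<union> pairs (J - {j})"
    using J by (auto simp: pairs_def)
  have "pair_prod th J = (\<Prod>(i, j)\<in>(\<lambda>i. (i, j)) ` ?L \<union> (\<lambda>i. (j, i)) ` ?R. th i j) * pair_prod th (J - {j})"
    unfolding pair_prod_def p
  proof (rule prod.union_disjoint)
    show "((\<lambda>i. (i, j)) ` ?L \<union> (\<lambda>i. (j, i)) ` ?R) \<inter> pairs (J - {j}) = {}" by (auto simp: pairs_def)
  qed (use J in auto)
  also have "(\<Prod>(i, j)\<in>(\<lambda>i. (i, j)) ` ?L \<union> (\<lambda>i. (j, i)) ` ?R. th i j) =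
      (\<Prod>(i, j)\<in>(\<lambda>i. (i, j)) ` ?L. th i j) * (\<Prod>(i, j)\<in>(\<lambda>i. (j, i)) ` ?R. th i j)"
    using J by (intro prod.union_disjoint) auto
  also have "(\<Prod>(i, j)\<in>(\<lambda>i. (i, j)) ` ?L. th i j) = (\<Prod>i\<in>?L. th i j)"
    by (subst prod.reindex) (auto simp: inj_on_def)
  also have "\<dots> = (\<Prod>i\<in>?L. - 1 * th j i)"
    using anti J by (intro prod.cong) auto
  also have "\<dots> = pos_sign J j * (\<Prod>i\<in>?L. th j i)"
    by (subst prod.distrib) (simp add: pos_sign_def)
  also have "(\<Prod>(i, j)\<in>(\<lambda>i. (j, i)) ` ?R. th i j) = (\<Prod>i\<in>?R. th j i)"
    by (subst prod.reindex) (auto simp: inj_on_def)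
  also have "pos_sign J j * (\<Prod>i\<in>?L. th j i) * (\<Prod>i\<in>?R. th j i) = pos_sign J j * (\<Prod>i\<in>?L \<union> ?R. th j i)"
    using J by (subst prod.union_disjoint) (auto simp: mult.assoc)
  also have "?L \<union> ?R = J - {j}" by auto
  finally show ?thesis .
qed

text \<open>The residues of $f(t)(z-t)/((1-tz)(1-t^2)\prod_k(t-y_k))$ with $f(t)=\prod_k(1-ty_k)$ add up to zero.\<close>

lemma schur_partial_fractions:
  fixes y :: "'i \<Rightarrow> 'a::field"
  assumes J: "finite J" "odd (card J)" and inj: "inj_on y J"
    and two: "(2 :: 'a) \<noteq> 0" and z: "z \<noteq> 0" "z \<noteq> 1" "z \<noteq> - 1"
    and y: "\<And>j. j \<in> J \<Longrightarrow> y j \<noteq> 1" "\<And>j. j \<in> J \<Longrightarrow> y j \<noteq> - 1" "\<And>j. j \<in> J \<Longrightarrow> z * y j \<noteq> 1"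
  shows "(\<Prod>j\<in>J. (z - y j) / (1 - z * y j)) =
    (\<Sum>j\<in>J. (z - y j) / (1 - z * y j) * (\<Prod>i\<in>J - {j}. (1 - y j * y i) / (y j - y i)))"
proof -
  define f where "f = (\<Prod>k\<in>J. [:1, - y k:])"
  define p where "p = f * [:z, - 1:]"
  have polyf: "poly f t = (\<Prod>k\<in>J. 1 - y k * t)" for t by (simp add: f_def poly_prod mult.commute)
  have "degree f \<le> card J"
  proof -
    have "degree f \<le> (\<Sum>k\<in>J. degree [:1, - y k:])"
      unfolding f_def by (rule degree_prod_sum_le[OF J(1), unfolded o_def])
    also have "\<dots> \<le> (\<Sum>k\<in>J. 1)" by (intro sum_mono) simp
    finally show ?thesis by simp
  qed
  then have degp: "degree p \<le> card J + 1"
    using degree_mult_le[of f "[:z, - 1:]"] by (simp add: p_def)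
  define Y where "Y = y ` J"
  \<comment> \<open>The nodes are the poles, all simple. Those at 1 and -1 contribute z/2 and -z/2
    and cancel; the one at 1/z gives -z times the left-hand side, and each \<open>y j\<close> gives
    z times one summand of the right-hand side.\<close>
  define S where "S = insert 1 (insert (- 1) (insert (inverse z) Y))"
  have m1: "(1 :: 'a) \<noteq> - 1" using two by (simp add: eq_neg_iff_add_eq_0)
  have zi: "inverse z \<noteq> 1" "inverse z \<noteq> - 1"
    using z by (auto simp: inverse_eq_iff_eq dest: arg_cong[where f = inverse])
  have "z * inverse z = 1" using z by simp
  then have zY: "inverse z \<notin> Y" "1 \<notin> Y" "- 1 \<notin> Y"
    using y unfolding Y_def image_iff by metis+
  have fY: "finite Y" using J by (simp add: Y_def)
  have cY: "card Y = card J" using inj by (simp add: Y_def card_image)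
  have "card S = card J + 3" using m1 zi zY fY cY by (simp add: S_def)
  then have "(\<Sum>s\<in>S. poly p s / (\<Prod>t\<in>S - {s}. s - t)) = 0"
    using degp fY by (intro sum_divided_difference_eq_0) (auto simp: S_def)
  moreover have "(\<Sum>s\<in>S. poly p s / (\<Prod>t\<in>S - {s}. s - t)) =
     poly p 1 / (\<Prod>t\<in>S - {1}. 1 - t) + (poly p (- 1) / (\<Prod>t\<in>S - {- 1}. - 1 - t) +
      (poly p (inverse z) / (\<Prod>t\<in>S - {inverse z}. inverse z - t) + (\<Sum>s\<in>Y. poly p s / (\<Prod>t\<in>S - {s}. s - t))))"
    using m1 zi zY fY by (subst S_def) (simp)
  moreover have "poly p 1 / (\<Prod>t\<in>S - {1}. 1 - t) = z / 2"
  proof -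
    have e: "S - {1} = insert (- 1) (insert (inverse z) Y)" using m1 zi zY by (auto simp: S_def)
    have "(\<Prod>t\<in>Y. 1 - t) = (\<Prod>k\<in>J. 1 - y k)" unfolding Y_def by (rule prod.reindex_cong[OF inj]) auto
    moreover have "(\<Prod>k\<in>J. 1 - y k) \<noteq> 0" using J y by auto
    moreover have "z - 1 \<noteq> 0" "1 - inverse z = (z - 1) / z" using z by (auto simp: field_simps)
    moreover have "(\<Prod>t\<in>S - {1}. 1 - t) = 2 * ((1 - inverse z) * (\<Prod>t\<in>Y. 1 - t))"
      unfolding e using zi zY fY by simp
    moreover have "poly p 1 = (\<Prod>k\<in>J. 1 - y k) * (z - 1)" by (simp add: p_def polyf algebra_simps)
    moreover have "a * w / (2 * (w / z * a)) = z / 2" if "a \<noteq> 0" "w \<noteq> 0" for a w :: 'a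
      using that two z(1) by (simp add: divide_simps)
    ultimately show ?thesis by metis
  qed
  \<comment> \<open>The cancellation against the pole at 1 rests on \<open>odd (card J)\<close>:
    pulling -1 out of every factor -1 - y k leaves a single minus sign.\<close>
  moreover have "poly p (- 1) / (\<Prod>t\<in>S - {- 1}. - 1 - t) = - z / 2"
  proof -
    have e: "S - {- 1} = insert 1 (insert (inverse z) Y)" using m1 zi zY by (auto simp: S_def)
    have "(\<Prod>t\<in>Y. - 1 - t) = (\<Prod>k\<in>J. - 1 * (1 + y k))" unfolding Y_def by (rule prod.reindex_cong[OF inj]) auto
    also have "\<dots> = - (\<Prod>k\<in>J. 1 + y k)" by (subst prod.distrib) (use J in simp)
    finally have 1: "(\<Prod>t\<in>Y. - 1 - t) = - (\<Prod>k\<in>J. 1 + y k)" .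
    have 2: "(\<Prod>k\<in>J. 1 + y k) \<noteq> 0" using J y by (auto simp: add_eq_0_iff)
    have 3: "z + 1 \<noteq> 0" using z by (simp add: eq_neg_iff_add_eq_0)
    have 4: "- 1 - inverse z = - (z + 1) / z" using z by (simp add: field_simps)
    have 5: "(\<Prod>t\<in>S - {- 1}. - 1 - t) = - 2 * ((- 1 - inverse z) * (\<Prod>t\<in>Y. - 1 - t))"
      unfolding e using zi zY fY by simp
    have 6: "poly p (- 1) = (\<Prod>k\<in>J. 1 + y k) * (z + 1)" by (simp add: p_def polyf algebra_simps)
    have 7: "a * w / (- 2 * (- w / z * - a)) = - z / 2" if "a \<noteq> 0" "w \<noteq> 0" for a w :: 'a
      using that two z(1) by (simp add: divide_simps)
    show ?thesis unfolding 5 6 4 1 by (rule 7[OF 2 3])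
  qed
  moreover have "poly p (inverse z) / (\<Prod>t\<in>S - {inverse z}. inverse z - t) = - z * (\<Prod>j\<in>J. (z - y j) / (1 - z * y j))"
  proof -
    have e: "S - {inverse z} = insert 1 (insert (- 1) Y)" using m1 zi zY by (auto simp: S_def)
    have "(\<Prod>t\<in>Y. inverse z - t) = (\<Prod>k\<in>J. inverse z * (1 - z * y k))"
      unfolding Y_def by (rule prod.reindex_cong[OF inj]) (use z in \<open>auto simp: field_simps\<close>)
    then have 1: "(\<Prod>t\<in>Y. inverse z - t) = (\<Prod>k\<in>J. inverse z) * (\<Prod>k\<in>J. 1 - z * y k)" by (simp only: prod.distrib)
    have "poly f (inverse z) = (\<Prod>k\<in>J. inverse z * (z - y k))"
      unfolding polyf by (rule prod.cong) (use z in \<open>auto simp: field_simps\<close>)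
    then have 2: "poly f (inverse z) = (\<Prod>k\<in>J. inverse z) * (\<Prod>k\<in>J. z - y k)" by (simp only: prod.distrib)
    have 3: "(\<Prod>k\<in>J. inverse z) \<noteq> 0" using z J by simp
    have 4: "(\<Prod>k\<in>J. 1 - z * y k) \<noteq> 0" using y J by auto
    have 5: "z - inverse z \<noteq> 0"
    proof
      assume "z - inverse z = 0"
      then have "z * z = 1" using z by (simp add: field_simps)
      then have "(z - 1) * (z + 1) = 0" by (simp add: algebra_simps)
      then show False using z by (auto simp: eq_neg_iff_add_eq_0)
    qed
    have 6: "(inverse z - 1) * (inverse z + 1) = - inverse z * (z - inverse z)"
      using z by (simp add: field_simps)
    have "(\<Prod>t\<in>S - {inverse z}. inverse z - t) = ((inverse z - 1) * (inverse z + 1)) * ((\<Prod>k\<in>J. inverse z) * (\<Prod>k\<in>J. 1 - z * y k))"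
      unfolding e using m1 zY fY 1 by simp
    also have "\<dots> = - inverse z * (z - inverse z) * ((\<Prod>k\<in>J. inverse z) * (\<Prod>k\<in>J. 1 - z * y k))"
      unfolding 6 ..
    finally have 7: "(\<Prod>t\<in>S - {inverse z}. inverse z - t) = - inverse z * (z - inverse z) * ((\<Prod>k\<in>J. inverse z) * (\<Prod>k\<in>J. 1 - z * y k))" .
    have 8: "poly p (inverse z) = (\<Prod>k\<in>J. inverse z) * (\<Prod>k\<in>J. z - y k) * (z - inverse z)"
      by (simp add: p_def 2 algebra_simps)
    show ?thesis unfolding 7 8 prod_dividef using 3 4 5 z by (simp add: field_simps)
  qed
  moreover have "(\<Sum>s\<in>Y. poly p s / (\<Prod>t\<in>S - {s}. s - t)) =
     (\<Sum>j\<in>J. z * ((z - y j) / (1 - z * y j) * (\<Prod>i\<in>J - {j}. (1 - y j * y i) / (y j - y i))))"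
    unfolding Y_def
  proof (rule sum.reindex_cong[OF inj refl])
    fix j assume j: "j \<in> J"
    have "S - {y j} = insert 1 (insert (- 1) (insert (inverse z) (y ` (J - {j}))))"
    proof -
      have "y ` (J - {j}) = Y - {y j}"
        using j inj unfolding Y_def inj_on_def by blast
      moreover have "y j \<in> Y" using j by (simp add: Y_def)
      then have "y j \<noteq> 1 \<and> y j \<noteq> - 1 \<and> y j \<noteq> inverse z" using zY by metis
      ultimately show ?thesis unfolding S_def by blast
    qed
    moreover have S1: "(\<Prod>t\<in>insert 1 (insert (- 1) (insert (inverse z) (y ` (J - {j})))). y j - t) =
       (y j - 1) * ((y j + 1) * ((y j - inverse z) * (\<Prod>t\<in>y ` (J - {j}). y j - t)))"
    proof -
      have Y': "y ` (J - {j}) \<subseteq> Y" by (auto simp: Y_def)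
      have n1: "inverse z \<notin> y ` (J - {j})" using zY Y' by blast
      have n2: "- 1 \<notin> insert (inverse z) (y ` (J - {j}))" using zY(3) Y' zi(2) by (metis insertE subsetD)
      have n3: "1 \<notin> insert (- 1) (insert (inverse z) (y ` (J - {j})))" using zY(2) Y' zi(1) m1 by (metis insertE subsetD)
      have fin: "finite (y ` (J - {j}))" using J(1) by blast
      have "y j - - 1 = y j + 1" by simp
      then show ?thesis using n1 n2 n3 fin by (simp only: prod.insert finite_insert not_False_eq_True)
    qed
    ultimately have "(\<Prod>t\<in>S - {y j}. y j - t) = (y j - 1) * ((y j + 1) * ((y j - inverse z) * (\<Prod>t\<in>y ` (J - {j}). y j - t)))"
      by (simp only:)
    also have "(\<Prod>t\<in>y ` (J - {j}). y j - t) = (\<Prod>i\<in>J - {j}. y j - y i)"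
      by (rule prod.reindex_cong[where l = y]) (use inj in \<open>auto simp: inj_on_def\<close>)
    finally have 1: "(\<Prod>t\<in>S - {y j}. y j - t) = (y j - 1) * ((y j + 1) * ((y j - inverse z) * (\<Prod>i\<in>J - {j}. y j - y i)))" .
    have "poly f (y j) = (\<Prod>i\<in>J. 1 - y j * y i)"
      unfolding polyf by (simp add: mult.commute)
    also have "\<dots> = (1 - y j * y j) * (\<Prod>i\<in>J - {j}. 1 - y j * y i)"
      by (rule prod.remove[OF J(1) j])
    finally have 2: "poly p (y j) = (z - y j) * ((1 - y j * y j) * (\<Prod>i\<in>J - {j}. 1 - y j * y i))"
      unfolding p_def by (simp only: poly_mult) (simp add: mult.commute)
    have 3: "(\<Prod>i\<in>J - {j}. y j - y i) \<noteq> 0" using inj j J by (auto simp: inj_on_def)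
    have 4: "y j - 1 \<noteq> 0" "y j + 1 \<noteq> 0" "1 - z * y j \<noteq> 0"
      using y[OF j] by (simp_all add: eq_neg_iff_add_eq_0)
    have 5: "v - inverse z = - (1 - z * v) / z" for v using z(1) by (simp add: field_simps)
    define A where "A = (\<Prod>i\<in>J - {j}. 1 - y j * y i)"
    define B where "B = (\<Prod>i\<in>J - {j}. y j - y i)"
    have 6: "(u - 1) * ((u + 1) * (- w / z * B)) = (1 - u * u) * w * B / z" for u w
      by (simp add: divide_inverse algebra_simps)
    have "(y j - 1) * (y j + 1) \<noteq> 0" using 4 by simp
    then have 7: "1 - y j * y j \<noteq> 0" by (simp add: algebra_simps)
    have 8: "e * (d * A) / (d * c * B / z) = z * (e / c * (A / B))"
      if "B \<noteq> 0" "c \<noteq> 0" "d \<noteq> 0" for A B c d e :: 'a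
      using that z(1) by (simp add: divide_simps)
    show "poly p (y j) / (\<Prod>t\<in>S - {y j}. y j - t) =
      z * ((z - y j) / (1 - z * y j) * (\<Prod>i\<in>J - {j}. (1 - y j * y i) / (y j - y i)))"
      unfolding 1 2 prod_dividef 5 A_def[symmetric] B_def[symmetric] 6
      by (rule 8[OF 3[folded B_def] 4(3) 7])
  qed
  ultimately have "z * (\<Sum>j\<in>J. (z - y j) / (1 - z * y j) * (\<Prod>i\<in>J - {j}. (1 - y j * y i) / (y j - y i))) =
    z * (\<Prod>j\<in>J. (z - y j) / (1 - z * y j))"
    by (simp add: sum_distrib_left)
  then show ?thesis using z(1) by simp
qed

text \<open>The partial fraction decomposition in \<open>z\<close> of a rational function that
  vanishes at infinity, since \<open>A\<close> has one element more than \<open>C\<close>. It is the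
  vanishing divided difference of the numerator on the nodes \<open>t a\<close> together with the
  extra node \<open>z\<close>.\<close>

lemma cauchy_partial_fractions:
  fixes t :: "'i \<Rightarrow> 'a::field"
  assumes A: "finite A" "inj_on t A" "z \<notin> t ` A" and C: "finite C" "card A = Suc (card C)"
  shows "(\<Prod>c\<in>C. t c - z) / (\<Prod>a\<in>A. t a - z) =
    (\<Sum>a\<in>A. (\<Prod>c\<in>C. t c - t a) / ((t a - z) * (\<Prod>i\<in>A - {a}. t i - t a)))"
proof -
  define p where "p = (\<Prod>c\<in>C. [:t c, - 1:])"
  have polyp: "poly p u = (\<Prod>c\<in>C. t c - u)" for u by (simp add: p_def poly_prod)
  have degp: "degree p \<le> card C"
  proof -
    have "degree p \<le> (\<Sum>c\<in>C. degree [:t c, - 1:])"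
      unfolding p_def by (rule degree_prod_sum_le[OF C(1), unfolded o_def])
    then show ?thesis by simp
  qed
  define S where "S = insert z (t ` A)"
  have cS: "card S = card C + 2" using A C by (simp add: S_def card_image)
  have minus: "(\<Prod>x\<in>X. u - f x) = (- 1) ^ card X * (\<Prod>x\<in>X. f x - u)" for u and f :: "'x \<Rightarrow> 'a" and X
  proof -
    have "(\<Prod>x\<in>X. u - f x) = (\<Prod>x\<in>X. - 1 * (f x - u))" by (intro prod.cong) auto
    also have "\<dots> = (- 1) ^ card X * (\<Prod>x\<in>X. f x - u)" by (simp only: prod.distrib prod_constant)
    finally show ?thesis .
  qed
  have "0 = (\<Sum>s\<in>S. poly p s / (\<Prod>u\<in>S - {s}. s - u))"
    using cS degp A by (intro sum_divided_difference_eq_0[symmetric]) (auto simp: S_def)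
  also have "\<dots> = poly p z / (\<Prod>u\<in>S - {z}. z - u) + (\<Sum>s\<in>t ` A. poly p s / (\<Prod>u\<in>S - {s}. s - u))"
    using A by (subst S_def) simp
  also have "S - {z} = t ` A" using A by (auto simp: S_def)
  also have "(\<Prod>u\<in>t ` A. z - u) = (\<Prod>a\<in>A. z - t a)"
    by (subst prod.reindex[OF A(2)]) simp
  also have "\<dots> = (- 1) ^ card A * (\<Prod>a\<in>A. t a - z)" by (rule minus)
  also have "(\<Sum>s\<in>t ` A. poly p s / (\<Prod>u\<in>S - {s}. s - u)) =
     (\<Sum>a\<in>A. (- 1) ^ card C * ((\<Prod>c\<in>C. t c - t a) / ((t a - z) * (\<Prod>i\<in>A - {a}. t i - t a))))"
  proof (rule sum.reindex_cong[OF A(2) refl])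
    fix a assume a: "a \<in> A"
    have "S - {t a} = insert z (t ` (A - {a}))"
      using a A(2,3) unfolding S_def inj_on_def by blast
    moreover have "z \<notin> t ` (A - {a})" using A(3) by blast
    ultimately have "(\<Prod>u\<in>S - {t a}. t a - u) = (t a - z) * (\<Prod>u\<in>t ` (A - {a}). t a - u)"
      using A(1) by (simp only: prod.insert finite_imageI finite_Diff not_False_eq_True)
    also have "(\<Prod>u\<in>t ` (A - {a}). t a - u) = (\<Prod>i\<in>A - {a}. t a - t i)"
      by (subst prod.reindex) (use A(2) in \<open>auto simp: inj_on_def\<close>)
    also have "\<dots> = (- 1) ^ card (A - {a}) * (\<Prod>i\<in>A - {a}. t i - t a)" by (rule minus)
    also have "card (A - {a}) = card C" using a A C by simp
    finally have 1: "(\<Prod>u\<in>S - {t a}. t a - u) = (t a - z) * ((- 1) ^ card C * (\<Prod>i\<in>A - {a}. t i - t a))" .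
    show "poly p (t a) / (\<Prod>u\<in>S - {t a}. t a - u) =
      (- 1) ^ card C * ((\<Prod>c\<in>C. t c - t a) / ((t a - z) * (\<Prod>i\<in>A - {a}. t i - t a)))"
      unfolding 1 polyp by (simp add: minus_one_power_iff)
  qed
  also have "poly p z / ((- 1) ^ card A * (\<Prod>a\<in>A. t a - z)) = - ((- 1) ^ card C * ((\<Prod>c\<in>C. t c - z) / (\<Prod>a\<in>A. t a - z)))"
    unfolding polyp C(2) by (simp add: minus_one_power_iff)
  finally have "(- 1) ^ card C * ((\<Prod>c\<in>C. t c - z) / (\<Prod>a\<in>A. t a - z)) =
    (- 1) ^ card C * (\<Sum>a\<in>A. (\<Prod>c\<in>C. t c - t a) / ((t a - z) * (\<Prod>i\<in>A - {a}. t i - t a)))"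
    unfolding sum_distrib_left by (simp add: eq_neg_iff_add_eq_0 add_eq_0_iff)
  then show ?thesis by (simp add: minus_one_power_iff split: if_splits)
qed

text \<open>The Pfaffians considered here link only indices with different values of
  \<open>e\<close>, so they vanish unless both classes are equally large.\<close>

definition balanced :: "(nat \<Rightarrow> bool) \<Rightarrow> nat set \<Rightarrow> bool" where
  "balanced e J \<longleftrightarrow> card {j \<in> J. e j} = card {j \<in> J. \<not> e j}"

lemma pair_prod_eq_0:
  fixes th :: "nat \<Rightarrow> nat \<Rightarrow> 'a::{idom}"
  assumes "finite J" "a \<in> J" "b \<in> J" "a < b" "th a b = 0"
  shows "pair_prod th J = 0"
  unfolding pair_prod_def using assms
  by (intro prod_zero finite_pairs bexI[of _ "(a, b)"]) (auto simp: pairs_def)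

lemma balanced_remove2:
  assumes "finite J" "k \<in> J" "j \<in> J" "e j \<noteq> e k"
  shows "balanced e (J - {k} - {j}) \<longleftrightarrow> balanced e J"
proof -
  have *: "balanced e (J - {k} - {j}) \<longleftrightarrow> balanced e J" if "e k" "\<not> e j" "k \<in> J" "j \<in> J" for j k
  proof -
    have "{i \<in> J. e i} = insert k {i \<in> J - {k} - {j}. e i}"
      "{i \<in> J. \<not> e i} = insert j {i \<in> J - {k} - {j}. \<not> e i}"
      using that by auto
    then have "card {i \<in> J. e i} = Suc (card {i \<in> J - {k} - {j}. e i})"
      "card {i \<in> J. \<not> e i} = Suc (card {i \<in> J - {k} - {j}. \<not> e i})"
      using assms(1) by simp_all
    then show ?thesis by (simp add: balanced_def)
  qed
  show ?thesis
  proof (cases "e k")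
    case True then show ?thesis using * assms by blast
  next
    case False
    then have "balanced e (J - {j} - {k}) \<longleftrightarrow> balanced e J" using * assms by blast
    moreover have "J - {j} - {k} = J - {k} - {j}" by blast
    ultimately show ?thesis by simp
  qed
qed

text \<open>Multiplied over all pairs of a balanced index set, this is up to sign the Cauchy
  determinant of 1/(t j - t i), with one class as rows and the other as columns.\<close>

definition cauchy_factor :: "(nat \<Rightarrow> bool) \<Rightarrow> (nat \<Rightarrow> 'a::field) \<Rightarrow> nat \<Rightarrow> nat \<Rightarrow> 'a" where
  "cauchy_factor e t i j = (if e i = e j then t j - t i else 1 / (t j - t i))"

lemma cauchy_factor_anti: "cauchy_factor e t j i = - cauchy_factor e t i j"
  using minus_divide_right[of 1 "t j - t i"] by (auto simp: cauchy_factor_def)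

lemma pos_sign_Diff_less:
  assumes "finite J" "a \<in> J" "a < b" shows "pos_sign (J - {a}) b = - pos_sign J b"
proof -
  have "{i \<in> J. i < b} = insert a {i \<in> J - {a}. i < b}" using assms by auto
  then have "card {i \<in> J. i < b} = Suc (card {i \<in> J - {a}. i < b})" using assms(1) by simp
  then show ?thesis by (simp add: pos_sign_def)
qed

lemma pos_sign_Diff_greater: "a \<le> b \<Longrightarrow> pos_sign (J - {b}) a = pos_sign J a"
  unfolding pos_sign_def by (rule arg_cong[where f = "\<lambda>X. (- 1) ^ card X"]) auto

text \<open>Once the product over \<open>J - {k}\<close> is split off, what remains is
  \<open>cauchy_partial_fractions\<close> at \<open>z = t k\<close>, with \<open>A\<close> the class
  opposite to \<open>k\<close> and \<open>C\<close> the rest of the class of \<open>k\<close>;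
  balance makes \<open>A\<close> larger by one. Distinctness of the values is assumed only across
  the classes, so repeated values inside \<open>A\<close> need a separate argument.\<close>

lemma cauchy_pfaffian_expand:
  fixes t :: "nat \<Rightarrow> 'a::field"
  assumes J: "finite J" "k \<in> J" "\<And>j. j \<in> J \<Longrightarrow> k \<le> j"
    and t: "\<And>i j. i \<in> J \<Longrightarrow> j \<in> J \<Longrightarrow> e i \<noteq> e j \<Longrightarrow> t i \<noteq> t j"
  shows "(if balanced e J then pair_prod (cauchy_factor e t) J else 0) =
    (\<Sum>j\<in>J - {k}. pos_sign (J - {k}) j * (if e j \<noteq> e k then cauchy_factor e t k j else 0) *
       (if balanced e (J - {k} - {j}) then pair_prod (cauchy_factor e t) (J - {k} - {j}) else 0))"
    (is "?L = (\<Sum>j\<in>J - {k}. ?r j)")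
proof -
  define J' where "J' = J - {k}"
  define A where "A = {j \<in> J'. e j \<noteq> e k}"
  define C where "C = {j \<in> J'. e j = e k}"
  let ?th = "cauchy_factor e t"
  have fin: "finite J'" "finite A" "finite C" using J by (auto simp: J'_def A_def C_def)
  have J'AC: "J' = A \<union> C" "A \<inter> C = {}" by (auto simp: A_def C_def)
  have R: "(\<Sum>j\<in>J - {k}. ?r j) =
     (if balanced e J then (\<Sum>j\<in>A. pos_sign J' j * ?th k j * pair_prod ?th (J' - {j})) else 0)"
  proof -
    have "(\<Sum>j\<in>J - {k}. ?r j) = (\<Sum>j\<in>A. ?r j)"
      using fin by (intro sum.mono_neutral_right) (auto simp: J'_def A_def)
    also have "\<dots> = (\<Sum>j\<in>A. if balanced e J then pos_sign J' j * ?th k j * pair_prod ?th (J' - {j}) else 0)"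
    proof (rule sum.cong[OF refl])
      fix j assume "j \<in> A"
      then have j: "j \<in> J" "e j \<noteq> e k" by (auto simp: A_def J'_def)
      show "?r j = (if balanced e J then pos_sign J' j * ?th k j * pair_prod ?th (J' - {j}) else 0)"
        unfolding balanced_remove2[OF J(1,2) j] using j by (simp add: J'_def)
    qed
    finally show ?thesis by (auto simp: sum.neutral)
  qed
  have key: "pair_prod ?th J = (\<Sum>j\<in>A. pos_sign J' j * ?th k j * pair_prod ?th (J' - {j}))"
    if bal: "balanced e J"
  proof -
    have "pos_sign J k = (1 :: 'a)"
    proof -
      have "{i \<in> J. i < k} = {}" using J(3) leD by blast
      then have "card {i \<in> J. i < k} = 0" by (metis card.empty)
      then show ?thesis unfolding pos_sign_def by (simp only: power_0)
    qed
    then have ppJ: "pair_prod ?th J = (\<Prod>j\<in>J'. ?th k j) * pair_prod ?th J'"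
      using pair_prod_remove[OF J(1,2), of ?th, OF cauchy_factor_anti] unfolding J'_def by simp
    have ppJ': "pair_prod ?th J' = pos_sign J' j * (\<Prod>i\<in>J' - {j}. ?th j i) * pair_prod ?th (J' - {j})"
      if "j \<in> J'" for j
      using pair_prod_remove[OF fin(1) that, of ?th] cauchy_factor_anti by blast
    have cAC: "card A = Suc (card C)"
    proof -
      have *: "{j \<in> J. e j = e k} = insert k C" "{j \<in> J. e j \<noteq> e k} = A"
        using J(2) by (auto simp: A_def C_def J'_def)
      have "k \<notin> C" by (auto simp: C_def J'_def)
      have "card {j \<in> J. e j = e k} = card {j \<in> J. e j \<noteq> e k}"
        using bal by (cases "e k") (auto simp: balanced_def)
      then show ?thesis using * \<open>k \<notin> C\<close> fin by simp
    qed
    show ?thesis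
    proof (cases "inj_on t A")
      case True
      have zA: "t k \<notin> t ` A" using t J by (fastforce simp: A_def J'_def)
      have tne: "t i \<noteq> t j" if "i \<in> A" "j \<in> C" for i j using t that by (auto simp: A_def C_def J'_def)
      have "(\<Prod>j\<in>J'. ?th k j) = (\<Prod>j\<in>A. ?th k j) * (\<Prod>j\<in>C. ?th k j)"
        unfolding J'AC(1) using fin J'AC by (intro prod.union_disjoint) auto
      also have "(\<Prod>j\<in>A. ?th k j) = 1 / (\<Prod>j\<in>A. t j - t k)"
        unfolding prod_dividef[of "\<lambda>_. 1", simplified, symmetric]
        by (intro prod.cong) (auto simp: A_def cauchy_factor_def)
      also have "(\<Prod>j\<in>C. ?th k j) = (\<Prod>c\<in>C. t c - t k)"
        by (intro prod.cong) (auto simp: C_def cauchy_factor_def)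
      finally have "(\<Prod>j\<in>J'. ?th k j) = (\<Prod>c\<in>C. t c - t k) / (\<Prod>j\<in>A. t j - t k)" by simp
      also have "\<dots> = (\<Sum>a\<in>A. (\<Prod>c\<in>C. t c - t a) / ((t a - t k) * (\<Prod>i\<in>A - {a}. t i - t a)))"
        by (rule cauchy_partial_fractions) (use fin True zA cAC in auto)
      finally have "pair_prod ?th J = (\<Sum>a\<in>A. (\<Prod>c\<in>C. t c - t a) / ((t a - t k) * (\<Prod>i\<in>A - {a}. t i - t a)) * pair_prod ?th J')"
        unfolding ppJ by (simp add: sum_distrib_right)
      also have "\<dots> = (\<Sum>j\<in>A. pos_sign J' j * ?th k j * pair_prod ?th (J' - {j}))"
      proof (rule sum.cong[OF refl])
        fix a assume a: "a \<in> A"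
        have aJ: "a \<in> J'" using a by (simp add: A_def)
        have "J' - {a} = (A - {a}) \<union> C" using J'AC a by blast
        then have "(\<Prod>i\<in>J' - {a}. ?th a i) = (\<Prod>i\<in>A - {a}. ?th a i) * (\<Prod>i\<in>C. ?th a i)"
          using fin J'AC by (simp only:) (intro prod.union_disjoint, auto)
        also have "(\<Prod>i\<in>A - {a}. ?th a i) = (\<Prod>i\<in>A - {a}. t i - t a)"
          using a by (intro prod.cong) (auto simp: A_def cauchy_factor_def)
        also have "(\<Prod>i\<in>C. ?th a i) = 1 / (\<Prod>c\<in>C. t c - t a)"
          unfolding prod_dividef[of "\<lambda>_. 1", simplified, symmetric]
          using a by (intro prod.cong) (auto simp: A_def C_def cauchy_factor_def)
        finally have 1: "(\<Prod>i\<in>J' - {a}. ?th a i) = (\<Prod>i\<in>A - {a}. t i - t a) / (\<Prod>c\<in>C. t c - t a)" by simp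
        have 2: "(\<Prod>i\<in>A - {a}. t i - t a) \<noteq> 0" using True a fin by (auto simp: inj_on_def)
        have 3: "(\<Prod>c\<in>C. t c - t a) \<noteq> 0" using tne[OF a] fin by (auto simp: eq_commute[of _ "t a"])
        have 4: "?th k a = 1 / (t a - t k)" using a by (auto simp: A_def cauchy_factor_def)
        have 5: "t a - t k \<noteq> 0" using zA a by (metis eq_iff_diff_eq_0 imageI)
        define s :: 'a where "s = pos_sign J' a"
        have s: "s * s = 1" by (simp add: s_def)
        define D where "D = pair_prod ?th (J' - {a})"
        have 6: "P / (x * Q) * (s * (Q / P) * D) = s * (1 / x) * D" if "P \<noteq> 0" "Q \<noteq> 0" "x \<noteq> 0" for P Q x :: 'a
          using that by (simp add: field_simps)
        show "(\<Prod>c\<in>C. t c - t a) / ((t a - t k) * (\<Prod>i\<in>A - {a}. t i - t a)) * pair_prod ?th J' =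
          pos_sign J' a * ?th k a * pair_prod ?th (J' - {a})"
          unfolding ppJ'[OF aJ] 1 4 s_def[symmetric] D_def[symmetric] by (rule 6[OF 3 2 5])
      qed
      finally show ?thesis .
    next
      \<comment> \<open>Partial fractions need distinct nodes. If \<open>t a = t b\<close>, the
        left-hand side has the factor \<open>th a b = 0\<close>; on the right only the terms that
        remove \<open>a\<close> or \<open>b\<close> escape this factor, and these two differ by a
        sign.\<close>
      case False
      then obtain a b where ab: "a \<in> A" "b \<in> A" "a < b" "t a = t b"
        unfolding inj_on_def by (metis linorder_neqE_nat)
      have abJ: "a \<in> J'" "b \<in> J'" "e a = e b" using ab by (auto simp: A_def)
      have thab: "?th a b = 0" using ab abJ by (simp add: cauchy_factor_def)
      have th_eq: "?th a i = ?th b i" "?th i a = ?th i b" for i using ab abJ by (simp_all add: cauchy_factor_def)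
      have "pair_prod ?th J' = 0" by (rule pair_prod_eq_0[of _ a b]) (use fin ab abJ thab in auto)
      then have L: "pair_prod ?th J = 0" by (simp add: ppJ)
      have "(\<Sum>j\<in>A. pos_sign J' j * ?th k j * pair_prod ?th (J' - {j})) =
        (\<Sum>j\<in>{a, b}. pos_sign J' j * ?th k j * pair_prod ?th (J' - {j}))"
      proof (rule sum.mono_neutral_right)
        show "\<forall>j\<in>A - {a, b}. pos_sign J' j * ?th k j * pair_prod ?th (J' - {j}) = 0"
        proof
          fix j assume "j \<in> A - {a, b}"
          then have "pair_prod ?th (J' - {j}) = 0"
            by (intro pair_prod_eq_0[of _ a b]) (use fin ab abJ thab in auto)
          then show "pos_sign J' j * ?th k j * pair_prod ?th (J' - {j}) = 0" by simp
        qed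
      qed (use fin ab in auto)
      also have "\<dots> = pos_sign J' a * ?th k a * pair_prod ?th (J' - {a}) + pos_sign J' b * ?th k b * pair_prod ?th (J' - {b})"
        using ab by simp
      also have "pair_prod ?th (J' - {a}) = pos_sign (J' - {a}) b * (\<Prod>i\<in>J' - {a} - {b}. ?th b i) * pair_prod ?th (J' - {a} - {b})"
        using ab abJ fin cauchy_factor_anti by (intro pair_prod_remove) auto
      also have "pos_sign (J' - {a}) b = - (pos_sign J' b :: 'a)"
        using ab abJ fin by (intro pos_sign_Diff_less) auto
      also have "pair_prod ?th (J' - {b}) = pos_sign (J' - {b}) a * (\<Prod>i\<in>J' - {b} - {a}. ?th a i) * pair_prod ?th (J' - {b} - {a})"
        using ab abJ fin cauchy_factor_anti by (intro pair_prod_remove) auto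
      also have "pos_sign (J' - {b}) a = (pos_sign J' a :: 'a)"
        using ab by (intro pos_sign_Diff_greater) auto
      also have "J' - {b} - {a} = J' - {a} - {b}" by blast
      finally show ?thesis unfolding L th_eq by (simp add: mult_ac)
    qed
  qed
  show ?thesis unfolding R using key by simp
qed

section \<open>Expansion of Schur's Pfaffian\<close>

lemma to_fract_prod: "to_fract (prod f A) = (\<Prod>x\<in>A. to_fract (f x))"
  by (induction A rule: infinite_finite_induct) auto

lemma to_fract_pos_sign: "to_fract (pos_sign J j) = pos_sign J j"
  by (cases "even (card {i \<in> J. i < j})") (auto simp: pos_sign_def)

text \<open>\<open>G i j\<close> stands for 1/(1 - x i * x j) in a ring without division, so the
  identity is transferred to the fraction field. There \<open>schur_partial_fractions\<close> with
  \<open>z = X k\<close> expands the factors involving \<open>k\<close>, and its inner products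
  cancel exactly the factors of \<open>j\<close> in the product over \<open>J - {k}\<close>.\<close>

lemma schur_pfaffian_expand:
  fixes x :: "nat \<Rightarrow> 'a::idom" and G :: "nat \<Rightarrow> nat \<Rightarrow> 'a"
  defines "th \<equiv> \<lambda>i j. (x i - x j) * G i j"
  assumes J: "finite J" "even (card J)" "k \<in> J" "\<And>j. j \<in> J \<Longrightarrow> k \<le> j"
    and inj: "inj_on x J" and two: "(2 :: 'a) \<noteq> 0"
    and x: "\<And>j. j \<in> J \<Longrightarrow> x j \<noteq> 0" "\<And>j. j \<in> J \<Longrightarrow> x j \<noteq> 1" "\<And>j. j \<in> J \<Longrightarrow> x j \<noteq> - 1"
    and G: "\<And>i j. i \<in> J \<Longrightarrow> j \<in> J \<Longrightarrow> i \<noteq> j \<Longrightarrow> (1 - x i * x j) * G i j = 1"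
  shows "pair_prod th J = (\<Sum>j\<in>J - {k}. pos_sign (J - {k}) j * th k j * pair_prod th (J - {k} - {j}))"
proof -
  define X where "X i = to_fract (x i)" for i
  define F where "F i j = (X i - X j) / (1 - X i * X j)" for i j
  define J' where "J' = J - {k}"
  have F: "to_fract (th i j) = F i j" if "i \<in> J" "j \<in> J" "i \<noteq> j" for i j
  proof -
    have "to_fract ((1 - x i * x j) * G i j) = 1" using G[OF that] by simp
    then have "(1 - X i * X j) * to_fract (G i j) = 1" by (simp add: X_def)
    then have "to_fract (G i j) = 1 / (1 - X i * X j)"
      by (metis mult_zero_left nonzero_mult_div_cancel_left zero_neq_one)
    then show ?thesis by (simp add: th_def F_def X_def)
  qed
  have anti: "F j i = - F i j" for i j
    unfolding F_def by (simp add: mult.commute minus_divide_left)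
  have pp: "to_fract (pair_prod th K) = pair_prod F K" if "K \<subseteq> J" for K
    unfolding pair_prod_def to_fract_prod
    by (rule prod.cong) (use that F in \<open>auto simp: pairs_def\<close>)
  have nz: "1 - X i * X j \<noteq> 0" "F i j \<noteq> 0" if "i \<in> J" "j \<in> J" "i \<noteq> j" for i j
  proof -
    have "1 - x i * x j \<noteq> 0" using G[OF that] by force
    then have "to_fract (1 - x i * x j) \<noteq> 0" by (simp del: to_fract_diff)
    then show "1 - X i * X j \<noteq> 0" by (simp add: X_def)
    moreover have "x i \<noteq> x j" using inj that by (auto simp: inj_on_def)
    then have "X i - X j \<noteq> 0" by (simp add: X_def)
    ultimately show "F i j \<noteq> 0" by (simp add: F_def)
  qed
  have "pos_sign J k = (1 :: 'a fract)"
  proof -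
    have "{i \<in> J. i < k} = {}" using J(4) leD by blast
    then have "card {i \<in> J. i < k} = 0" by (metis card.empty)
    then show ?thesis unfolding pos_sign_def by (simp only: power_0)
  qed
  then have "pair_prod F J = (\<Prod>j\<in>J'. F k j) * pair_prod F J'"
    using pair_prod_remove[OF J(1,3), of F, OF anti] unfolding J'_def by simp
  also have "(\<Prod>j\<in>J'. F k j) = (\<Sum>j\<in>J'. F k j * (\<Prod>i\<in>J' - {j}. (1 - X j * X i) / (X j - X i)))"
    unfolding F_def
  proof (rule schur_partial_fractions)
    show "finite J'" "odd (card J')" using J by (auto simp: J'_def card_gt_0_iff)
    show "inj_on X J'" using inj by (auto simp: J'_def inj_on_def X_def)
    show "(2 :: 'a fract) \<noteq> 0" using two by (metis one_add_one to_fract_1 to_fract_add to_fract_eq_0_iff)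
    show "X k \<noteq> 0" "X k \<noteq> 1" "X k \<noteq> - 1"
      using x[OF J(3)] unfolding X_def by (metis to_fract_0 to_fract_1 to_fract_uminus to_fract_eq_iff)+
    fix j assume j: "j \<in> J'"
    then have jJ: "j \<in> J" "k \<noteq> j" by (auto simp: J'_def)
    show "X j \<noteq> 1" "X j \<noteq> - 1"
      using x[OF jJ(1)] unfolding X_def by (metis to_fract_1 to_fract_uminus to_fract_eq_iff)+
    show "X k * X j \<noteq> 1" using nz(1)[OF J(3) jJ] by force
  qed
  also have "\<dots> * pair_prod F J' = (\<Sum>j\<in>J'. pos_sign J' j * F k j * pair_prod F (J' - {j}))"
    unfolding sum_distrib_right
  proof (rule sum.cong[OF refl])
    fix j assume j: "j \<in> J'"
    have "(\<Prod>i\<in>J' - {j}. (1 - X j * X i) / (X j - X i)) = inverse (\<Prod>i\<in>J' - {j}. F j i)"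
      unfolding prod_inversef[symmetric] by (rule prod.cong) (auto simp: F_def)
    moreover have "(\<Prod>i\<in>J' - {j}. F j i) \<noteq> 0"
      using nz(2) j J(1) by (auto simp: J'_def)
    moreover have "pair_prod F J' = pos_sign J' j * (\<Prod>i\<in>J' - {j}. F j i) * pair_prod F (J' - {j})"
      by (rule pair_prod_remove[OF _ _ anti]) (use J j in \<open>auto simp: J'_def\<close>)
    ultimately show "F k j * (\<Prod>i\<in>J' - {j}. (1 - X j * X i) / (X j - X i)) * pair_prod F J' =
      pos_sign J' j * F k j * pair_prod F (J' - {j})" by (simp add: field_simps)
  qed
  also have "\<dots> = (\<Sum>j\<in>J'. to_fract (pos_sign J' j * th k j * pair_prod th (J' - {j})))"
  proof (rule sum.cong[OF refl])
    fix j assume j: "j \<in> J'"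
    have "to_fract (pair_prod th (J' - {j})) = pair_prod F (J' - {j})" by (rule pp) (auto simp: J'_def)
    moreover have "to_fract (th k j) = F k j" using j J(3) by (intro F) (auto simp: J'_def)
    ultimately show "pos_sign J' j * F k j * pair_prod F (J' - {j}) =
      to_fract (pos_sign J' j * th k j * pair_prod th (J' - {j}))" by (simp add: to_fract_pos_sign)
  qed
  finally have "to_fract (pair_prod th J) =
      to_fract (\<Sum>j\<in>J'. pos_sign J' j * th k j * pair_prod th (J' - {j}))"
    by (simp only: pp[OF order_refl] to_fract_sum)
  then show ?thesis unfolding J'_def by (simp only: to_fract_eq_iff)
qed

section \<open>Coefficients of the antisymmetric product\<close>

definition univar :: "nat \<Rightarrow> (nat \<Rightarrow> 'a::zero) \<Rightarrow> 'a mfps" where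
  "univar i f = Abs_mfps (\<lambda>m. if keys m \<subseteq> {i} then f (lookup m i) else 0)"

definition bivar :: "nat \<Rightarrow> nat \<Rightarrow> (nat \<Rightarrow> nat \<Rightarrow> 'a::zero) \<Rightarrow> 'a mfps" where
  "bivar i j f = Abs_mfps (\<lambda>m. if keys m \<subseteq> {i, j} then f (lookup m i) (lookup m j) else 0)"

lemma mcoeff_univar: "mcoeff (univar i f) m = (if keys m \<subseteq> {i} then f (lookup m i) else 0)"
  by (simp add: univar_def)

lemma mcoeff_bivar: "mcoeff (bivar i j f) m = (if keys m \<subseteq> {i, j} then f (lookup m i) (lookup m j) else 0)"
  by (simp add: bivar_def)

lemma vars_in_univar: "vars_in {i} (univar i f)" and vars_in_bivar: "vars_in {i, j} (bivar i j h)"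
  by (auto simp: vars_in_def mcoeff_univar mcoeff_bivar split: if_splits)

lemma univar_times_univar:
  fixes f :: "nat \<Rightarrow> 'a::comm_ring_1"
  assumes "i \<noteq> j"
  shows "univar i f * univar j h = bivar i j (\<lambda>a b. f a * h b)"
proof (rule mfps_eqI)
  fix m
  have "mcoeff (univar i f * univar j h) m = (if keys m \<subseteq> {i} \<union> {j}
    then mcoeff (univar i f) (mrestr {i} m) * mcoeff (univar j h) (mrestr {j} m) else 0)"
    by (rule mcoeff_times_disjoint) (use assms vars_in_univar in auto)
  then show "mcoeff (univar i f * univar j h) m = mcoeff (bivar i j (\<lambda>a b. f a * h b)) m"
    by (auto simp: mcoeff_univar mcoeff_bivar keys_mrestr lookup_mrestr)
qed

lemma bivar_minus: "bivar i j f - bivar i j h = bivar i j (\<lambda>a b. f a b - h a b :: 'a::comm_ring_1)"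
  by (rule mfps_eqI) (simp add: mcoeff_bivar)

lemma bivar_1: "1 = bivar i j (\<lambda>a b. if a = 0 \<and> b = 0 then 1 else (0 :: 'a::comm_ring_1))"
proof (rule mfps_eqI)
  fix m :: "nat \<Rightarrow>\<^sub>0 nat"
  have "m = 0 \<longleftrightarrow> keys m \<subseteq> {i, j} \<and> lookup m i = 0 \<and> lookup m j = 0"
    by (auto simp: in_keys_iff keys_eq_empty[symmetric] simp del: keys_eq_empty)
  then show "mcoeff 1 m = mcoeff (bivar i j (\<lambda>a b. if a = 0 \<and> b = 0 then 1 else (0 :: 'a))) m"
    by (auto simp: mcoeff_one mcoeff_bivar)
qed

lemma keys_minus_single:
  "i \<in> A \<Longrightarrow> keys (m - Poly_Mapping.single i (Suc 0)) \<subseteq> A \<longleftrightarrow> keys m \<subseteq> A"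
  by (auto simp: in_keys_iff lookup_minus lookup_single when_def subset_iff)

lemma mvar_times_bivar1:
  fixes f :: "nat \<Rightarrow> nat \<Rightarrow> 'a::comm_ring_1"
  assumes "i \<noteq> j"
  shows "mvar i * bivar i j f = bivar i j (\<lambda>a b. if a = 0 then 0 else f (a - 1) b)"
  by (rule mfps_eqI)
    (use assms in \<open>auto simp: mcoeff_mvar_times mcoeff_bivar keys_minus_single lookup_minus lookup_single\<close>)

lemma mvar_times_bivar2:
  fixes f :: "nat \<Rightarrow> nat \<Rightarrow> 'a::comm_ring_1"
  assumes "i \<noteq> j"
  shows "mvar j * bivar i j f = bivar i j (\<lambda>a b. if b = 0 then 0 else f a (b - 1))"
  by (rule mfps_eqI)
    (use assms in \<open>auto simp: mcoeff_mvar_times mcoeff_bivar keys_minus_single lookup_minus lookup_single\<close>)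

definition geo :: "nat \<Rightarrow> nat \<Rightarrow> 'a::zero_neq_one mfps" where
  "geo i j = bivar i j (\<lambda>a b. if a = b then 1 else 0)"

lemma geo_inverse: "i \<noteq> j \<Longrightarrow> (1 - mvar i * mvar j) * geo i j = (1 :: 'a::comm_ring_1 mfps)"
  by (subst (2) bivar_1[of i j])
    (auto simp: geo_def left_diff_distrib mult.assoc mvar_times_bivar1 mvar_times_bivar2 bivar_minus
       intro!: arg_cong[of _ _ "bivar i j"] ext)

text \<open>The entry (x_i - x_j)/(1 - x_i x_j) of Schur's Pfaffian, with the geometric series in
  place of the division.\<close>

definition antisym_factor :: "nat \<Rightarrow> nat \<Rightarrow> 'a::comm_ring_1 mfps" where
  "antisym_factor i j = (mvar i - mvar j) * geo i j"

lemma vars_in_antisym_factor: "vars_in {i, j} (antisym_factor i j)"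
  unfolding antisym_factor_def geo_def
  by (intro vars_in_times vars_in_minus vars_in_mvar vars_in_bivar) auto

lemma mvar_inj: "mvar i = (mvar j :: 'a::comm_ring_1 mfps) \<Longrightarrow> i = j"
proof -
  assume "mvar i = (mvar j :: 'a mfps)"
  then have "mcoeff (mvar i :: 'a mfps) (Poly_Mapping.single i 1) = mcoeff (mvar j :: 'a mfps) (Poly_Mapping.single i 1)"
    by simp
  then have "Poly_Mapping.single i (1::nat) = Poly_Mapping.single j 1"
    by (simp add: mcoeff_mvar split: if_splits)
  then show "i = j" by (metis lookup_single_eq lookup_single_not_eq zero_neq_one)
qed

lemma mvar_nonzero: "(mvar i :: 'a::comm_ring_1 mfps) \<noteq> 0"
  and mvar_noteq_1: "(mvar i :: 'a::comm_ring_1 mfps) \<noteq> 1"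
  and mvar_noteq_minus_1: "(mvar i :: 'a::comm_ring_1 mfps) \<noteq> - 1"
proof -
  have "mcoeff (mvar i :: 'a mfps) (Poly_Mapping.single i 1) = 1" by (simp add: mcoeff_mvar)
  moreover have "mcoeff (1 :: 'a mfps) (Poly_Mapping.single i 1) = 0"
    by (simp add: mcoeff_one) (metis lookup_single_eq lookup_zero nat.simps(3))
  ultimately show "(mvar i :: 'a mfps) \<noteq> 0" "(mvar i :: 'a mfps) \<noteq> 1" "(mvar i :: 'a mfps) \<noteq> - 1"
    by (auto dest: arg_cong[where f = "\<lambda>f. mcoeff f (Poly_Mapping.single i 1)"])
qed

lemma antisym_factor_expand:
  assumes J: "finite J" "even (card J)" "k \<in> J" "\<And>j. j \<in> J \<Longrightarrow> k \<le> j"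
  shows "pair_prod antisym_factor J = (\<Sum>j\<in>J - {k}. pos_sign (J - {k}) j * antisym_factor k j *
    pair_prod antisym_factor (J - {k} - {j}) :: 'a::{idom,ring_char_0} mfps)"
proof -
  have two: "(2 :: 'a mfps) \<noteq> 0"
  proof
    assume "(2 :: 'a mfps) = 0"
    then have "mcoeff (1 + 1 :: 'a mfps) 0 = 0" by simp
    moreover have "mcoeff (1 + 1 :: 'a mfps) 0 = 1 + 1" by (simp only: mcoeff_plus mcoeff_one refl if_True)
    ultimately show False by simp
  qed
  have "inj_on (mvar :: nat \<Rightarrow> 'a mfps) J" by (rule inj_onI) (rule mvar_inj)
  from schur_pfaffian_expand[OF J this two mvar_nonzero mvar_noteq_1 mvar_noteq_minus_1 geo_inverse]
  show ?thesis unfolding antisym_factor_def .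
qed

lemma mcoeff_pos_sign_times: "mcoeff (pos_sign J j * f) m = pos_sign J j * mcoeff (f :: 'a::comm_ring_1 mfps) m"
  by (cases "even (card {i \<in> J. i < j})") (auto simp: pos_sign_def)

text \<open>The closed form of the Pfaffian with entries
  \<open>cauchy_entry W u (l i) (l j)\<close>; \<open>W\<close> absorbs what depends on a single
  exponent. \<open>cauchy_coeff_expand\<close> is the corresponding row expansion.\<close>

definition cauchy_coeff :: "(nat \<Rightarrow> 'a::field) \<Rightarrow> (nat \<Rightarrow> 'a) \<Rightarrow> nat set \<Rightarrow> (nat \<Rightarrow> nat) \<Rightarrow> 'a" where
  "cauchy_coeff W u J l = (if balanced (\<lambda>i. even (l i)) J
     then (\<Prod>i\<in>J. W (l i)) * pair_prod (cauchy_factor (\<lambda>i. even (l i)) (\<lambda>i. u (l i))) J else 0)"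

lemma cauchy_coeff_cong:
  assumes "\<And>i. i \<in> J \<Longrightarrow> l i = l' i"
  shows "cauchy_coeff W u J l = cauchy_coeff W u J l'"
proof -
  have "{j \<in> J. even (l j)} = {j \<in> J. even (l' j)}" "{j \<in> J. \<not> even (l j)} = {j \<in> J. \<not> even (l' j)}"
    using assms by auto
  then have "balanced (\<lambda>i. even (l i)) J \<longleftrightarrow> balanced (\<lambda>i. even (l' i)) J"
    unfolding balanced_def by simp
  moreover have "(\<Prod>i\<in>J. W (l i)) = (\<Prod>i\<in>J. W (l' i))" using assms by (intro prod.cong) auto
  moreover have "pair_prod (cauchy_factor (\<lambda>i. even (l i)) (\<lambda>i. u (l i))) J =
     pair_prod (cauchy_factor (\<lambda>i. even (l' i)) (\<lambda>i. u (l' i))) J"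
    unfolding pair_prod_def by (rule prod.cong) (use assms in \<open>auto simp: pairs_def cauchy_factor_def\<close>)
  ultimately show ?thesis by (simp add: cauchy_coeff_def)
qed

definition cauchy_entry :: "(nat \<Rightarrow> 'a::field) \<Rightarrow> (nat \<Rightarrow> 'a) \<Rightarrow> nat \<Rightarrow> nat \<Rightarrow> 'a" where
  "cauchy_entry W u a b = (if even a \<noteq> even b then W a * W b / (u b - u a) else 0)"

lemma cauchy_coeff_expand:
  assumes J: "finite J" "k \<in> J" "\<And>j. j \<in> J \<Longrightarrow> k \<le> j"
    and u: "\<And>a b. even a \<noteq> even b \<Longrightarrow> u a \<noteq> u b"
  shows "cauchy_coeff W u J l = (\<Sum>j\<in>J - {k}. pos_sign (J - {k}) j *
     cauchy_entry W u (l k) (l j) * cauchy_coeff W u (J - {k} - {j}) l)"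
proof -
  let ?e = "\<lambda>i. even (l i)" and ?t = "\<lambda>i. u (l i)"
  have "cauchy_coeff W u J l = (\<Prod>i\<in>J. W (l i)) *
     (if balanced ?e J then pair_prod (cauchy_factor ?e ?t) J else 0)"
    by (simp add: cauchy_coeff_def)
  also have "(if balanced ?e J then pair_prod (cauchy_factor ?e ?t) J else 0) =
     (\<Sum>j\<in>J - {k}. pos_sign (J - {k}) j * (if ?e j \<noteq> ?e k then cauchy_factor ?e ?t k j else 0) *
       (if balanced ?e (J - {k} - {j}) then pair_prod (cauchy_factor ?e ?t) (J - {k} - {j}) else 0))"
    by (rule cauchy_pfaffian_expand) (use J u in auto)
  also have "(\<Prod>i\<in>J. W (l i)) * \<dots> = (\<Sum>j\<in>J - {k}. pos_sign (J - {k}) j *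
     cauchy_entry W u (l k) (l j) * cauchy_coeff W u (J - {k} - {j}) l)"
    unfolding sum_distrib_left
  proof (rule sum.cong[OF refl])
    fix j assume j: "j \<in> J - {k}"
    have "(\<Prod>i\<in>J. W (l i)) = W (l k) * (W (l j) * (\<Prod>i\<in>J - {k} - {j}. W (l i)))"
      using J j by (simp add: prod.remove[of J k] prod.remove[of "J - {k}" j])
    then show "(\<Prod>i\<in>J. W (l i)) * (pos_sign (J - {k}) j * (if ?e j \<noteq> ?e k then cauchy_factor ?e ?t k j else 0) *
       (if balanced ?e (J - {k} - {j}) then pair_prod (cauchy_factor ?e ?t) (J - {k} - {j}) else 0)) =
      pos_sign (J - {k}) j * cauchy_entry W u (l k) (l j) * cauchy_coeff W u (J - {k} - {j}) l"
      by (simp add: cauchy_entry_def cauchy_coeff_def cauchy_factor_def)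
  qed
  finally show ?thesis .
qed

lemma mcoeff_bivar_times:
  fixes f :: "nat \<Rightarrow> nat \<Rightarrow> 'a::comm_ring_1"
  assumes R: "\<And>m. mcoeff R m = (if keys m \<subseteq> K then c (lookup m) else 0)"
    and k: "k \<notin> K" "j \<notin> K"
    and c: "\<And>l l'. (\<And>i. i \<in> K \<Longrightarrow> l i = l' i) \<Longrightarrow> c l = c l'"
  shows "mcoeff (bivar k j f * R) m =
    (if keys m \<subseteq> insert k (insert j K) then f (lookup m k) (lookup m j) * c (lookup m) else 0)"
proof -
  have "vars_in K R" by (auto simp: vars_in_def R split: if_splits)
  then have 1: "mcoeff (bivar k j f * R) m = (if keys m \<subseteq> {k, j} \<union> K
      then mcoeff (bivar k j f) (mrestr {k, j} m) * mcoeff R (mrestr K m) else 0)"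
    by (rule mcoeff_times_disjoint[OF vars_in_bivar]) (use k in auto)
  have "c (lookup (mrestr K m)) = c (lookup m)" by (rule c) (simp add: lookup_mrestr)
  then have 2: "mcoeff R (mrestr K m) = c (lookup m)"
    unfolding R by (simp add: keys_mrestr)
  have 3: "mcoeff (bivar k j f) (mrestr {k, j} m) = f (lookup m k) (lookup m j)"
    by (simp add: mcoeff_bivar keys_mrestr lookup_mrestr)
  show ?thesis unfolding 1 2 3 by simp
qed

text \<open>Let Q(x, y) be the series with coefficients \<open>cauchy_entry W u a b\<close>. The
  assumption \<open>rec\<close> is the coefficient form of (1 - xy) Q = (x - y) g(x) g(y), so Q is
  g(x) g(y) times an entry of Schur's Pfaffian. Both sides then satisfy the same expansion along the
  least index of \<open>J\<close>, and the induction removes two indices at a time.\<close>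

theorem mcoeff_antisym_product:
  fixes W u g :: "nat \<Rightarrow> 'a::field_char_0"
  assumes u: "\<And>a b. even a \<noteq> even b \<Longrightarrow> u a \<noteq> u b"
    and rec: "\<And>a b. cauchy_entry W u a b - (if a = 0 \<or> b = 0 then 0 else cauchy_entry W u (a - 1) (b - 1)) =
      (if a = 0 then 0 else g (a - 1) * g b) - (if b = 0 then 0 else g a * g (b - 1))"
    and J: "finite J" "even (card J)"
  shows "mcoeff ((\<Prod>i\<in>J. univar i g) * pair_prod antisym_factor J) m =
    (if keys m \<subseteq> J then cauchy_coeff W u J (lookup m) else 0)"
  using J
proof (induction "card J" arbitrary: J m rule: less_induct)
  case (less J)
  note J = less.prems
  show ?case
  proof (cases "J = {}")
    case True
    then show ?thesis
      by (auto simp: pair_prod_def pairs_def cauchy_coeff_def balanced_def mcoeff_one)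
  next
    case False
    define k where "k = Min J"
    have k: "k \<in> J" "\<And>j. j \<in> J \<Longrightarrow> k \<le> j" using J False by (auto simp: k_def)
    have H: "univar k g * univar j g * antisym_factor k j = bivar k j (cauchy_entry W u)" if "k \<noteq> j" for j
    proof -
      let ?Q = "bivar k j (cauchy_entry W u)"
      have "?Q * (1 - mvar k * mvar j) = ?Q - mvar k * (mvar j * ?Q)" by (simp add: algebra_simps)
      also have "\<dots> = bivar k j (\<lambda>a b. cauchy_entry W u a b - (if a = 0 \<or> b = 0 then 0 else cauchy_entry W u (a - 1) (b - 1)))"
        using that by (auto simp: mvar_times_bivar1 mvar_times_bivar2 bivar_minus intro!: arg_cong[of _ _ "bivar k j"] ext)
      also have "\<dots> = bivar k j (\<lambda>a b. (if a = 0 then 0 else g (a - 1) * g b) - (if b = 0 then 0 else g a * g (b - 1)))"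
        unfolding rec ..
      also have "\<dots> = (mvar k - mvar j) * (univar k g * univar j g)"
        using that by (simp add: univar_times_univar left_diff_distrib mvar_times_bivar1 mvar_times_bivar2 bivar_minus)
      finally have "?Q * ((1 - mvar k * mvar j) * geo k j) = (mvar k - mvar j) * (univar k g * univar j g) * geo k j"
        by (simp add: mult.assoc)
      then have "?Q = (mvar k - mvar j) * (univar k g * univar j g) * geo k j"
        unfolding geo_inverse[OF that] by simp
      then show ?thesis by (simp only: antisym_factor_def ac_simps)
    qed
    have expand: "pair_prod antisym_factor J = (\<Sum>j\<in>J - {k}. pos_sign (J - {k}) j * antisym_factor k j *
      pair_prod antisym_factor (J - {k} - {j}) :: 'a mfps)"
      by (rule antisym_factor_expand[OF J k])
    have product: "(\<Prod>i\<in>J. univar i g) * pair_prod antisym_factor J =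
      (\<Sum>j\<in>J - {k}. pos_sign (J - {k}) j * (bivar k j (cauchy_entry W u) *
         ((\<Prod>i\<in>J - {k} - {j}. univar i g) * pair_prod antisym_factor (J - {k} - {j}))))"
      unfolding expand sum_distrib_left
    proof (rule sum.cong[OF refl])
      fix j assume j: "j \<in> J - {k}"
      have "(\<Prod>i\<in>J. univar i g) = univar k g * univar j g * (\<Prod>i\<in>J - {k} - {j}. univar i g)"
        using J j k by (simp add: prod.remove[of J k] prod.remove[of "J - {k}" j] mult.assoc)
      then show "(\<Prod>i\<in>J. univar i g) * (pos_sign (J - {k}) j * antisym_factor k j * pair_prod antisym_factor (J - {k} - {j})) =
        pos_sign (J - {k}) j * (bivar k j (cauchy_entry W u) *
         ((\<Prod>i\<in>J - {k} - {j}. univar i g) * pair_prod antisym_factor (J - {k} - {j})))"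
        using H[of j, symmetric] j by (simp add: mult_ac)
    qed
    have "mcoeff ((\<Prod>i\<in>J. univar i g) * pair_prod antisym_factor J) m = (\<Sum>j\<in>J - {k}. pos_sign (J - {k}) j *
        (if keys m \<subseteq> J then cauchy_entry W u (lookup m k) (lookup m j) * cauchy_coeff W u (J - {k} - {j}) (lookup m) else 0))"
      unfolding product mcoeff_sum mcoeff_pos_sign_times
    proof (rule sum.cong[OF refl])
      fix j assume j: "j \<in> J - {k}"
      define K where "K = J - {k} - {j}"
      have "K \<subset> J" using j k(1) by (auto simp: K_def)
      then have "card K < card J" by (rule psubset_card_mono[OF J(1)])
      then have cK: "card K < card J" "even (card K)" "finite K"
        using J j k(1) by (auto simp: K_def card_Diff_singleton_if card_gt_0_iff intro: psubset_card_mono)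
      have KJ: "insert k (insert j K) = J" "k \<notin> K" "j \<notin> K" using j k(1) by (auto simp: K_def)
      have "mcoeff (bivar k j (cauchy_entry W u) * ((\<Prod>i\<in>K. univar i g) * pair_prod antisym_factor K)) m =
        (if keys m \<subseteq> insert k (insert j K)
         then cauchy_entry W u (lookup m k) (lookup m j) * cauchy_coeff W u K (lookup m) else 0)"
      proof (rule mcoeff_bivar_times[OF _ KJ(2,3) cauchy_coeff_cong])
        show "mcoeff ((\<Prod>i\<in>K. univar i g) * pair_prod antisym_factor K) m' =
          (if keys m' \<subseteq> K then cauchy_coeff W u K (lookup m') else 0)" for m'
          by (rule less.hyps) (use cK in auto)
      qed
      then show "pos_sign (J - {k}) j * mcoeff (bivar k j (cauchy_entry W u) *
          ((\<Prod>i\<in>J - {k} - {j}. univar i g) * pair_prod antisym_factor (J - {k} - {j}))) m =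
        pos_sign (J - {k}) j * (if keys m \<subseteq> J then cauchy_entry W u (lookup m k) (lookup m j) * cauchy_coeff W u (J - {k} - {j}) (lookup m) else 0)"
        unfolding KJ(1) by (simp only: K_def)
    qed
    also have "\<dots> = (if keys m \<subseteq> J then cauchy_coeff W u J (lookup m) else 0)"
      using cauchy_coeff_expand[where W = W and u = u and l = "lookup m", OF J(1) k u]
      by (simp add: mult.assoc)
    finally show ?thesis .
  qed
qed

section \<open>Diagrams and domino tilings\<close>

text \<open>Row lengths are a function of a positive index, and the value at 0 is ignored. In
  contrast to lists of nonzero parts, shortening a row needs no removal of trailing zeros.\<close>

definition row_diagram :: "(nat \<Rightarrow> nat) \<Rightarrow> (nat \<times> nat) set" where
  "row_diagram r = {(i, j). 1 \<le> i \<and> 1 \<le> j \<and> j \<le> r i}"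

definition row_shape :: "(nat \<Rightarrow> nat) \<Rightarrow> bool" where
  "row_shape r \<longleftrightarrow> (\<forall>i\<ge>1. r (Suc i) \<le> r i) \<and> (\<exists>n. \<forall>i>n. r i = 0)"

lemma row_shape_antimono: "row_shape r \<Longrightarrow> 1 \<le> i \<Longrightarrow> i \<le> j \<Longrightarrow> r j \<le> r i"
proof (induction j)
  case (Suc j)
  show ?case
  proof (cases "i = Suc j")
    case False
    then have "r j \<le> r i" using Suc by simp
    moreover have "r (Suc j) \<le> r j" using Suc.prems False by (simp add: row_shape_def)
    ultimately show ?thesis by simp
  qed simp
qed simp

lemma finite_row_diagram: "row_shape r \<Longrightarrow> finite (row_diagram r)"
proof -
  assume r: "row_shape r"
  then obtain n where n: "\<forall>i>n. r i = 0" by (auto simp: row_shape_def)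
  have "row_diagram r \<subseteq> {1..n} \<times> {1..r 1}"
  proof (clarify, rule conjI)
    fix i j assume ij: "(i, j) \<in> row_diagram r"
    then have "1 \<le> i" "1 \<le> j" "j \<le> r i" by (auto simp: row_diagram_def)
    moreover have "\<not> n < i" using n \<open>1 \<le> j\<close> \<open>j \<le> r i\<close> by force
    moreover have "r i \<le> r 1" using row_shape_antimono[OF r, of 1 i] \<open>1 \<le> i\<close> by simp
    ultimately show "i \<in> {1..n}" "j \<in> {1..r 1}" by auto
  qed
  then show ?thesis by (rule finite_subset) simp
qed

text \<open>A chessboard colouring: the two cells of a domino have opposite signs.\<close>

definition colour_sum :: "(nat \<times> nat) set \<Rightarrow> int" where
  "colour_sum S = (\<Sum>(i, j)\<in>S. (- 1) ^ (i + j))"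

definition tileable :: "(nat \<times> nat) set \<Rightarrow> bool" where
  "tileable S \<longleftrightarrow> (\<exists>P. partition_on S P \<and> (\<forall>d\<in>P. is_domino d))"

lemma domino_finite: "is_domino d \<Longrightarrow> finite d" by (auto simp: is_domino_def)

lemma colour_sum_domino: "is_domino d \<Longrightarrow> colour_sum d = 0"
  by (auto simp: is_domino_def colour_sum_def)

lemma colour_sum_tileable: "tileable S \<Longrightarrow> colour_sum S = 0"
proof -
  assume "tileable S"
  then obtain P where P: "partition_on S P" "\<And>d. d \<in> P \<Longrightarrow> is_domino d" by (auto simp: tileable_def)
  have S: "S = \<Union> P" using P(1) by (auto simp: partition_on_def)
  have "colour_sum S = (\<Sum>d\<in>P. colour_sum d)"
    unfolding colour_sum_def S
    using P(1) by (subst sum.Union_disjoint) (auto simp: domino_finite P partition_on_def disjoint_def)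
  then show ?thesis by (simp add: P colour_sum_domino)
qed

lemma tileable_Un_domino:
  assumes "tileable S" "is_domino d" "S \<inter> d = {}"
  shows "tileable (S \<union> d)"
proof -
  obtain P where P: "partition_on S P" "\<And>d. d \<in> P \<Longrightarrow> is_domino d" using assms by (auto simp: tileable_def)
  have "d \<noteq> {}" using assms by (auto simp: is_domino_def)
  then have "partition_on (S \<union> d) (insert d P)"
    using P(1) assms(3) by (auto simp: partition_on_def disjoint_def)
  then show ?thesis using P(2) assms(2) by (auto simp: tileable_def)
qed

lemma colour_sum_Un_domino:
  assumes "finite S" "is_domino d" "S \<inter> d = {}"
  shows "colour_sum (S \<union> d) = colour_sum S"
  using assms colour_sum_domino[OF assms(2)] unfolding colour_sum_def
  by (subst sum.union_disjoint) (auto simp: domino_finite)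

lemma colour_sum_rows:
  assumes "\<And>i. i > n \<Longrightarrow> r i = 0"
  shows "colour_sum (row_diagram r) = (\<Sum>i = 1..n. if odd (r i) then (- 1) ^ (i + 1) else 0)"
proof -
  have row: "(\<Sum>j = 1..a. (- 1 :: int) ^ (i + j)) = (if odd a then (- 1) ^ (i + 1) else 0)" for i a :: nat
    by (induction a) (auto simp: power_add minus_one_power_iff)
  have "row_diagram r = (SIGMA i:{1..n}. {1..r i})"
    using assms by (auto simp: row_diagram_def) (metis not_less not_less_zero less_le_trans neq0_conv zero_less_one One_nat_def Suc_le_eq)
  then have "colour_sum (row_diagram r) = (\<Sum>i = 1..n. \<Sum>j = 1..r i. (- 1) ^ (i + j))"
    by (simp add: colour_sum_def sum.Sigma)
  then show ?thesis by (simp only: row)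
qed

text \<open>Dominoes are peeled off the rim: a horizontal one from a row that exceeds the next by at
  least 2, a vertical one from two equal rows followed by a shorter row. If neither exists, the
  shape is a staircase, and a nonempty staircase has nonzero colour sum.\<close>

lemma colour_sum_eq_0_imp_tileable:
  assumes "row_shape r" "colour_sum (row_diagram r) = 0"
  shows "tileable (row_diagram r)"
  using assms
proof (induction "card (row_diagram r)" arbitrary: r rule: less_induct)
  case less
  note r = less.prems(1)
  have step: "tileable (row_diagram r)"
    if r': "row_shape r'" and d: "is_domino d" "row_diagram r = row_diagram r' \<union> d" "row_diagram r' \<inter> d = {}" for r' d
  proof -
    have fin: "finite (row_diagram r')" by (rule finite_row_diagram[OF r'])
    have "d \<noteq> {}" using d(1) by (auto simp: is_domino_def)
    then have "card (row_diagram r') < card (row_diagram r)"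
      using d fin by (simp add: card_Un_disjoint domino_finite card_gt_0_iff)
    moreover have "colour_sum (row_diagram r') = 0"
      using less.prems(2) colour_sum_Un_domino[OF fin d(1,3)] d(2) by simp
    ultimately have "tileable (row_diagram r')" using less.hyps r' by blast
    then show ?thesis using tileable_Un_domino d by metis
  qed
  show ?case
  proof (cases "\<exists>i\<ge>1. r i \<ge> r (Suc i) + 2")
    case True
    then obtain i where i: "i \<ge> 1" "r i \<ge> r (Suc i) + 2" by blast
    define r' where "r' = r(i := r i - 2)"
    show ?thesis
    proof (rule step)
      obtain n where n: "\<forall>i>n. r i = 0" using r by (auto simp: row_shape_def)
      have "r' (Suc k) \<le> r' k" if "k \<ge> 1" for k
      proof -
        have "r (Suc k) \<le> r k" using r that by (auto simp: row_shape_def)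
        then show ?thesis using i by (auto simp: r'_def)
      qed
      moreover have "\<forall>k>n. r' k = 0" using n i by (auto simp: r'_def)
      ultimately show "row_shape r'" unfolding row_shape_def by blast
      show "is_domino {(i, r i - 1), (i, r i - 1 + 1)}" by (auto simp: is_domino_def)
      show "row_diagram r = row_diagram r' \<union> {(i, r i - 1), (i, r i - 1 + 1)}"
        using i by (auto simp: row_diagram_def r'_def split: if_splits)
      show "row_diagram r' \<inter> {(i, r i - 1), (i, r i - 1 + 1)} = {}"
        using i by (auto simp: row_diagram_def r'_def)
    qed
  next
    case False
    then have A: "r i \<le> r (Suc i) + 1" if "i \<ge> 1" for i using that by force
    show ?thesis
    proof (cases "\<exists>i\<ge>1. r i = r (Suc i) \<and> r (Suc (Suc i)) < r (Suc i)")
      case True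
      then obtain i where i: "i \<ge> 1" "r i = r (Suc i)" "r (Suc (Suc i)) < r (Suc i)" by blast
      define r' where "r' = r(i := r i - 1, Suc i := r i - 1)"
      show ?thesis
      proof (rule step)
        obtain n where n: "\<forall>i>n. r i = 0" using r by (auto simp: row_shape_def)
        have "r' (Suc k) \<le> r' k" if "k \<ge> 1" for k
        proof -
          have "r (Suc k) \<le> r k" using r that by (auto simp: row_shape_def)
          then show ?thesis using i by (auto simp: r'_def)
        qed
        moreover have "\<forall>k>n. r' k = 0" using n i by (auto simp: r'_def)
        ultimately show "row_shape r'" unfolding row_shape_def by blast
        show "is_domino {(i, r i), (i + 1, r i)}" unfolding is_domino_def by blast
        show "row_diagram r = row_diagram r' \<union> {(i, r i), (i + 1, r i)}"
          using i by (auto simp: row_diagram_def r'_def split: if_splits)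
        show "row_diagram r' \<inter> {(i, r i), (i + 1, r i)} = {}"
          using i by (auto simp: row_diagram_def r'_def)
      qed
    next
      case False
      then have B: "r (Suc (Suc i)) = r (Suc i)" if "i \<ge> 1" "r i = r (Suc i)" for i
        using that row_shape_antimono[OF r, of "Suc i" "Suc (Suc i)"] by force
      obtain n where n: "\<forall>i>n. r i = 0" using r by (auto simp: row_shape_def)
      \<comment> \<open>Without a removable vertical domino, two equal consecutive rows repeat
        forever and so are empty. Together with \<open>A\<close> this makes the nonempty rows drop
        by exactly 1.\<close>
      have const: "r (Suc i + k) = r i" if "i \<ge> 1" "r i = r (Suc i)" for i k
      proof -
        have "r (i + k) = r i \<and> r (Suc (i + k)) = r i"
        proof (induction k)
          case 0 then show ?case using that by simp
        next
          case (Suc k) then show ?case using B[of "i + k"] that by simp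
        qed
        then show ?thesis by simp
      qed
      have zero: "r i = 0" if "i \<ge> 1" "r i = r (Suc i)" for i
        using const[OF that, of n] n by simp
      have stair: "r (Suc i) = r 1 - i" for i
      proof (induction i)
        case (Suc i)
        have "r (Suc (Suc i)) \<le> r (Suc i)" using r by (auto simp: row_shape_def)
        with A[of "Suc i"] have "r (Suc (Suc i)) = r (Suc i) \<or> r (Suc i) = Suc (r (Suc (Suc i)))" by force
        then show ?case using zero[of "Suc i"] Suc by fastforce
      qed simp
      define m where "m = r 1"
      have m0: "r i = 0" if "i > m" for i using stair[of "i - 1"] that by (simp add: m_def)
      have "m = 0"
      proof (rule ccontr)
        assume m: "m \<noteq> 0"
        have "colour_sum (row_diagram r) = (\<Sum>i = 1..m. if odd (r i) then (- 1) ^ (i + 1) else 0)"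
          by (rule colour_sum_rows) (rule m0)
        \<comment> \<open>Row i of the staircase has length m + 1 - i, which is odd exactly when i
          and m have the same parity. All odd rows therefore contribute with the same sign.\<close>
        also have "\<dots> = (\<Sum>i = 1..m. (- 1) ^ (m + 1) * (if odd (r i) then 1 else 0))"
        proof (rule sum.cong[OF refl])
          fix i assume i: "i \<in> {1..m}"
          then have "r i = m + 1 - i" using stair[of "i - 1"] by (simp add: m_def)
          then have "odd (r i) \<Longrightarrow> even (i + 1) = even (m + 1)" using i by auto
          then show "(if odd (r i) then (- 1) ^ (i + 1) else 0) = (- 1 :: int) ^ (m + 1) * (if odd (r i) then 1 else 0)"
            by (auto simp: minus_one_power_iff)
        qed
        also have "\<dots> = (- 1) ^ (m + 1) * (\<Sum>i = 1..m. if odd (r i) then 1 else 0)" by (simp only: sum_distrib_left)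
        finally have "(\<Sum>i = 1..m. if odd (r i) then 1 else 0 :: int) = 0" using less.prems(2) by simp
        moreover have "r m = 1" using stair[of "m - 1"] m by (simp add: m_def)
        ultimately show False using m
          by (subst (asm) sum_nonneg_eq_0_iff) (auto dest: bspec[of _ _ m])
      qed
      then have "row_diagram r = {}" using m0 by (auto simp: row_diagram_def)
      then show ?thesis unfolding tileable_def by (intro exI[of _ "{}"]) (simp add: partition_on_def)
    qed
  qed
qed

section \<open>Partitions as row functions, and their conjugates\<close>

lemma part_antimono: "is_partition la \<Longrightarrow> 1 \<le> i \<Longrightarrow> i \<le> j \<Longrightarrow> part la j \<le> part la i"
  using sorted_wrt_nth_less[of "(\<ge>)" la "i - 1" "j - 1"]
  by (cases "i = j") (auto simp: part_def is_partition_def)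

lemma part_beyond: "length la < i \<Longrightarrow> part la i = 0"
  by (simp add: part_def)

lemma row_shape_part: "is_partition la \<Longrightarrow> row_shape (part la)"
  unfolding row_shape_def using part_antimono part_beyond by (metis le_SucI order_refl)

lemma diagram_eq: "diagram la = row_diagram (part la)"
  by (simp add: diagram_def row_diagram_def)

lemma diagram_Sigma:
  assumes "length la \<le> n"
  shows "diagram la = (SIGMA i:{1..n}. {1..part la i})"
proof (intro Set.set_eqI iffI)
  fix s assume s: "s \<in> diagram la"
  obtain i j where [simp]: "s = (i, j)" by force
  have "1 \<le> part la i" using s by (auto simp: diagram_def)
  then have "\<not> length la < i" using part_beyond by force
  then show "s \<in> (SIGMA i:{1..n}. {1..part la i})" using s assms by (auto simp: diagram_def)
qed (auto simp: diagram_def)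

lemma part_conjugate:
  assumes la: "is_partition la" and j: "1 \<le> j"
  shows "part (conjugate la) j = card {i. 1 \<le> i \<and> j \<le> part la i}"
proof -
  have len: "length (conjugate la) = part la 1" by (simp add: conjugate_def del: upt_Suc)
  show ?thesis
proof (cases "j \<le> part la 1")
  case True
  then have "[1..<part la 1 + 1] ! (j - 1) = j"
    using j by (subst nth_upt) auto
  then have "conjugate la ! (j - 1) = card {i. 1 \<le> i \<and> j \<le> part la i}"
    unfolding conjugate_def using True j by (subst nth_map) (simp_all del: upt_Suc)
  then show ?thesis
    using True j by (simp add: part_def[of "conjugate la" j] len)
next
  case False
  have "\<not> j \<le> part la i" if "1 \<le> i" for i
    using part_antimono[OF la order_refl that] False by simp
  then have "card {i. 1 \<le> i \<and> j \<le> part la i} = 0" by (metis (no_types, lifting) card.empty empty_Collect_eq)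
  then show ?thesis using False by (simp add: part_def[of "conjugate la" j] len)
qed
qed

text \<open>The rows that reach column \<open>j\<close> form an initial segment, so there are at
  least \<open>i\<close> of them exactly when row \<open>i\<close> is one of them.\<close>

lemma le_part_conjugate_iff:
  assumes la: "is_partition la" and ij: "1 \<le> i" "1 \<le> j"
  shows "i \<le> part (conjugate la) j \<longleftrightarrow> j \<le> part la i"
proof -
  let ?S = "{i. 1 \<le> i \<and> j \<le> part la i}"
  have "?S \<subseteq> {1..length la}" using part_beyond[of la] ij(2) by (force simp: not_less[symmetric])
  then have fin: "finite ?S" by (rule finite_subset) simp
  show ?thesis
  proof
    assume "j \<le> part la i"
    then have "{1..i} \<subseteq> ?S" using part_antimono[OF la] by (auto intro: order_trans)
    then have "card {1..i} \<le> card ?S" by (rule card_mono[OF fin])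
    then show "i \<le> part (conjugate la) j" by (simp add: part_conjugate[OF la ij(2)])
  next
    assume i: "i \<le> part (conjugate la) j"
    show "j \<le> part la i"
    proof (rule ccontr)
      assume "\<not> j \<le> part la i"
      then have "?S \<subseteq> {1..<i}" using part_antimono[OF la ij(1)] by (force simp: not_le)
      then have "card ?S \<le> card {1..<i}" by (rule card_mono[rotated]) simp
      then show False using i ij by (simp add: part_conjugate[OF la ij(2)])
    qed
  qed
qed

section \<open>Beta numbers\<close>

text \<open>Indices start at 0 here, so this is \<lambda>_(i+1) + n - (i+1). Adding the staircase
  makes the sequence strictly decreasing.\<close>

definition beta :: "nat \<Rightarrow> nat list \<Rightarrow> nat \<Rightarrow> nat" where
  "beta n la i = part la (Suc i) + (n - 1 - i)"

lemma beta_less: "is_partition la \<Longrightarrow> i < k \<Longrightarrow> k < n \<Longrightarrow> beta n la k < beta n la i"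
  using part_antimono[of la "Suc i" "Suc k"] by (simp add: beta_def)

text \<open>The hook lengths of a row and the differences to the later beta numbers together fill
  {1..l_i}: both families are injective, they are disjoint and bounded by l_i, and their sizes
  \<lambda>_(i+1) and n - 1 - i add up to l_i. Products and sums over hooks thereby become products
  and sums over beta numbers.\<close>

lemma hook_row:
  assumes la: "is_partition la" and n: "length la \<le> n" and i: "i < n"
  defines "H \<equiv> (\<lambda>j. hook la (Suc i, j)) ` {1..part la (Suc i)}"
    and "D \<equiv> (\<lambda>k. beta n la i - beta n la k) ` {i<..<n}"
  shows "inj_on (\<lambda>j. hook la (Suc i, j)) {1..part la (Suc i)}"
    and "inj_on (\<lambda>k. beta n la i - beta n la k) {i<..<n}"
    and "H \<inter> D = {}" and "H \<union> D = {1..beta n la i}"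
proof -
  let ?a = "part la (Suc i)" and ?c = "\<lambda>j. part (conjugate la) j"
  have hook: "hook la (Suc i, j) = ?a - j + (?c j - Suc i) + 1" for j by (simp add: hook_def)
  have c: "Suc i \<le> ?c j" if "1 \<le> j" "j \<le> ?a" for j
    using le_part_conjugate_iff[OF la, of "Suc i" j] that by simp
  have cle: "?c j \<le> n" if "1 \<le> j" for j
  proof (rule ccontr)
    assume "\<not> ?c j \<le> n"
    then have "j \<le> part la (Suc n)" using le_part_conjugate_iff[OF la, of "Suc n" j] that by simp
    then show False using part_beyond[of la "Suc n"] n that by simp
  qed
  have cmono: "?c j' \<le> ?c j" if "1 \<le> j" "j \<le> j'" for j j'
  proof (rule ccontr)
    assume "\<not> ?c j' \<le> ?c j"
    then have "j' \<le> part la (?c j')" using le_part_conjugate_iff[OF la, of "?c j'" j'] that by simp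
    then have "?c j' \<le> ?c j" using le_part_conjugate_iff[OF la, of "?c j'" j] that \<open>\<not> ?c j' \<le> ?c j\<close> by simp
    then show False using \<open>\<not> ?c j' \<le> ?c j\<close> by simp
  qed
  show inj1: "inj_on (\<lambda>j. hook la (Suc i, j)) {1..?a}"
  proof (rule linorder_inj_onI)
    fix j j' assume "j < j'" "j \<in> {1..?a}" "j' \<in> {1..?a}"
    then show "hook la (Suc i, j) \<noteq> hook la (Suc i, j')"
      using cmono[of j j'] c[of j'] by (auto simp: hook)
  qed auto
  show inj2: "inj_on (\<lambda>k. beta n la i - beta n la k) {i<..<n}"
  proof (rule linorder_inj_onI)
    fix k k' assume "k < k'" "k \<in> {i<..<n}" "k' \<in> {i<..<n}"
    then show "beta n la i - beta n la k \<noteq> beta n la i - beta n la k'"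
      using beta_less[OF la, of k k' n] beta_less[OF la, of i k n] by auto
  qed auto
  \<comment> \<open>The comparison depends on the cell in row k + 1 and column j: if it lies in the
    diagram, the hook is longer than the difference, otherwise it is shorter.\<close>
  show disj: "H \<inter> D = {}"
  proof -
    have "hook la (Suc i, j) \<noteq> beta n la i - beta n la k" if j: "j \<in> {1..?a}" and k: "k \<in> {i<..<n}" for j k
    proof -
      have ak: "part la (Suc k) \<le> ?a" using part_antimono[OF la, of "Suc i" "Suc k"] k by simp
      have d: "beta n la i - beta n la k = ?a - part la (Suc k) + (k - i)"
        using k ak by (auto simp: beta_def)
      show ?thesis
      proof (cases "Suc k \<le> ?c j")
        case True
        then have "j \<le> part la (Suc k)" using le_part_conjugate_iff[OF la, of "Suc k" j] j by simp
        then show ?thesis using True ak j k unfolding d hook by auto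
      next
        case False
        then have "\<not> j \<le> part la (Suc k)" using le_part_conjugate_iff[OF la, of "Suc k" j] j by simp
        then show ?thesis using False ak j k c[of j] unfolding d hook by auto
      qed
    qed
    then show ?thesis unfolding H_def D_def by blast
  qed
  have sub: "H \<union> D \<subseteq> {1..beta n la i}"
  proof -
    have "hook la (Suc i, j) \<in> {1..beta n la i}" if "j \<in> {1..?a}" for j
      using that c[of j] cle[of j] i by (auto simp: hook beta_def)
    moreover have "beta n la i - beta n la k \<in> {1..beta n la i}" if "k \<in> {i<..<n}" for k
      using that beta_less[OF la, of i k n] by auto
    ultimately show ?thesis unfolding H_def D_def by blast
  qed
  have "card (H \<union> D) = card H + card D" using disj by (intro card_Un_disjoint) (auto simp: H_def D_def)
  also have "card H = ?a" using inj1 by (simp add: H_def card_image)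
  also have "card D = n - 1 - i" using inj2 by (simp add: D_def card_image)
  finally have "card (H \<union> D) = card {1..beta n la i}" by (simp add: beta_def)
  then show "H \<union> D = {1..beta n la i}" using sub by (intro card_subset_eq) auto
qed

lemma prod_hook_row:
  fixes f :: "nat \<Rightarrow> 'a::comm_monoid_mult"
  assumes la: "is_partition la" and n: "length la \<le> n" and i: "i < n"
  shows "(\<Prod>j = 1..part la (Suc i). f (hook la (Suc i, j))) * (\<Prod>k\<in>{i<..<n}. f (beta n la i - beta n la k)) =
    (\<Prod>h = 1..beta n la i. f h)"
proof -
  note row = hook_row[OF assms]
  show ?thesis
    unfolding row(4)[symmetric] prod.union_disjoint[OF finite_imageI finite_imageI row(3), OF finite_atLeastAtMost finite_greaterThanLessThan]
      prod.reindex[OF row(1)] prod.reindex[OF row(2)] by simp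
qed

lemma sum_hook_row:
  fixes f :: "nat \<Rightarrow> 'a::comm_monoid_add"
  assumes la: "is_partition la" and n: "length la \<le> n" and i: "i < n"
  shows "(\<Sum>j = 1..part la (Suc i). f (hook la (Suc i, j))) + (\<Sum>k\<in>{i<..<n}. f (beta n la i - beta n la k)) =
    (\<Sum>h = 1..beta n la i. f h)"
proof -
  note row = hook_row[OF assms]
  show ?thesis
    unfolding row(4)[symmetric] sum.union_disjoint[OF finite_imageI finite_imageI row(3), OF finite_atLeastAtMost finite_greaterThanLessThan]
      sum.reindex[OF row(1)] sum.reindex[OF row(2)] by simp
qed

lemma pairs_Sigma: "pairs {..<n} = (SIGMA i:{..<n}. {i<..<n})"
  by (auto simp: pairs_def)

lemma prod_diagram:
  assumes "length la \<le> n"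
  shows "(\<Prod>s\<in>diagram la. f s) = (\<Prod>i<n. \<Prod>j = 1..part la (Suc i). f (Suc i, j))"
proof -
  have "(\<Prod>s\<in>diagram la. f s) = (\<Prod>i = 1..n. \<Prod>j = 1..part la i. f (i, j))"
    unfolding diagram_Sigma[OF assms] by (subst prod.Sigma) auto
  also have "\<dots> = (\<Prod>i<n. \<Prod>j = 1..part la (Suc i). f (Suc i, j))"
    by (rule prod.reindex_bij_witness[of _ Suc "\<lambda>i. i - 1"]) auto
  finally show ?thesis .
qed

lemma sum_diagram:
  assumes "length la \<le> n"
  shows "(\<Sum>s\<in>diagram la. f s) = (\<Sum>i<n. \<Sum>j = 1..part la (Suc i). f (Suc i, j))"
proof -
  have "(\<Sum>s\<in>diagram la. f s) = (\<Sum>i = 1..n. \<Sum>j = 1..part la i. f (i, j))"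
    unfolding diagram_Sigma[OF assms] by (subst sum.Sigma) auto
  also have "\<dots> = (\<Sum>i<n. \<Sum>j = 1..part la (Suc i). f (Suc i, j))"
    by (rule sum.reindex_bij_witness[of _ Suc "\<lambda>i. i - 1"]) auto
  finally show ?thesis .
qed

lemma hook_product:
  fixes f :: "nat \<Rightarrow> 'a::comm_monoid_mult"
  assumes la: "is_partition la" and n: "length la \<le> n"
  shows "(\<Prod>s\<in>diagram la. f (hook la s)) * (\<Prod>(i, k)\<in>pairs {..<n}. f (beta n la i - beta n la k)) =
    (\<Prod>i<n. \<Prod>h = 1..beta n la i. f h)"
  unfolding prod_diagram[OF n] pairs_Sigma
  by (subst prod.Sigma[symmetric]) (auto simp: prod.distrib[symmetric] prod_hook_row[OF la n] simp del: One_nat_def)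

text \<open>What one hook length contributes to the quotient of the odd and the even product. Having
  a single function for both parities lets \<open>hook_product\<close> apply.\<close>

definition hook_factor :: "'a::field \<Rightarrow> nat \<Rightarrow> 'a" where
  "hook_factor q h = (if odd h then 1 - q ^ h else 1 / (1 - q ^ h))"

lemma finite_diagram: "finite (diagram la)"
  by (subst diagram_Sigma[OF order_refl]) auto

lemma hook_ratio:
  "(\<Prod>h\<in>#odd_hook_lengths la. 1 - q ^ h) / (\<Prod>h\<in>#even_hook_lengths la. 1 - q ^ h) =
    (\<Prod>s\<in>diagram la. hook_factor q (hook la s))" for q :: "'a::field"
proof -
  have *: "(\<Prod>h\<in>#filter_mset odd M. 1 - q ^ h) / (\<Prod>h\<in>#filter_mset even M. 1 - q ^ h) =
    (\<Prod>h\<in>#M. hook_factor q h)" for M :: "nat multiset"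
  proof (induction M)
    case (add x M)
    show ?case
    proof (cases "odd x")
      case True
      then show ?thesis using add by (simp add: hook_factor_def flip: times_divide_eq_right)
    next
      case False
      have "(\<Prod>h\<in>#filter_mset odd M. 1 - q ^ h) / ((1 - q ^ x) * (\<Prod>h\<in>#filter_mset even M. 1 - q ^ h)) =
        1 / (1 - q ^ x) * ((\<Prod>h\<in>#filter_mset odd M. 1 - q ^ h) / (\<Prod>h\<in>#filter_mset even M. 1 - q ^ h))"
        by simp
      moreover have "hook_factor q x = 1 / (1 - q ^ x)" using False by (simp add: hook_factor_def)
      ultimately show ?thesis using False unfolding add by simp
    qed
  qed simp
  show ?thesis
    unfolding odd_hook_lengths_def even_hook_lengths_def * hook_lengths_def
    by (simp add: prod_unfold_prod_mset image_mset.compositionality comp_def)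
qed

lemma empty_2core_iff_colour_sum:
  "is_partition la \<Longrightarrow> empty_2core la \<longleftrightarrow> colour_sum (diagram la) = 0"
  using colour_sum_tileable colour_sum_eq_0_imp_tileable row_shape_part
  unfolding empty_2core_def tileable_def[symmetric] diagram_eq by blast

definition sg :: "nat \<Rightarrow> int" where "sg l = (if even l then 1 else - 1)"

lemma sg_diff: "b \<le> a \<Longrightarrow> sg (a - b) = sg a * sg b" by (auto simp: sg_def)
lemma sg_square [simp]: "sg a * sg a = 1" by (simp add: sg_def)
lemma sg_power: "(- 1) ^ a = sg a" by (simp add: sg_def minus_one_power_iff)

lemma sum_sg_even: "even n \<Longrightarrow> (\<Sum>i<n. sg i) = 0"
proof -
  have "(\<Sum>i<n. sg i) = (if even n then 0 else 1)" by (induction n) (auto simp: sg_def)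
  then show "even n \<Longrightarrow> ?thesis" by simp
qed

lemma sum_sg_balanced: "finite J \<Longrightarrow> balanced (\<lambda>i. even (l i)) J \<longleftrightarrow> (\<Sum>i\<in>J. sg (l i)) = 0"
proof -
  assume J: "finite J"
  have "(\<Sum>i\<in>J. sg (l i)) = int (card {i \<in> J. even (l i)}) - int (card {i \<in> J. odd (l i)})"
    using J by (simp add: sg_def sum.If_cases Int_def)
  then show ?thesis by (auto simp: balanced_def)
qed

text \<open>Twice the colour sum equals the sum of the signs of the beta numbers: for even
  \<open>n\<close>, the contribution of row i + 1, doubled, is
  \<open>sg (beta n la i) + sg i\<close>, and the signs \<open>sg i\<close> add up to zero.\<close>

lemma empty_2core_iff_balanced:
  assumes la: "is_partition la" and n: "length la \<le> n" "even n"
  shows "empty_2core la \<longleftrightarrow> balanced (\<lambda>i. even (beta n la i)) {..<n}"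
proof -
  have "colour_sum (diagram la) = (\<Sum>i = 1..n. if odd (part la i) then (- 1) ^ (i + 1) else 0)"
    unfolding diagram_eq by (rule colour_sum_rows) (use n in \<open>simp add: part_beyond\<close>)
  also have "\<dots> = (\<Sum>i<n. if odd (part la (Suc i)) then (- 1) ^ (Suc i + 1) else 0)"
    by (rule sum.reindex_bij_witness[of _ Suc "\<lambda>i. i - 1"]) auto
  also have "2 * \<dots> = (\<Sum>i<n. sg (beta n la i) + sg i)"
    unfolding sum_distrib_left by (rule sum.cong) (use n in \<open>auto simp: sg_def beta_def minus_one_power_iff\<close>)
  also have "\<dots> = (\<Sum>i<n. sg (beta n la i))"
    by (simp add: sum.distrib sum_sg_even n)
  finally have "(\<Sum>i<n. sg (beta n la i)) = 2 * colour_sum (diagram la)" ..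
  then show ?thesis
    unfolding empty_2core_iff_colour_sum[OF la] sum_sg_balanced[OF finite_lessThan] by simp
qed

section \<open>The statistic b in terms of beta numbers\<close>

lemma b_stat_hook:
  assumes la: "is_partition la"
  shows "b_stat la = (\<Sum>s\<in>diagram la. sg (hook la s) * (int (part la (fst s)) - int (fst s)))"
  unfolding b_stat_def
proof (rule sum.cong[OF refl])
  fix s assume s: "s \<in> diagram la"
  obtain i j where [simp]: "s = (i, j)" by force
  have ij: "1 \<le> i" "1 \<le> j" "j \<le> part la i" using s by (auto simp: diagram_def)
  then have "i \<le> part (conjugate la) j" using le_part_conjugate_iff[OF la] by simp
  then have "part la i + part (conjugate la) j + 1 - i - j = hook la (i, j)"
    using ij by (simp add: hook_def)
  then show "(case s of (i, j) \<Rightarrow> (- 1) ^ (part la i + part (conjugate la) j + 1 - i - j) * (int (part la i) - int i)) =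
    sg (hook la s) * (int (part la (fst s)) - int (fst s))" by (simp add: sg_power)
qed

lemma is_partition_conjugate:
  assumes la: "is_partition la" shows "is_partition (conjugate la)"
proof -
  have len: "length (conjugate la) = part la 1" by (simp add: conjugate_def)
  have nth: "conjugate la ! k = part (conjugate la) (Suc k)" if "k < part la 1" for k
    using that by (simp add: part_def[of "conjugate la"] len)
  have "conjugate la ! k' \<le> conjugate la ! k" if "k < k'" "k' < part la 1" for k k'
  proof -
    let ?c = "part (conjugate la) (Suc k')"
    have "?c \<le> part (conjugate la) (Suc k)"
    proof (cases "?c = 0")
      case False
      then have "Suc k' \<le> part la ?c" using le_part_conjugate_iff[OF la, of ?c "Suc k'"] by simp
      then show ?thesis using le_part_conjugate_iff[OF la, of ?c "Suc k"] that False by simp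
    qed simp
    then show ?thesis using nth that by simp
  qed
  then have "sorted_wrt (\<ge>) (conjugate la)" by (simp add: sorted_wrt_iff_nth_less len)
  moreover have "0 < conjugate la ! k" if "k < part la 1" for k
    using le_part_conjugate_iff[OF la, of 1 "Suc k"] nth[OF that] that by simp
  then have "0 \<notin> set (conjugate la)" by (auto simp: in_set_conv_nth len)
  ultimately show ?thesis by (simp add: is_partition_def)
qed

lemma part_conjugate_conjugate:
  assumes la: "is_partition la" and i: "1 \<le> i"
  shows "part (conjugate (conjugate la)) i = part la i"
proof -
  note la' = is_partition_conjugate[OF la]
  have "j \<le> part (conjugate (conjugate la)) i \<longleftrightarrow> j \<le> part la i" if "1 \<le> j" for j
    using le_part_conjugate_iff[OF la' that i] le_part_conjugate_iff[OF la i that] by simp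
  then show ?thesis
    by (metis One_nat_def Suc_leI le_antisym le_zero_eq neq0_conv order_refl)
qed

lemma diagram_conjugate:
  assumes la: "is_partition la"
  shows "diagram (conjugate la) = prod.swap ` diagram la"
  using le_part_conjugate_iff[OF la] by (fastforce simp: diagram_def image_iff)

text \<open>Transposition preserves hook lengths, and at a cell with hook length h the two weights
  \<lambda>_i - i and \<lambda>'_j - j add up to h - 1.\<close>

lemma b_stat_conjugate:
  assumes la: "is_partition la"
  shows "b_stat (conjugate la) = (\<Sum>s\<in>diagram la. sg (hook la s) * (int (hook la s) - 1)) - b_stat la"
proof -
  have "b_stat (conjugate la) =
    (\<Sum>s\<in>diagram la. sg (hook (conjugate la) (prod.swap s)) * (int (part (conjugate la) (snd s)) - int (snd s)))"
    unfolding b_stat_hook[OF is_partition_conjugate[OF la]] diagram_conjugate[OF la]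
    by (subst sum.reindex) auto
  also have "\<dots> = (\<Sum>s\<in>diagram la. sg (hook la s) * (int (hook la s) - 1) -
      sg (hook la s) * (int (part la (fst s)) - int (fst s)))"
  proof (rule sum.cong[OF refl])
    fix s assume s: "s \<in> diagram la"
    obtain i j where [simp]: "s = (i, j)" by force
    have ij: "1 \<le> i" "1 \<le> j" "j \<le> part la i" using s by (auto simp: diagram_def)
    then have i: "i \<le> part (conjugate la) j" using le_part_conjugate_iff[OF la] by simp
    have "hook (conjugate la) (j, i) = hook la (i, j)"
      using part_conjugate_conjugate[OF la ij(1)] by (simp add: hook_def)
    moreover have "int (part (conjugate la) j) - int j = (int (hook la (i, j)) - 1) - (int (part la i) - int i)"
      using i ij by (simp add: hook_def)
    ultimately show "sg (hook (conjugate la) (prod.swap s)) * (int (part (conjugate la) (snd s)) - int (snd s)) =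
      sg (hook la s) * (int (hook la s) - 1) - sg (hook la s) * (int (part la (fst s)) - int (fst s))"
      by (simp only: \<open>s = (i, j)\<close> swap_simp fst_conv snd_conv right_diff_distrib)
  qed
  finally show ?thesis by (simp add: sum_subtractf b_stat_hook[OF la])
qed

text \<open>The first part is the expansion of 0 = (sum of all signs)^2. The second trades the signs
  after \<open>i\<close> for those before \<open>i\<close>; this is how balance enters both formulas
  for b.\<close>

lemma sum_sg_pairs:
  assumes bal: "(\<Sum>i<n. sg (l i)) = 0"
  shows "2 * (\<Sum>(i, k)\<in>pairs {..<n}. sg (l i) * sg (l k)) = - int n"
    and "i < n \<Longrightarrow> sg (l i) * (\<Sum>k\<in>{i<..<n}. sg (l k)) = - 1 - sg (l i) * (\<Sum>k<i. sg (l k))"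
proof -
  have row: "sg (l i) * (\<Sum>k\<in>{i<..<n}. sg (l k)) = - 1 - sg (l i) * (\<Sum>k<i. sg (l k))" if "i < n" for i
  proof -
    have "(\<Sum>k<n. sg (l k)) = (\<Sum>k\<in>{..<i} \<union> insert i {i<..<n}. sg (l k))"
      by (rule sum.cong) (use that in auto)
    also have "\<dots> = (\<Sum>k<i. sg (l k)) + (\<Sum>k\<in>insert i {i<..<n}. sg (l k))"
      by (rule sum.union_disjoint) auto
    finally have *: "(\<Sum>k\<in>{i<..<n}. sg (l k)) = - sg (l i) - (\<Sum>k<i. sg (l k))" using bal by simp
    show ?thesis unfolding * by (simp add: right_diff_distrib)
  qed
  then show "i < n \<Longrightarrow> sg (l i) * (\<Sum>k\<in>{i<..<n}. sg (l k)) = - 1 - sg (l i) * (\<Sum>k<i. sg (l k))" .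
  have "(\<Sum>(i, k)\<in>pairs {..<n}. sg (l i) * sg (l k)) = (\<Sum>i<n. sg (l i) * (\<Sum>k\<in>{i<..<n}. sg (l k)))"
    unfolding pairs_Sigma by (subst sum.Sigma[symmetric]) (auto simp: sum_distrib_left)
  also have "\<dots> = - int n - (\<Sum>i<n. sg (l i) * (\<Sum>k<i. sg (l k)))"
    by (simp add: row sum_subtractf sum_negf)
  also have "(\<Sum>i<n. sg (l i) * (\<Sum>k<i. sg (l k))) = (\<Sum>(i, k)\<in>pairs {..<n}. sg (l i) * sg (l k))"
    unfolding sum_distrib_left
    by (subst sum.Sigma) (auto simp: pairs_def intro!: sum.reindex_bij_witness[of _ prod.swap prod.swap])
  finally show "2 * (\<Sum>(i, k)\<in>pairs {..<n}. sg (l i) * sg (l k)) = - int n" by simp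
qed

text \<open>For decreasing \<open>l\<close>, the exponent of q that results from taking the lower
  power q^(l k) out of every factor (q^(l k) - q^(l i))^(+1 or -1).\<close>

definition pair_stat :: "nat \<Rightarrow> (nat \<Rightarrow> nat) \<Rightarrow> int" where
  "pair_stat n l = (\<Sum>(i, k)\<in>pairs {..<n}. sg (l i) * sg (l k) * int (l k))"

lemma pair_stat_column:
  "pair_stat n l = (\<Sum>i<n. int (l i) * (sg (l i) * (\<Sum>k<i. sg (l k))))"
  unfolding pair_stat_def sum_distrib_left
  by (subst sum.Sigma) (auto simp: pairs_def intro!: sum.reindex_bij_witness[of _ prod.swap prod.swap])

text \<open>The weight \<lambda>_i - i equals l_i - n along the whole row, so only the signed number
  of hooks of each row matters, and \<open>hook_row\<close> determines it. The part proportional to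
  n cancels in total.\<close>

lemma b_stat_beta:
  assumes la: "is_partition la" and n: "length la \<le> n" and bal: "(\<Sum>i<n. sg (beta n la i)) = 0"
  shows "b_stat la = (\<Sum>i<n. if even (beta n la i) then int (beta n la i) else 0) + pair_stat n (beta n la)"
proof -
  let ?l = "beta n la"
  have tri: "(\<Sum>h = 1..a. sg h) = (if even a then 0 else - 1)" for a
    by (induction a) (auto simp: sg_def)
  have "b_stat la = (\<Sum>i<n. (int (?l i) - int n) * (\<Sum>j = 1..part la (Suc i). sg (hook la (Suc i, j))))"
    unfolding b_stat_hook[OF la] sum_diagram[OF n] sum_distrib_left
    by (intro sum.cong refl) (auto simp: beta_def algebra_simps)
  also have "\<dots> = (\<Sum>i<n. (int (?l i) - int n) * ((if even (?l i) then 1 else 0) + sg (?l i) * (\<Sum>k<i. sg (?l k))))"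
  proof (rule sum.cong[OF refl])
    fix i assume "i \<in> {..<n}"
    then have i: "i < n" by simp
    have "(\<Sum>k\<in>{i<..<n}. sg (?l i - ?l k)) = sg (?l i) * (\<Sum>k\<in>{i<..<n}. sg (?l k))"
      unfolding sum_distrib_left
      by (rule sum.cong) (use beta_less[OF la, of i _ n] in \<open>auto intro!: sg_diff less_imp_le\<close>)
    then have "(\<Sum>j = 1..part la (Suc i). sg (hook la (Suc i, j))) = (if even (?l i) then 1 else 0) + sg (?l i) * (\<Sum>k<i. sg (?l k))"
      using sum_hook_row[OF la n i, of sg] unfolding tri sum_sg_pairs(2)[OF bal i] by (auto split: if_splits)
    then show "(int (?l i) - int n) * (\<Sum>j = 1..part la (Suc i). sg (hook la (Suc i, j))) =
      (int (?l i) - int n) * ((if even (?l i) then 1 else 0) + sg (?l i) * (\<Sum>k<i. sg (?l k)))" by simp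
  qed
  also have "\<dots> = (\<Sum>i<n. if even (?l i) then int (?l i) else 0) + pair_stat n ?l -
     int n * (\<Sum>i<n. (if even (?l i) then 1 else 0) + sg (?l i) * (\<Sum>k<i. sg (?l k)))"
    unfolding pair_stat_column sum_distrib_left[of "int n"] sum.distrib[symmetric] sum_subtractf[symmetric]
    by (rule sum.cong) (auto simp: left_diff_distrib distrib_left)
  \<comment> \<open>By balance the even beta numbers count n/2, and the sum over pairs is
    -n/2.\<close>
  also have "(\<Sum>i<n. (if even (?l i) then 1 else 0) + sg (?l i) * (\<Sum>k<i. sg (?l k))) = 0"
  proof -
    have 1: "(\<Sum>i<n. sg (?l i) * (\<Sum>k<i. sg (?l k))) = (\<Sum>(i, k)\<in>pairs {..<n}. sg (?l i) * sg (?l k))"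
      unfolding sum_distrib_left
      by (subst sum.Sigma) (auto simp: pairs_def intro!: sum.reindex_bij_witness[of _ prod.swap prod.swap])
    have "2 * (\<Sum>i<n. (if even (?l i) then 1 else 0)) = (\<Sum>i<n. 1 + sg (?l i))"
      unfolding sum_distrib_left by (rule sum.cong) (auto simp: sg_def)
    also have "\<dots> = int n" using bal by (simp add: sum.distrib)
    finally have "2 * (\<Sum>i<n. (if even (?l i) then 1 else 0)) = int n" .
    then show ?thesis using sum_sg_pairs(1)[OF bal] by (simp add: sum.distrib 1)
  qed
  finally show ?thesis by simp
qed

text \<open>By \<open>b_stat_conjugate\<close> the signed sum of h - 1 over all hooks is needed,
  again row by row from \<open>hook_row\<close>. It contains \<open>pair_stat\<close> twice, and
  subtracting b removes one copy. The constant -n/2 from the sum over pairs is compensated by the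
  n/2 odd beta numbers; doubling all equations avoids the fraction.\<close>

lemma b_stat_conjugate_beta:
  assumes la: "is_partition la" and n: "length la \<le> n" and bal: "(\<Sum>i<n. sg (beta n la i)) = 0"
  shows "b_stat (conjugate la) = (\<Sum>i<n. int (beta n la i div 2)) + pair_stat n (beta n la)"
proof -
  let ?l = "beta n la"
  let ?T = "\<Sum>s\<in>diagram la. sg (hook la s) * (int (hook la s) - 1)"
  have tri: "(\<Sum>h = 1..a. sg h * (int h - 1)) = sg a * int (a div 2)" for a
    by (induction a) (auto simp: sg_def elim!: evenE oddE)
  have row: "(\<Sum>j = 1..part la (Suc i). sg (hook la (Suc i, j)) * (int (hook la (Suc i, j)) - 1)) =
     sg (?l i) * int (?l i div 2) - (\<Sum>k\<in>{i<..<n}. sg (?l i) * sg (?l k) * (int (?l i) - int (?l k) - 1))"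
    if i: "i < n" for i
  proof -
    have "(\<Sum>k\<in>{i<..<n}. sg (?l i - ?l k) * (int (?l i - ?l k) - 1)) =
      (\<Sum>k\<in>{i<..<n}. sg (?l i) * sg (?l k) * (int (?l i) - int (?l k) - 1))"
      by (rule sum.cong) (use beta_less[OF la, of i _ n] in \<open>auto simp: sg_diff less_imp_le of_nat_diff\<close>)
    then show ?thesis
      using sum_hook_row[OF la n i, of "\<lambda>h. sg h * (int h - 1)"] unfolding tri by simp
  qed
  have inner: "(\<Sum>k\<in>{i<..<n}. sg (?l i) * sg (?l k) * (int (?l i) - int (?l k) - 1)) =
      - int (?l i) - int (?l i) * (sg (?l i) * (\<Sum>k<i. sg (?l k)))
      - (\<Sum>k\<in>{i<..<n}. sg (?l i) * sg (?l k) * int (?l k)) - (\<Sum>k\<in>{i<..<n}. sg (?l i) * sg (?l k))"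
    if i: "i < n" for i
  proof -
    have "(\<Sum>k\<in>{i<..<n}. sg (?l i) * sg (?l k) * (int (?l i) - int (?l k) - 1)) =
      int (?l i) * (sg (?l i) * (\<Sum>k\<in>{i<..<n}. sg (?l k)))
      - (\<Sum>k\<in>{i<..<n}. sg (?l i) * sg (?l k) * int (?l k)) - (\<Sum>k\<in>{i<..<n}. sg (?l i) * sg (?l k))"
      unfolding sum_distrib_left sum_subtractf[symmetric] by (rule sum.cong) (auto simp: algebra_simps)
    then show ?thesis unfolding sum_sg_pairs(2)[OF bal i] by (simp add: algebra_simps)
  qed
  have "?T = (\<Sum>i<n. sg (?l i) * int (?l i div 2) - (\<Sum>k\<in>{i<..<n}. sg (?l i) * sg (?l k) * (int (?l i) - int (?l k) - 1)))"
    unfolding sum_diagram[OF n] by (rule sum.cong) (use row in auto)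
  also have "\<dots> = (\<Sum>i<n. sg (?l i) * int (?l i div 2)) -
     (\<Sum>i<n. - int (?l i) - int (?l i) * (sg (?l i) * (\<Sum>k<i. sg (?l k)))
      - (\<Sum>k\<in>{i<..<n}. sg (?l i) * sg (?l k) * int (?l k)) - (\<Sum>k\<in>{i<..<n}. sg (?l i) * sg (?l k)))"
    unfolding sum_subtractf[of "\<lambda>i. sg (?l i) * int (?l i div 2)"]
    by (intro arg_cong2[of _ _ _ _ "(-)"] sum.cong refl) (use inner in auto)
  also have "\<dots> = (\<Sum>i<n. sg (?l i) * int (?l i div 2)) + (\<Sum>i<n. int (?l i)) + 2 * pair_stat n ?l
     + (\<Sum>(i, k)\<in>pairs {..<n}. sg (?l i) * sg (?l k))"
  proof -
    have 1: "pair_stat n ?l = (\<Sum>i<n. \<Sum>k\<in>{i<..<n}. sg (?l i) * sg (?l k) * int (?l k))"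
      unfolding pair_stat_def pairs_Sigma by (subst sum.Sigma[symmetric]) auto
    have 2: "(\<Sum>(i, k)\<in>pairs {..<n}. sg (?l i) * sg (?l k)) = (\<Sum>i<n. \<Sum>k\<in>{i<..<n}. sg (?l i) * sg (?l k))"
      unfolding pairs_Sigma by (subst sum.Sigma[symmetric]) auto
    show ?thesis
      unfolding sum_subtractf sum_negf pair_stat_column[symmetric] 1[symmetric] 2[symmetric] by simp
  qed
  finally have T: "2 * ?T = 2 * (\<Sum>i<n. sg (?l i) * int (?l i div 2) + int (?l i)) + 4 * pair_stat n ?l - int n"
    using sum_sg_pairs(1)[OF bal] by (simp add: sum.distrib)
  have "2 * (\<Sum>i<n. sg (?l i) * int (?l i div 2) + int (?l i)) - (\<Sum>i<n. 1 - sg (?l i)) -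
     2 * (\<Sum>i<n. if even (?l i) then int (?l i) else 0) = 2 * (\<Sum>i<n. int (?l i div 2))"
    unfolding sum_distrib_left sum_subtractf[symmetric]
    by (rule sum.cong) (auto simp: sg_def elim!: evenE oddE)
  moreover have "(\<Sum>i<n. 1 - sg (?l i)) = int n" using bal by (simp add: sum_subtractf)
  ultimately have "2 * b_stat (conjugate la) = 2 * ((\<Sum>i<n. int (?l i div 2)) + pair_stat n ?l)"
    using T unfolding b_stat_conjugate[OF la] b_stat_beta[OF assms] by (simp add: algebra_simps)
  then show ?thesis by simp
qed

definition hook_fact :: "'a::field \<Rightarrow> nat \<Rightarrow> 'a" where
  "hook_fact q l = (\<Prod>h = 1..l. hook_factor q h)"

lemma power_int_sum: "(q :: 'a::field) \<noteq> 0 \<Longrightarrow> q powi (\<Sum>i\<in>I. f i) = (\<Prod>i\<in>I. q powi f i)"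
  by (induction I rule: infinite_finite_induct) (auto simp: power_int_add)

text \<open>For i < k the pair factor is q^(+-l_k) divided by
  \<open>hook_factor q (l_i - l_k)\<close>. The powers of q collect to \<open>pair_stat\<close>, and
  by \<open>hook_product\<close> the denominators cut the product of all
  \<open>hook_fact q (l_i)\<close> down to the actual hooks.\<close>

lemma cauchy_coeff_beta:
  fixes q :: "'a::field" and w :: "nat \<Rightarrow> nat"
  assumes q: "q \<noteq> 0" "\<And>h. h \<ge> 1 \<Longrightarrow> q ^ h \<noteq> 1"
    and la: "is_partition la" and n: "length la \<le> n"
    and bal: "balanced (\<lambda>i. even (beta n la i)) {..<n}"
  shows "cauchy_coeff (\<lambda>l. q ^ w l * hook_fact q l) (\<lambda>l. q ^ l) {..<n} (beta n la) =
    q powi ((\<Sum>i<n. int (w (beta n la i))) + pair_stat n (beta n la)) *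
      (\<Prod>s\<in>diagram la. hook_factor q (hook la s))"
proof -
  let ?l = "beta n la"
  have hf: "hook_factor q h \<noteq> 0" if "h \<ge> 1" for h
    using q(2)[OF that] by (auto simp: hook_factor_def)
  have fac: "cauchy_factor (\<lambda>i. even (?l i)) (\<lambda>i. q ^ ?l i) i k =
      q powi (sg (?l i) * sg (?l k) * int (?l k)) / hook_factor q (?l i - ?l k)" if "i < k" "k < n" for i k
  proof -
    have lt: "?l k < ?l i" by (rule beta_less[OF la that])
    define d where "d = ?l i - ?l k"
    have d: "?l i = ?l k + d" "d \<ge> 1" using lt by (auto simp: d_def)
    have "q ^ ?l k - q ^ ?l i = q ^ ?l k * (1 - q ^ d)" by (simp add: d power_add algebra_simps)
    moreover have "even d \<longleftrightarrow> even (?l i) = even (?l k)" unfolding d(1) by auto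
    ultimately show ?thesis
      unfolding d_def[symmetric] cauchy_factor_def
      by (auto simp: hook_factor_def sg_def power_int_minus field_simps)
  qed
  have "pair_prod (cauchy_factor (\<lambda>i. even (?l i)) (\<lambda>i. q ^ ?l i)) {..<n} =
    (\<Prod>(i, k)\<in>pairs {..<n}. q powi (sg (?l i) * sg (?l k) * int (?l k)) / hook_factor q (?l i - ?l k))"
    unfolding pair_prod_def by (rule prod.cong) (use fac in \<open>auto simp: pairs_def\<close>)
  also have "\<dots> = q powi pair_stat n ?l / (\<Prod>(i, k)\<in>pairs {..<n}. hook_factor q (?l i - ?l k))"
    unfolding pair_stat_def power_int_sum[OF q(1)] by (simp add: case_prod_unfold prod_dividef)
  finally have pp: "pair_prod (cauchy_factor (\<lambda>i. even (?l i)) (\<lambda>i. q ^ ?l i)) {..<n} =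
    q powi pair_stat n ?l / (\<Prod>(i, k)\<in>pairs {..<n}. hook_factor q (?l i - ?l k))" .
  have nz: "(\<Prod>(i, k)\<in>pairs {..<n}. hook_factor q (?l i - ?l k)) \<noteq> 0"
  proof -
    have "(case p of (i, k) \<Rightarrow> hook_factor q (?l i - ?l k)) \<noteq> 0" if "p \<in> pairs {..<n}" for p
    proof -
      obtain i k where p: "p = (i, k)" by force
      have "?l k < ?l i" using that beta_less[OF la, of i k n] by (simp add: p pairs_def)
      then show ?thesis using hf[of "?l i - ?l k"] by (simp add: p)
    qed
    then show ?thesis using prod_zero_iff[OF finite_pairs[OF finite_lessThan]] by blast
  qed
  have "(\<Prod>i<n. q ^ w (?l i) * hook_fact q (?l i)) =
     q powi (\<Sum>i<n. int (w (?l i))) * ((\<Prod>s\<in>diagram la. hook_factor q (hook la s)) *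
       (\<Prod>(i, k)\<in>pairs {..<n}. hook_factor q (?l i - ?l k)))"
    unfolding prod.distrib hook_fact_def hook_product[OF la n] power_int_sum[OF q(1)] by simp
  then show ?thesis
    unfolding cauchy_coeff_def pp using bal nz q(1) by (simp add: power_int_add)
qed

section \<open>The two-variable recurrences\<close>

text \<open>This is (q;q^2)_n/(q^2;q^2)_n, the coefficient of X^n in the quotient of (qX;q^2) and
  (X;q^2), both infinite, by the q-binomial theorem.\<close>

fun qbinom_coeff :: "'a::field \<Rightarrow> nat \<Rightarrow> 'a" where
  "qbinom_coeff q 0 = 1"
| "qbinom_coeff q (Suc n) = qbinom_coeff q n * (1 - q ^ (2 * n + 1)) / (1 - q ^ (2 * n + 2))"

lemma hook_fact_even: "hook_fact q (2 * a) = qbinom_coeff q a"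
  and hook_fact_odd: "hook_fact q (2 * a + 1) = qbinom_coeff q a * (1 - q ^ (2 * a + 1))"
proof -
  show *: "hook_fact q (2 * a) = qbinom_coeff q a" for a
    by (induction a) (auto simp: hook_fact_def hook_factor_def)
  show "hook_fact q (2 * a + 1) = qbinom_coeff q a * (1 - q ^ (2 * a + 1))"
    using *[of a] by (simp add: hook_fact_def hook_factor_def)
qed

lemma cauchy_entry_anti: "cauchy_entry W u b a = - cauchy_entry W u a b"
  using minus_divide_right[of "W a * W b" "u b - u a"] by (auto simp: cauchy_entry_def mult.commute)

text \<open>Both sides are antisymmetric in a and b and vanish for equal parities, so a = 2c + 1 can
  be assumed odd and b even; the two assumptions are the cases b = 0 and b = 2d + 2.\<close>

lemma cauchy_entry_recurrence:
  fixes W u g :: "nat \<Rightarrow> 'a::field"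
  assumes g: "\<And>l. odd l \<Longrightarrow> g l = 0"
    and 0: "\<And>c. W (2 * c + 1) * W 0 / (u 0 - u (2 * c + 1)) = g (2 * c) * g 0"
    and Suc: "\<And>c d. W (2 * c + 1) * W (2 * d + 2) / (u (2 * d + 2) - u (2 * c + 1)) -
        W (2 * c) * W (2 * d + 1) / (u (2 * d + 1) - u (2 * c)) = g (2 * c) * g (2 * d + 2)"
  shows "cauchy_entry W u a b - (if a = 0 \<or> b = 0 then 0 else cauchy_entry W u (a - 1) (b - 1)) =
      (if a = 0 then 0 else g (a - 1) * g b) - (if b = 0 then 0 else g a * g (b - 1))"
proof -
  let ?P = "\<lambda>a b. cauchy_entry W u a b - (if a = 0 \<or> b = 0 then 0 else cauchy_entry W u (a - 1) (b - 1)) =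
      (if a = 0 then 0 else g (a - 1) * g b) - (if b = 0 then 0 else g a * g (b - 1))"
  have *: "?P a b" if "odd a" "even b" for a b
  proof -
    from that(1) obtain c where a: "a = 2 * c + 1" by (elim oddE)
    from that(2) obtain d where b: "b = 2 * d" by (elim evenE)
    show ?thesis
    proof (cases d)
      case 0
      then show ?thesis using assms(2)[of c] g by (simp add: a b cauchy_entry_def)
    next
      case (Suc d')
      then show ?thesis using assms(3)[of c d'] g[of a] by (simp add: a b cauchy_entry_def)
    qed
  qed
  have sym: "?P a b" if "?P b a" for a b
    using that cauchy_entry_anti[of W u a b] cauchy_entry_anti[of W u "a - 1" "b - 1"]
    by (auto simp: mult.commute algebra_simps split: if_splits)
  show ?thesis
  proof (cases "even a = even b")
    case True
    then show ?thesis using g by (cases "a = 0"; cases "b = 0") (auto simp: cauchy_entry_def)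
  next
    case False
    then show ?thesis using * sym by (cases "even a") blast+
  qed
qed

lemma power_inj_norm:
  fixes q :: complex
  assumes "q \<noteq> 0" "norm q < 1" "a \<noteq> b"
  shows "q ^ a \<noteq> q ^ b"
proof
  assume "q ^ a = q ^ b"
  then have "norm q ^ a = norm q ^ b" by (metis norm_power)
  then show False using assms by (metis power_inject_exp' zero_less_norm_iff linorder_neqE_nat order_less_irrefl power_strict_decreasing)
qed

lemma qbinom_coeff_Suc:
  assumes "norm (q :: complex) < 1"
  shows "qbinom_coeff q (Suc n) * (1 - q ^ (2 * n + 2)) = qbinom_coeff q n * (1 - q ^ (2 * n + 1))"
proof -
  have "norm (q ^ (2 * n + 2)) < 1" by (subst norm_power, subst power_less_one_iff) (use assms in auto)
  then have "q ^ (2 * n + 2) \<noteq> 1" by force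
  then show ?thesis by simp
qed

definition even_series :: "(nat \<Rightarrow> 'a::zero) \<Rightarrow> nat \<Rightarrow> 'a" where
  "even_series c l = (if even l then c (l div 2) else 0)"

text \<open>The weight q^l for even l is the one demanded by \<open>b_stat_beta\<close>. Lowering
  both exponents divides the denominator \<open>D\<close> by q, and after the common factors are
  removed the claim is (1 - q^(2c+1)) q^(2d+2) - q^(2c+1) (1 - q^(2d+2)) = D.\<close>

lemma cauchy_entry_recurrence_even_weight:
  fixes q :: complex
  assumes q: "q \<noteq> 0" "norm q < 1"
  defines "W \<equiv> \<lambda>l. q ^ (if even l then l else 0) * hook_fact q l"
    and "g \<equiv> even_series (qbinom_coeff q)"
  shows "cauchy_entry W (\<lambda>l. q ^ l) a b -
      (if a = 0 \<or> b = 0 then 0 else cauchy_entry W (\<lambda>l. q ^ l) (a - 1) (b - 1)) =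
      (if a = 0 then 0 else g (a - 1) * g b) - (if b = 0 then 0 else g a * g (b - 1))"
proof (rule cauchy_entry_recurrence)
  have W: "W (2 * c) = q ^ (2 * c) * qbinom_coeff q c" "W (2 * c + 1) = qbinom_coeff q c * (1 - q ^ (2 * c + 1))" for c
    by (simp_all add: W_def hook_fact_even hook_fact_odd[simplified])
  have ne: "q ^ a \<noteq> q ^ b" if "a \<noteq> b" for a b using power_inj_norm[OF q that] .
  fix c d
  show "W (2 * c + 1) * W 0 / (q ^ 0 - q ^ (2 * c + 1)) = g (2 * c) * g 0"
    using W(1)[of 0] ne[of "2 * c + 1" 0] unfolding W(2) by (simp add: g_def even_series_def)
  define A B D where "A = qbinom_coeff q c" and "B = qbinom_coeff q (Suc d)" and "D = q ^ (2 * d + 2) - q ^ (2 * c + 1)"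
  have D: "D \<noteq> 0" "q ^ (2 * d + 1) - q ^ (2 * c) = D / q"
    using ne[of "2 * d + 2" "2 * c + 1"] q by (auto simp: D_def field_simps) presburger
  have "W (2 * c + 1) * W (2 * d + 2) / D - W (2 * c) * W (2 * d + 1) / (q ^ (2 * d + 1) - q ^ (2 * c)) =
     A * (1 - q ^ (2 * c + 1)) * (q ^ (2 * d + 2) * B) / D - q ^ (2 * c) * A * (B * (1 - q ^ (2 * d + 2))) / (D / q)"
    using W(1)[of "Suc d"] unfolding D(2) W(2) W(1)[of c] A_def B_def qbinom_coeff_Suc[OF q(2)] by simp
  also have "\<dots> = A * B * D / D"
    unfolding divide_divide_eq_right diff_divide_distrib[symmetric]
    by (rule arg_cong[where f = "\<lambda>x. x / D"]) (simp add: D_def algebra_simps)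
  also have "\<dots> = g (2 * c) * g (2 * d + 2)" using D by (simp add: g_def even_series_def A_def B_def del: qbinom_coeff.simps)
  finally show "W (2 * c + 1) * W (2 * d + 2) / (q ^ (2 * d + 2) - q ^ (2 * c + 1)) -
    W (2 * c) * W (2 * d + 1) / (q ^ (2 * d + 1) - q ^ (2 * c)) = g (2 * c) * g (2 * d + 2)" by (simp only: D_def)
qed (simp add: g_def even_series_def)

text \<open>Here the weight comes from \<open>b_stat_conjugate_beta\<close>. The common factor now
  contains q^(c+d+1), and what remains is (1 - q^(2c+1)) - (1 - q^(2d+2)) = D.\<close>

lemma cauchy_entry_recurrence_half_weight:
  fixes q :: complex
  assumes q: "q \<noteq> 0" "norm q < 1"
  defines "W \<equiv> \<lambda>l. q ^ (l div 2) * hook_fact q l"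
    and "g \<equiv> even_series (\<lambda>n. q ^ n * qbinom_coeff q n)"
  shows "cauchy_entry W (\<lambda>l. q ^ l) a b -
      (if a = 0 \<or> b = 0 then 0 else cauchy_entry W (\<lambda>l. q ^ l) (a - 1) (b - 1)) =
      (if a = 0 then 0 else g (a - 1) * g b) - (if b = 0 then 0 else g a * g (b - 1))"
proof (rule cauchy_entry_recurrence)
  have W: "W (2 * c) = q ^ c * qbinom_coeff q c" "W (2 * c + 1) = q ^ c * (qbinom_coeff q c * (1 - q ^ (2 * c + 1)))" for c
    by (simp_all add: W_def hook_fact_even hook_fact_odd[simplified])
  have ne: "q ^ a \<noteq> q ^ b" if "a \<noteq> b" for a b using power_inj_norm[OF q that] .
  fix c d
  show "W (2 * c + 1) * W 0 / (q ^ 0 - q ^ (2 * c + 1)) = g (2 * c) * g 0"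
    using W(1)[of 0] ne[of "2 * c + 1" 0] unfolding W(2) by (simp add: g_def even_series_def)
  define A B D where "A = qbinom_coeff q c" and "B = qbinom_coeff q (Suc d)" and "D = q ^ (2 * d + 2) - q ^ (2 * c + 1)"
  have D: "D \<noteq> 0" "q ^ (2 * d + 1) - q ^ (2 * c) = D / q"
    using ne[of "2 * d + 2" "2 * c + 1"] q by (auto simp: D_def field_simps) presburger
  have "W (2 * c + 1) * W (2 * d + 2) / D - W (2 * c) * W (2 * d + 1) / (q ^ (2 * d + 1) - q ^ (2 * c)) =
     q ^ c * (A * (1 - q ^ (2 * c + 1))) * (q ^ Suc d * B) / D - q ^ c * A * (q ^ d * (B * (1 - q ^ (2 * d + 2)))) / (D / q)"
    using W(1)[of "Suc d"] unfolding D(2) W(2) W(1)[of c] A_def B_def qbinom_coeff_Suc[OF q(2)] by simp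
  also have "\<dots> = q ^ c * A * (q ^ Suc d * B) * D / D"
    unfolding divide_divide_eq_right diff_divide_distrib[symmetric]
    by (rule arg_cong[where f = "\<lambda>x. x / D"]) (simp add: D_def algebra_simps)
  also have "\<dots> = g (2 * c) * g (2 * d + 2)" using D by (simp add: g_def even_series_def A_def B_def del: qbinom_coeff.simps)
  finally show "W (2 * c + 1) * W (2 * d + 2) / (q ^ (2 * d + 2) - q ^ (2 * c + 1)) -
    W (2 * c) * W (2 * d + 1) / (q ^ (2 * d + 1) - q ^ (2 * c)) = g (2 * c) * g (2 * d + 2)" by (simp only: D_def)
qed (simp add: g_def even_series_def)

section \<open>Infinite sums and products\<close>

text \<open>The topology is the product topology carried over by the bijection
  \<open>mcoeff\<close>. All limits of series below are taken coefficientwise.\<close>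

lemma tendsto_mfps_iff:
  fixes f :: "'i \<Rightarrow> 'a::topological_space mfps"
  shows "(f \<longlongrightarrow> l) F \<longleftrightarrow> (\<forall>m. ((\<lambda>x. mcoeff (f x) m) \<longlongrightarrow> mcoeff l m) F)"
proof -
  have "(f \<longlongrightarrow> l) F \<longleftrightarrow> ((\<lambda>x. mcoeff (f x)) \<longlongrightarrow> mcoeff l) F"
  proof
    assume f: "(f \<longlongrightarrow> l) F"
    show "((\<lambda>x. mcoeff (f x)) \<longlongrightarrow> mcoeff l) F"
    proof (rule topological_tendstoI)
      fix S :: "((nat \<Rightarrow>\<^sub>0 nat) \<Rightarrow> 'a) set" assume S: "open S" "mcoeff l \<in> S"
      have "mcoeff ` (Abs_mfps ` S) = S" by (auto simp: image_image)
      then have "open (Abs_mfps ` S)" using S by (simp add: open_mfps_def)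
      moreover have "l \<in> Abs_mfps ` S" using S(2) by (metis imageI mcoeff_inverse)
      ultimately have "eventually (\<lambda>x. f x \<in> Abs_mfps ` S) F" using f by (simp add: tendsto_def)
      then show "eventually (\<lambda>x. mcoeff (f x) \<in> S) F" by (rule eventually_mono) auto
    qed
  next
    assume f: "((\<lambda>x. mcoeff (f x)) \<longlongrightarrow> mcoeff l) F"
    show "(f \<longlongrightarrow> l) F"
    proof (rule topological_tendstoI)
      fix S :: "'a mfps set" assume S: "open S" "l \<in> S"
      have "eventually (\<lambda>x. mcoeff (f x) \<in> mcoeff ` S) F"
        using f S by (auto simp: tendsto_def open_mfps_def)
      then show "eventually (\<lambda>x. f x \<in> S) F"
        by (rule eventually_mono) (auto simp: mcoeff_inject)
    qed
  qed
  also have "\<dots> \<longleftrightarrow> limitin (product_topology (\<lambda>_. euclidean) UNIV) (\<lambda>x. mcoeff (f x)) (mcoeff l) F"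
    by (simp add: euclidean_product_topology)
  also have "\<dots> \<longleftrightarrow> (\<forall>m. ((\<lambda>x. mcoeff (f x) m) \<longlongrightarrow> mcoeff l m) F)"
    unfolding limitin_componentwise by (simp add: extensional_def)
  finally show ?thesis .
qed

lemma has_sum_mfps_iff:
  fixes f :: "'i \<Rightarrow> 'a::{comm_ring_1, topological_space} mfps"
  shows "(f has_sum s) A \<longleftrightarrow> (\<forall>m. ((\<lambda>x. mcoeff (f x) m) has_sum mcoeff s m) A)"
  unfolding has_sum_def tendsto_mfps_iff by simp

lemma tendsto_mult_mfps:
  fixes f g :: "'i \<Rightarrow> 'a::{comm_ring_1, topological_semigroup_mult, topological_comm_monoid_add} mfps"
  assumes "(f \<longlongrightarrow> a) F" "(g \<longlongrightarrow> b) F"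
  shows "((\<lambda>x. f x * g x) \<longlongrightarrow> a * b) F"
  using assms unfolding tendsto_mfps_iff mcoeff_times case_prod_unfold
  by (intro allI tendsto_sum tendsto_mult) auto

lemma has_sum_mult_mfps:
  fixes f :: "'i \<Rightarrow> 'a::{comm_ring_1, topological_semigroup_mult, topological_comm_monoid_add} mfps"
  assumes "(f has_sum s) A"
  shows "((\<lambda>x. f x * c) has_sum s * c) A"
  using assms unfolding has_sum_def sum_distrib_right[symmetric]
  by (intro tendsto_mult_mfps tendsto_const)

lemma inverse_mfps_eq:
  fixes f :: "'a::comm_ring_1 mfps"
  assumes "f * g = 1" shows "inverse f = g"
proof -
  have unique: "h = g" if "f * h = 1" for h
  proof -
    have "h = (f * g) * h" using assms by simp
    also have "\<dots> = (f * h) * g" by (simp only: ac_simps)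
    finally show ?thesis using that by simp
  qed
  have "(THE g. f * g = 1) = g" by (rule the_equality[where P = "\<lambda>g. f * g = 1", OF assms unique])
  then show ?thesis using assms by (auto simp: inverse_mfps_def)
qed

lemma divide_mfps_eq:
  fixes f g h :: "'a::comm_ring_1 mfps"
  assumes "h * g = f" "g * y = 1" shows "f / g = h"
  unfolding divide_mfps_def inverse_mfps_eq[OF assms(2)]
  using assms by (metis mult.assoc mult_1_right)

lemma geo_eq_divide: "i \<noteq> j \<Longrightarrow> 1 / (1 - mvar i * mvar j) = (geo i j :: 'a::comm_ring_1 mfps)"
  by (rule divide_mfps_eq[OF _ geo_inverse]) (subst mult.commute, rule geo_inverse)

section \<open>Infinite q-products in one variable and the q-binomial theorem\<close>

lemma mconst_mult: "mconst (a * b) = mconst a * (mconst b :: 'a::comm_ring_1 mfps)"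
  by (rule mfps_eqI) (simp add: mcoeff_mconst)

lemma mconst_1 [simp]: "mconst 1 = (1 :: 'a::comm_ring_1 mfps)"
  by (rule mfps_eqI) (simp add: mcoeff_mconst mcoeff_one)

lemma mconst_power: "mconst (a ^ n) = (mconst a ^ n :: 'a::comm_ring_1 mfps)"
  by (induction n) (simp_all add: mconst_mult)

lemma univar_times_same:
  fixes f g :: "'a::comm_ring_1 fps"
  shows "univar i (fps_nth f) * univar i (fps_nth g) = univar i (fps_nth (f * g))"
proof (rule mfps_eqI)
  fix m
  show "mcoeff (univar i (fps_nth f) * univar i (fps_nth g)) m = mcoeff (univar i (fps_nth (f * g))) m"
  proof (cases "keys m \<subseteq> {i}")
    case True
    define n where "n = lookup m i"
    have single: "a = Poly_Mapping.single i (lookup a i)" if "keys a \<subseteq> {i}" for a :: "nat \<Rightarrow>\<^sub>0 nat"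
      using that by (intro poly_mapping_eqI) (auto simp: lookup_single when_def in_keys_iff)
    have m: "m = Poly_Mapping.single i n" using single[OF True] by (simp add: n_def)
    have "mcoeff (univar i (fps_nth f) * univar i (fps_nth g)) m = (\<Sum>k=0..n. fps_nth f k * fps_nth g (n - k))"
      unfolding mcoeff_times
    proof (rule sum.reindex_bij_witness[of _ "\<lambda>k. (Poly_Mapping.single i k, Poly_Mapping.single i (n - k))" "\<lambda>(a, b). lookup a i"])
      fix p assume "p \<in> monomial_splits m"
      then obtain a b where p: "p = (a, b)" "a + b = m" by (auto simp: monomial_splits_def)
      then have k: "keys a \<subseteq> {i}" "keys b \<subseteq> {i}" using True keys_add_nat[of a b] by auto
      have n: "n = lookup a i + lookup b i" using p(2) by (auto simp: n_def lookup_add)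
      then show "(Poly_Mapping.single i (case p of (a, b) \<Rightarrow> lookup a i), Poly_Mapping.single i (n - (case p of (a, b) \<Rightarrow> lookup a i))) = p"
        using single[OF k(1)] single[OF k(2)] p by simp
      show "(case p of (a, b) \<Rightarrow> lookup a i) \<in> {0..n}" using n p by simp
      show "fps_nth f (case p of (a, b) \<Rightarrow> lookup a i) * fps_nth g (n - (case p of (a, b) \<Rightarrow> lookup a i)) =
        (case p of (a, b) \<Rightarrow> mcoeff (univar i (fps_nth f)) a * mcoeff (univar i (fps_nth g)) b)"
        using k n p by (simp add: mcoeff_univar)
    next
      fix k assume "k \<in> {0..n}"
      then show "(Poly_Mapping.single i k, Poly_Mapping.single i (n - k)) \<in> monomial_splits m"
        by (simp add: monomial_splits_def m single_add[symmetric])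
    qed auto
    then show ?thesis using True by (simp add: mcoeff_univar n_def fps_mult_nth)
  next
    case False
    have "vars_in {i} (univar i (fps_nth f) * univar i (fps_nth g))"
      by (intro vars_in_times vars_in_univar)
    then show ?thesis using False by (simp add: vars_inD mcoeff_univar)
  qed
qed

text \<open>The series f(x_i^2). Going through \<open>fps_compose\<close> makes it multiplicative at
  once; \<open>square_subst_eq\<close> gives the coefficients.\<close>

definition square_subst :: "nat \<Rightarrow> 'a::comm_ring_1 fps \<Rightarrow> 'a mfps" where
  "square_subst i f = univar i (fps_nth (fps_compose f (fps_X ^ 2)))"

lemma square_subst_mult: "square_subst i (f * g) = square_subst i f * square_subst i (g :: 'a::idom fps)"
  unfolding square_subst_def univar_times_same
  by (subst fps_compose_mult_distrib) auto

lemma square_subst_1: "square_subst i 1 = (1 :: 'a::idom mfps)"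
proof (rule mfps_eqI)
  fix m :: "nat \<Rightarrow>\<^sub>0 nat"
  have "keys m \<subseteq> {i} \<and> lookup m i = 0 \<longleftrightarrow> m = 0"
    by (auto simp: in_keys_iff intro!: poly_mapping_eqI)
  then show "mcoeff (square_subst i (1 :: 'a fps)) m = mcoeff 1 m"
    by (auto simp: square_subst_def mcoeff_univar mcoeff_one)
qed

lemma square_subst_prod: "square_subst i (prod f A) = (\<Prod>x\<in>A. square_subst i (f x :: 'a::idom fps))"
  by (induction A rule: infinite_finite_induct) (auto simp: square_subst_mult square_subst_1)

lemma fps_nth_compose_square:
  "fps_nth (fps_compose f (fps_X ^ 2)) n = (if even n then fps_nth f (n div 2) else 0)" for f :: "'a::comm_ring_1 fps"
proof -
  have "fps_nth (fps_compose f (fps_X ^ 2)) n = (\<Sum>i=0..n. if i = n div 2 \<and> even n then fps_nth f i else 0)"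
    unfolding fps_compose_nth
    by (rule sum.cong) (auto simp flip: power_mult)
  then show ?thesis by (cases "even n") (simp_all add: sum.delta)
qed

lemma square_subst_eq: "square_subst i f = univar i (even_series (fps_nth f))" for f :: "'a::idom fps"
  unfolding square_subst_def
  by (intro arg_cong[of _ _ "univar i"] ext) (auto simp: even_series_def fps_nth_compose_square)

lemma square_subst_linear:
  "square_subst i (1 - fps_const c * fps_X) = 1 - mconst c * mvar i ^ 2" for c :: "'a::idom"
proof (rule mfps_eqI)
  fix m :: "nat \<Rightarrow>\<^sub>0 nat"
  have 2: "mvar i ^ 2 = univar i (\<lambda>l. if l = 2 then 1 else (0 :: 'a))"
  proof (rule mfps_eqI)
    fix m :: "nat \<Rightarrow>\<^sub>0 nat"
    have "m - Poly_Mapping.single i (Suc 0) = Poly_Mapping.single i (Suc 0) \<and> Suc 0 \<le> lookup m i \<longleftrightarrow>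
      keys m \<subseteq> {i} \<and> lookup m i = 2"
    proof
      assume *: "m - Poly_Mapping.single i (Suc 0) = Poly_Mapping.single i (Suc 0) \<and> Suc 0 \<le> lookup m i"
      then have "lookup (m - Poly_Mapping.single i (Suc 0)) k = lookup (Poly_Mapping.single i (Suc 0)) k" for k by simp
      then have "lookup m k - (Suc 0 when i = k) = (Suc 0 when i = k)" for k
        by (simp add: lookup_minus lookup_single)
      note eq = this
      have "lookup m i = 2" using eq[of i] * by simp
      moreover have "lookup m k = 0" if "k \<noteq> i" for k using eq[of k] that by (simp add: when_def)
      then have "keys m \<subseteq> {i}" by (force simp: in_keys_iff)
      ultimately show "keys m \<subseteq> {i} \<and> lookup m i = 2" by simp
    next
      assume "keys m \<subseteq> {i} \<and> lookup m i = 2"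
      then show "m - Poly_Mapping.single i (Suc 0) = Poly_Mapping.single i (Suc 0) \<and> Suc 0 \<le> lookup m i"
        by (intro conjI poly_mapping_eqI) (auto simp: lookup_minus lookup_single when_def in_keys_iff)
    qed
    then show "mcoeff (mvar i ^ 2 :: 'a mfps) m = mcoeff (univar i (\<lambda>l. if l = 2 then 1 else (0 :: 'a))) m"
      by (auto simp: power2_eq_square mcoeff_mvar_times mcoeff_mvar mcoeff_univar)
  qed
  have "m = 0 \<longleftrightarrow> keys m \<subseteq> {i} \<and> lookup m i = 0"
    by (auto simp: in_keys_iff intro!: poly_mapping_eqI)
  then show "mcoeff (square_subst i (1 - fps_const c * fps_X)) m = mcoeff (1 - mconst c * mvar i ^ 2) m"
    unfolding square_subst_eq 2
    by (auto simp: mcoeff_univar mcoeff_one even_series_def elim!: evenE)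
qed

text \<open>Euler's expansion of the infinite product of the factors 1 - c q^k X, with coefficients
  (-c)^n q^(n(n-1)/2)/((1-q)...(1-q^n)), here in recursive form.\<close>

definition euler_series :: "complex \<Rightarrow> complex \<Rightarrow> complex fps" where
  "euler_series c q = Abs_fps (rec_nat 1 (\<lambda>n e. - c * q ^ n * e / (1 - q ^ Suc n)))"

lemma euler_series_nth:
  "fps_nth (euler_series c q) 0 = 1"
  "fps_nth (euler_series c q) (Suc n) = - c * q ^ n * fps_nth (euler_series c q) n / (1 - q ^ Suc n)"
  by (simp_all add: euler_series_def)

lemma power_Suc_neq_1: "norm (q :: complex) < 1 \<Longrightarrow> q ^ Suc n \<noteq> 1"
proof
  assume q: "norm q < 1" "q ^ Suc n = 1"
  then have "norm q ^ Suc n = 1" by (metis norm_one norm_power)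
  moreover have "norm q ^ Suc n < 1" using q by (subst power_less_one_iff) auto
  ultimately show False by simp
qed

text \<open>The finite product P_N satisfies P_N(X) (1 - c q^N X) = (1 - c X) P_N(qX). Comparing
  coefficients yields a recursion that tends to that of \<open>euler_series\<close> as q^N goes to
  0; \<open>S\<close> is the substitution of qX for X.\<close>

lemma finite_qpochhammer_tendsto:
  fixes q c :: complex
  assumes q: "norm q < 1"
  shows "(\<lambda>N. fps_nth (\<Prod>k<N. 1 - fps_const (c * q ^ k) * fps_X) n) \<longlonglongrightarrow> fps_nth (euler_series c q) n"
proof -
  define P where "P N = (\<Prod>k<N. 1 - fps_const (c * q ^ k) * fps_X)" for N
  define S where "S f = fps_compose f (fps_const q * fps_X)" for f :: "complex fps"
  have S: "fps_nth (S f) n = q ^ n * fps_nth f n" for f n by (simp add: S_def fps_compose_linear)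
  have S_mult: "S (f * g) = S f * S g" for f g by (simp add: S_def fps_compose_mult_distrib)
  have S_lin: "S (1 - fps_const a * fps_X) = 1 - fps_const (a * q) * fps_X" for a
    by (rule fps_ext) (auto simp: S le_Suc_eq)
  have SP: "S (P N) = (\<Prod>k<N. 1 - fps_const (c * q ^ Suc k) * fps_X)" for N
  proof (induction N)
    case 0
    have "S 1 = 1" by (rule fps_ext) (auto simp: S)
    then show ?case by (simp add: P_def)
  next
    case (Suc N)
    have "S (P (Suc N)) = S (P N * (1 - fps_const (c * q ^ N) * fps_X))" by (simp add: P_def)
    also have "\<dots> = S (P N) * S (1 - fps_const (c * q ^ N) * fps_X)" by (rule S_mult)
    also have "\<dots> = (\<Prod>k<Suc N. 1 - fps_const (c * q ^ Suc k) * fps_X)"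
      unfolding Suc.IH S_lin by (simp add: mult_ac)
    finally show ?case .
  qed
  have rec: "fps_nth (P N) (Suc n) * (1 - q ^ Suc n) = c * (q ^ N - q ^ n) * fps_nth (P N) n" for N n
  proof -
    have "P N * (1 - fps_const (c * q ^ N) * fps_X) = P (Suc N)" by (simp add: P_def)
    also have "\<dots> = (1 - fps_const c * fps_X) * S (P N)"
      unfolding SP unfolding P_def prod.lessThan_Suc_shift by simp
    finally have "fps_nth (P N * (1 - fps_const (c * q ^ N) * fps_X)) (Suc n) =
      fps_nth ((1 - fps_const c * fps_X) * S (P N)) (Suc n)" by simp
    then have "fps_nth (P N) (Suc n) - c * q ^ N * fps_nth (P N) n =
      q ^ Suc n * fps_nth (P N) (Suc n) - c * (q ^ n * fps_nth (P N) n)"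
      by (simp add: algebra_simps S)
    then show ?thesis by (simp add: algebra_simps)
  qed
  have "(\<lambda>N. fps_nth (P N) n) \<longlonglongrightarrow> fps_nth (euler_series c q) n"
  proof (induction n)
    case 0
    have "fps_nth (P N) 0 = 1" for N by (induction N) (auto simp: P_def)
    then show ?case by (simp add: euler_series_nth)
  next
    case (Suc n)
    have "(\<lambda>N. c * (q ^ N - q ^ n) * fps_nth (P N) n / (1 - q ^ Suc n)) \<longlonglongrightarrow>
      c * (0 - q ^ n) * fps_nth (euler_series c q) n / (1 - q ^ Suc n)"
      using power_Suc_neq_1[OF q, of n] by (intro tendsto_intros Suc LIMSEQ_power_zero q) auto
    moreover have "c * (q ^ N - q ^ n) * fps_nth (P N) n / (1 - q ^ Suc n) = fps_nth (P N) (Suc n)" for N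
      using rec[of N n] power_Suc_neq_1[OF q, of n] by (simp add: divide_eq_eq)
    ultimately show ?case by (simp add: euler_series_nth)
  qed
  then show ?thesis by (simp add: P_def)
qed

lemma qpochhammer_inf_eq:
  assumes q: "norm q < 1"
  shows "qpochhammer_inf (mconst c * mvar i ^ 2) (mconst q) = square_subst i (euler_series c q)"
proof -
  let ?f = "\<lambda>k. 1 - mconst c * mvar i ^ 2 * mconst q ^ k"
  have f: "?f k = square_subst i (1 - fps_const (c * q ^ k) * fps_X)" for k
    unfolding square_subst_linear by (simp add: mconst_mult mconst_power mult_ac)
  have "(\<lambda>n. \<Prod>k<n. ?f k) \<longlonglongrightarrow> square_subst i (euler_series c q)"
    unfolding f square_subst_prod[symmetric]
    unfolding square_subst_eq tendsto_mfps_iff mcoeff_univar even_series_def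
    using finite_qpochhammer_tendsto[OF q] by auto
  then have "(\<lambda>n. \<Prod>k\<le>n. ?f k) \<longlonglongrightarrow> square_subst i (euler_series c q)"
    using LIMSEQ_Suc unfolding lessThan_Suc_atMost[symmetric] by blast
  \<comment> \<open>\<open>has_prod\<close> with offset 0 demands a nonzero limit; the constant
    coefficient 1 provides it.\<close>
  moreover have "mcoeff (square_subst i (euler_series c q)) 0 = 1"
    by (simp add: square_subst_eq mcoeff_univar even_series_def euler_series_nth)
  then have "square_subst i (euler_series c q) \<noteq> 0" by auto
  ultimately have "?f has_prod square_subst i (euler_series c q)"
    unfolding has_prod_def raw_has_prod_def by simp
  then show ?thesis unfolding qpochhammer_inf_def by (rule has_prod_unique[symmetric])
qed

text \<open>The q-binomial theorem. The recursion for \<open>A\<close> says (1 - bX) A(X) = (1 - aX)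
  A(qX), so F = A * \<open>euler_series b q\<close> satisfies F(X) = (1 - aX) F(qX). With F(0) = 1
  this determines all coefficients, because q^(n+1) is never 1.\<close>

lemma euler_series_quotient:
  fixes q a b :: complex
  assumes q: "norm q < 1"
    and A: "fps_nth A 0 = 1" "\<And>n. fps_nth A (Suc n) * (1 - q ^ Suc n) = fps_nth A n * (b - a * q ^ n)"
  shows "A * euler_series b q = euler_series a q"
proof -
  define S where "S f = fps_compose f (fps_const q * fps_X)" for f :: "complex fps"
  have S: "fps_nth (S f) n = q ^ n * fps_nth f n" for f n by (simp add: S_def fps_compose_linear)
  have S_mult: "S (f * g) = S f * S g" for f g by (simp add: S_def fps_compose_mult_distrib)
  have E: "euler_series b q = (1 - fps_const b * fps_X) * S (euler_series b q)"
  proof (rule fps_ext)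
    fix n
    show "fps_nth (euler_series b q) n = fps_nth ((1 - fps_const b * fps_X) * S (euler_series b q)) n"
    proof (cases n)
      case (Suc k)
      have "fps_nth (euler_series b q) (Suc k) * (1 - q ^ Suc k) = - b * q ^ k * fps_nth (euler_series b q) k"
        using power_Suc_neq_1[OF q, of k] by (simp add: euler_series_nth)
      then show ?thesis unfolding Suc by (simp add: algebra_simps S del: euler_series_nth)
    qed (simp add: left_diff_distrib S mult.assoc)
  qed
  have A': "(1 - fps_const b * fps_X) * A = (1 - fps_const a * fps_X) * S A"
  proof (rule fps_ext)
    fix n
    show "fps_nth ((1 - fps_const b * fps_X) * A) n = fps_nth ((1 - fps_const a * fps_X) * S A) n"
    proof (cases n)
      case (Suc k)
      have l: "fps_nth ((1 - fps_const b * fps_X) * A) (Suc k) = fps_nth A (Suc k) - b * fps_nth A k"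
        by (simp add: left_diff_distrib mult.assoc)
      have r: "fps_nth ((1 - fps_const a * fps_X) * S A) (Suc k) = q ^ Suc k * fps_nth A (Suc k) - a * (q ^ k * fps_nth A k)"
        by (simp add: left_diff_distrib mult.assoc S)
      show ?thesis unfolding Suc l r using A(2)[of k] by (simp add: algebra_simps)
    qed (simp add: algebra_simps S)
  qed
  define F where "F = A * euler_series b q"
  have "F = ((1 - fps_const b * fps_X) * A) * S (euler_series b q)"
    unfolding F_def by (subst E) (simp only: ac_simps)
  also have "\<dots> = (1 - fps_const a * fps_X) * S F" unfolding A' F_def S_mult by (simp add: mult.assoc)
  finally have F: "F = (1 - fps_const a * fps_X) * S F" .
  have "fps_nth F n = fps_nth (euler_series a q) n" for n
  proof (induction n)
    case 0 then show ?case by (simp add: F_def A euler_series_nth)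
  next
    case (Suc n)
    have "fps_nth F (Suc n) = fps_nth ((1 - fps_const a * fps_X) * S F) (Suc n)" using F by simp
    then have "fps_nth F (Suc n) * (1 - q ^ Suc n) = - a * q ^ n * fps_nth F n"
      by (simp add: algebra_simps S)
    moreover have nz: "1 - q ^ Suc n \<noteq> 0" using power_Suc_neq_1[OF q, of n] by (metis right_minus_eq)
    ultimately show ?case unfolding euler_series_nth(2) nonzero_eq_divide_eq[OF nz] Suc.IH by blast
  qed
  then show ?thesis unfolding F_def by (rule fps_ext)
qed

lemma qpochhammer_inf_quotient:
  fixes q a b :: complex
  assumes q: "norm q < 1"
    and A: "A 0 = 1" "\<And>n. A (Suc n) * (1 - q ^ Suc n) = A n * (b - a * q ^ n)"
  shows "qpochhammer_inf (mconst a * mvar i ^ 2) (mconst q) / qpochhammer_inf (mconst b * mvar i ^ 2) (mconst q) =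
    univar i (even_series A)"
  unfolding qpochhammer_inf_eq[OF q]
proof (rule divide_mfps_eq)
  have "Abs_fps A * euler_series b q = euler_series a q"
    using A by (intro euler_series_quotient q) auto
  then have "square_subst i (Abs_fps A) * square_subst i (euler_series b q) = square_subst i (euler_series a q)"
    by (simp flip: square_subst_mult)
  moreover have "fps_nth (Abs_fps A) = A" by (rule ext) simp
  ultimately show "univar i (even_series A) * square_subst i (euler_series b q) = square_subst i (euler_series a q)"
    by (simp add: square_subst_eq[of i "Abs_fps A"])
  have "euler_series b q * inverse (euler_series b q) = 1"
    by (rule inverse_mult_eq_1') (simp add: euler_series_nth)
  then show "square_subst i (euler_series b q) * square_subst i (inverse (euler_series b q)) = 1"
    by (simp flip: square_subst_mult add: square_subst_1)
qed

section \<open>Infinite products over the variables\<close>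

lemma mcoeff_prod_univar:
  fixes g :: "nat \<Rightarrow> 'a::comm_ring_1"
  assumes "finite I"
  shows "mcoeff (\<Prod>i\<in>I. univar i g) m = (if keys m \<subseteq> I then \<Prod>i\<in>I. g (lookup m i) else 0)"
  using assms
proof (induction I arbitrary: m rule: finite_induct)
  case (insert i I)
  have v: "vars_in I (\<Prod>i\<in>I. univar i g)"
    by (intro vars_in_prod) (auto intro: vars_in_mono[OF vars_in_univar])
  have "mcoeff (\<Prod>i\<in>insert i I. univar i g) m = mcoeff (univar i g * (\<Prod>i\<in>I. univar i g)) m"
    using insert by simp
  also have "\<dots> = (if keys m \<subseteq> {i} \<union> I
      then mcoeff (univar i g) (mrestr {i} m) * mcoeff (\<Prod>i\<in>I. univar i g) (mrestr I m) else 0)"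
    by (rule mcoeff_times_disjoint[OF vars_in_univar v]) (use insert in auto)
  also have "mcoeff (\<Prod>i\<in>I. univar i g) (mrestr I m) = (\<Prod>i\<in>I. g (lookup m i))"
    unfolding insert.IH by (auto simp: keys_mrestr lookup_mrestr intro!: prod.cong)
  finally show ?case using insert by (simp add: mcoeff_univar keys_mrestr lookup_mrestr)
qed (auto simp: mcoeff_one)

text \<open>A variable absent from a monomial contributes \<open>g 0 = 1\<close>, so each
  coefficient of the partial products is eventually constant. The limit \<open>L\<close> has
  constant coefficient 1 and is therefore nonzero, as \<open>has_prod\<close> requires.\<close>

lemma prodinf_univar:
  fixes g :: "nat \<Rightarrow> complex"
  assumes g: "g 0 = 1"
  shows "mtrunc {..<n} (prodinf (\<lambda>i. univar i g)) = (\<Prod>i<n. univar i g)"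
proof -
  define L where "L = Abs_mfps (\<lambda>m. \<Prod>i\<in>keys m. g (lookup m i))"
  have *: "mcoeff (\<Prod>i\<in>I. univar i g) m = mcoeff L m" if "finite I" "keys m \<subseteq> I" for I m
  proof -
    have "(\<Prod>i\<in>I. g (lookup m i)) = (\<Prod>i\<in>keys m. g (lookup m i))"
      using that by (intro prod.mono_neutral_right) (auto simp: in_keys_iff g)
    then show ?thesis using that by (simp add: mcoeff_prod_univar L_def)
  qed
  have "(\<lambda>N. \<Prod>i\<le>N. univar i g) \<longlonglongrightarrow> L"
    unfolding tendsto_mfps_iff
  proof
    fix m :: "nat \<Rightarrow>\<^sub>0 nat"
    obtain N where N: "keys m \<subseteq> {..<N}" by (meson finite_keys finite_nat_iff_bounded)
    have "eventually (\<lambda>k. mcoeff (\<Prod>i\<le>k. univar i g) m = mcoeff L m) sequentially"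
      using eventually_ge_at_top[of N] by eventually_elim (use N in \<open>force intro!: *\<close>)
    then show "(\<lambda>k. mcoeff (\<Prod>i\<le>k. univar i g) m) \<longlonglongrightarrow> mcoeff L m"
      by (rule tendsto_eventually)
  qed
  moreover have "mcoeff L 0 = 1" by (simp add: L_def)
  then have "L \<noteq> 0" by auto
  ultimately have "(\<lambda>i. univar i g) has_prod L" unfolding has_prod_def raw_has_prod_def by simp
  then have "prodinf (\<lambda>i. univar i g) = L" by (rule has_prod_unique[symmetric])
  moreover have "mtrunc {..<n} L = (\<Prod>i<n. univar i g)"
  proof (rule mfps_eqI)
    fix m
    show "mcoeff (mtrunc {..<n} L) m = mcoeff (\<Prod>i<n. univar i g) m"
      using *[of "{..<n}" m] by (auto simp: mcoeff_mtrunc mcoeff_prod_univar)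
  qed
  ultimately show ?thesis by simp
qed

lemma mtrunc_geo:
  "i \<noteq> j \<Longrightarrow> mtrunc A (geo i j) = (if i \<in> A \<and> j \<in> A then geo i j else (1 :: 'a::comm_ring_1 mfps))"
proof (rule mfps_eqI)
  fix m :: "nat \<Rightarrow>\<^sub>0 nat" assume "i \<noteq> j"
  have m0: "m = 0 \<longleftrightarrow> keys m \<subseteq> {i, j} \<and> lookup m i = 0 \<and> lookup m j = 0"
    by (auto simp: in_keys_iff keys_eq_empty[symmetric] simp del: keys_eq_empty)
  have "lookup m i = 0" if "keys m \<subseteq> A" "i \<notin> A" for i using that by (auto simp: in_keys_iff)
  then show "mcoeff (mtrunc A (geo i j)) m = mcoeff (if i \<in> A \<and> j \<in> A then geo i j else (1 :: 'a mfps)) m"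
    using m0 by (auto simp: mcoeff_mtrunc geo_def mcoeff_bivar mcoeff_one)
qed

text \<open>The coefficient of m is settled once a finite index set contains
  \<open>pairs {..<N m}\<close>: all other factors become 1 when the variables from
  \<open>N m\<close> on are set to 0.\<close>

lemma infprod_geo:
  "mtrunc {..<n} (infprod (\<lambda>(i, j). 1 / (1 - mvar i * mvar j)) {(i, j). i < j}) =
    (pair_prod geo {..<n} :: complex mfps)"
proof -
  let ?f = "\<lambda>(i, j). 1 / (1 - mvar i * mvar j) :: complex mfps"
  let ?P = "{(i, j). i < j} :: (nat \<times> nat) set"
  define N where "N m = (LEAST n. keys m \<subseteq> {..<n})" for m :: "nat \<Rightarrow>\<^sub>0 nat"
  have N: "keys m \<subseteq> {..<N m}" for m
    unfolding N_def by (rule LeastI_ex) (meson finite_keys finite_nat_iff_bounded)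
  have N_le: "N m \<le> n" if "keys m \<subseteq> {..<n}" for m n unfolding N_def using that by (rule Least_le)
  define L :: "complex mfps" where "L = Abs_mfps (\<lambda>m. mcoeff (pair_prod geo {..<N m}) m)"
  have f: "?f p = (case p of (i, j) \<Rightarrow> geo i j)" if "p \<in> ?P" for p
    using that by (auto simp: geo_eq_divide)
  have *: "mcoeff (prod ?f X) m = mcoeff L m" if X: "finite X" "pairs {..<N m} \<subseteq> X" "X \<subseteq> ?P" for X m
  proof -
    have "mcoeff (prod ?f X) m = mcoeff (mtrunc {..<N m} (prod ?f X)) m"
      using N by (simp add: mcoeff_mtrunc)
    also have "mtrunc {..<N m} (prod ?f X) = (\<Prod>p\<in>X. mtrunc {..<N m} (case p of (i, j) \<Rightarrow> geo i j))"
      unfolding mtrunc_prod by (rule prod.cong) (use X f in auto)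
    also have "\<dots> = (\<Prod>p\<in>pairs {..<N m}. mtrunc {..<N m} (case p of (i, j) \<Rightarrow> geo i j))"
    proof (rule prod.mono_neutral_right)
      have "mtrunc {..<N m} (geo i j) = (1 :: complex mfps)" if "(i, j) \<in> X - pairs {..<N m}" for i j
      proof -
        have "i < j" using that X by auto
        then show ?thesis using that by (auto simp: mtrunc_geo pairs_def)
      qed
      then show "\<forall>p\<in>X - pairs {..<N m}. mtrunc {..<N m} (case p of (i, j) \<Rightarrow> geo i j) = (1 :: complex mfps)"
        by auto
    qed (use X in auto)
    also have "\<dots> = pair_prod geo {..<N m}"
      unfolding pair_prod_def by (rule prod.cong) (auto simp: pairs_def mtrunc_geo)
    finally show ?thesis by (simp add: L_def)
  qed
  have "(prod ?f \<longlongrightarrow> L) (finite_subsets_at_top ?P)"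
    unfolding tendsto_mfps_iff
  proof
    fix m :: "nat \<Rightarrow>\<^sub>0 nat"
    have "pairs {..<N m} \<subseteq> ?P" by (auto simp: pairs_def)
    then have "eventually (\<lambda>X. mcoeff (prod ?f X) m = mcoeff L m) (finite_subsets_at_top ?P)"
      unfolding eventually_finite_subsets_at_top using *
      by (intro exI[of _ "pairs {..<N m}"]) auto
    then show "((\<lambda>X. mcoeff (prod ?f X) m) \<longlongrightarrow> mcoeff L m) (finite_subsets_at_top ?P)"
      by (rule tendsto_eventually)
  qed
  then have "infprod ?f ?P = L"
    unfolding infprod_def by (rule tendsto_Lim[rotated]) simp
  moreover have "mtrunc {..<n} L = pair_prod geo {..<n}"
  proof (rule mfps_eqI)
    fix m
    have v: "vars_in {..<n} (pair_prod geo {..<n} :: complex mfps)"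
      unfolding pair_prod_def geo_def by (intro vars_in_prod) (auto simp: pairs_def intro!: vars_in_mono[OF vars_in_bivar])
    have "prod ?f (pairs {..<n}) = pair_prod geo {..<n}"
      unfolding pair_prod_def by (rule prod.cong) (auto simp: pairs_def geo_eq_divide)
    moreover have "pairs {..<N m} \<subseteq> pairs {..<n}" if "keys m \<subseteq> {..<n}"
      using N_le[OF that] by (auto simp: pairs_def)
    moreover have "pairs {..<n} \<subseteq> ?P" by (auto simp: pairs_def)
    ultimately show "mcoeff (mtrunc {..<n} L) m = mcoeff (pair_prod geo {..<n} :: complex mfps) m"
      using *[of "pairs {..<n}" m] vars_inD[OF v] by (auto simp: mcoeff_mtrunc)
  qed
  ultimately show ?thesis by simp
qed

definition vandermonde :: "nat \<Rightarrow> 'a::comm_ring_1 mfps" where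
  "vandermonde n = pair_prod (\<lambda>i j. mvar i - mvar j) {..<n}"

lemma truncated_product:
  fixes g :: "nat \<Rightarrow> complex"
  assumes g: "g 0 = 1"
  shows "mtrunc {..<n} (prodinf (\<lambda>i. univar i g) *
      infprod (\<lambda>(i, j). 1 / (1 - mvar i * mvar j)) {(i, j). i < j}) * vandermonde n =
    (\<Prod>i<n. univar i g) * pair_prod antisym_factor {..<n}"
proof -
  have "pair_prod antisym_factor {..<n} = (pair_prod geo {..<n} * vandermonde n :: complex mfps)"
    unfolding pair_prod_def vandermonde_def antisym_factor_def
    by (simp add: case_prod_unfold prod.distrib mult.commute)
  then show ?thesis
    unfolding mtrunc_times prodinf_univar[where g = g, OF g] infprod_geo by (simp add: mult.assoc)
qed

section \<open>The bialternant formula\<close>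

text \<open>Semistandard tableaux in the first \<open>n\<close> variables. Shapes are row functions
  because the branching rule varies the shape; \<open>mtrunc_schur\<close> connects them with
  \<open>schur\<close>.\<close>

definition tableaux :: "nat \<Rightarrow> (nat \<Rightarrow> nat) \<Rightarrow> (nat \<times> nat \<Rightarrow> nat) set" where
  "tableaux n r = {T \<in> extensional (row_diagram r).
     (\<forall>i j. (i, j) \<in> row_diagram r \<and> (i, j + 1) \<in> row_diagram r \<longrightarrow> T (i, j) \<le> T (i, j + 1)) \<and>
     (\<forall>i j. (i, j) \<in> row_diagram r \<and> (i + 1, j) \<in> row_diagram r \<longrightarrow> T (i, j) < T (i + 1, j)) \<and>
     (\<forall>s\<in>row_diagram r. T s < n)}"

definition schur_poly :: "nat \<Rightarrow> (nat \<Rightarrow> nat) \<Rightarrow> 'a::comm_ring_1 mfps" where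
  "schur_poly n r = (\<Sum>T\<in>tableaux n r. \<Prod>s\<in>row_diagram r. mvar (T s))"

lemma row_diagram_iff: "(i, j) \<in> row_diagram r \<longleftrightarrow> 1 \<le> i \<and> 1 \<le> j \<and> j \<le> r i"
  by (simp add: row_diagram_def)

lemma finite_tableaux: "row_shape r \<Longrightarrow> finite (tableaux n r)"
  by (rule finite_subset[of _ "row_diagram r \<rightarrow>\<^sub>E {..<n}"])
    (auto simp: tableaux_def PiE_iff extensional_def intro!: finite_PiE finite_row_diagram)

lemma tableaux_column:
  assumes r: "row_shape r" and T: "T \<in> tableaux n r" and s: "(i, j) \<in> row_diagram r"
  shows "i \<le> Suc (T (i, j))"
  using s
proof (induction i)
  case (Suc i)
  show ?case
  proof (cases "i = 0")
    case False
    then have "(i, j) \<in> row_diagram r"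
      using Suc.prems row_shape_antimono[OF r, of i "Suc i"] by (auto simp: row_diagram_iff)
    then have "i \<le> Suc (T (i, j))" "T (i, j) < T (Suc i, j)"
      using Suc T by (auto simp: tableaux_def)
    then show ?thesis by simp
  qed simp
qed (simp add: row_diagram_iff)

lemma tableaux_row:
  assumes T: "T \<in> tableaux n r" and j: "j \<le> j'" "(i, j') \<in> row_diagram r" "1 \<le> j"
  shows "T (i, j) \<le> T (i, j')"
  using j
proof (induction j' rule: dec_induct)
  case (step k)
  then have "(i, k) \<in> row_diagram r" by (auto simp: row_diagram_iff)
  moreover have "T (i, k) \<le> T (i, k + 1)"
    using T step.prems calculation by (auto simp: tableaux_def)
  ultimately show ?case using step.IH step.prems by simp
qed simp

text \<open>The shapes with at most \<open>n\<close> rows whose complement in \<open>r\<close> has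
  no two cells in one column (a horizontal strip), for \<open>r\<close> with at most n + 1
  rows.\<close>

definition interlacing :: "nat \<Rightarrow> (nat \<Rightarrow> nat) \<Rightarrow> (nat \<Rightarrow> nat) set" where
  "interlacing n r = {r'. (\<forall>i\<in>{1..n}. r (Suc i) \<le> r' i \<and> r' i \<le> r i) \<and> (\<forall>i. i \<notin> {1..n} \<longrightarrow> r' i = 0)}"

lemma interlacing_le: "r' \<in> interlacing n r \<Longrightarrow> r' i \<le> r i"
  by (cases "i \<in> {1..n}") (auto simp: interlacing_def)

lemma row_shape_interlacing:
  assumes "r' \<in> interlacing n r" shows "row_shape r'"
proof -
  have "r' (Suc i) \<le> r' i" if "1 \<le> i" for i
  proof (cases "Suc i \<le> n")
    case True
    then have "r' (Suc i) \<le> r (Suc i)" "r (Suc i) \<le> r' i" using assms that by (auto simp: interlacing_def)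
    then show ?thesis by simp
  qed (use assms in \<open>auto simp: interlacing_def\<close>)
  moreover have "\<forall>i>n. r' i = 0" using assms by (auto simp: interlacing_def)
  ultimately show ?thesis by (auto simp: row_shape_def)
qed

lemma row_diagram_mono: "r' \<in> interlacing n r \<Longrightarrow> row_diagram r' \<subseteq> row_diagram r"
  using interlacing_le by (fastforce simp: row_diagram_def intro: order_trans)

lemma finite_interlacing: "finite (interlacing n r)"
proof -
  have "inj_on (\<lambda>r'. restrict r' {1..n}) (interlacing n r)"
  proof (rule inj_onI, rule ext)
    fix x y i assume xy: "x \<in> interlacing n r" "y \<in> interlacing n r" "restrict x {1..n} = restrict y {1..n}"
    show "x i = y i"
    proof (cases "i \<in> {1..n}")
      case True then show ?thesis using fun_cong[OF xy(3), of i] by simp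
    qed (use xy in \<open>auto simp: interlacing_def\<close>)
  qed
  moreover have "(\<lambda>r'. restrict r' {1..n}) ` interlacing n r \<subseteq> (\<Pi>\<^sub>E i\<in>{1..n}. {..r i})"
    by (auto simp: interlacing_def)
  then have "finite ((\<lambda>r'. restrict r' {1..n}) ` interlacing n r)"
    by (rule finite_subset) (auto intro: finite_PiE)
  ultimately show ?thesis by (rule finite_imageD[rotated])
qed

definition small_rows :: "nat \<Rightarrow> (nat \<Rightarrow> nat) \<Rightarrow> (nat \<times> nat \<Rightarrow> nat) \<Rightarrow> nat \<Rightarrow> nat" where
  "small_rows n r T i = card {j. (i, j) \<in> row_diagram r \<and> T (i, j) < n}"

text \<open>Fills the strip between the two shapes with the new largest entry \<open>n\<close>. The
  value outside \<open>r\<close> is \<open>undefined\<close> to stay in the extensional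
  functions.\<close>

definition extend_tableau :: "nat \<Rightarrow> (nat \<Rightarrow> nat) \<Rightarrow> (nat \<Rightarrow> nat) \<Rightarrow> (nat \<times> nat \<Rightarrow> nat) \<Rightarrow> nat \<times> nat \<Rightarrow> nat" where
  "extend_tableau n r r' T s = (if s \<in> row_diagram r' then T s else if s \<in> row_diagram r then n else undefined)"

text \<open>Rows increase weakly, so the entries below \<open>n\<close> form an initial segment of
  each row and their number determines them.\<close>

lemma row_diagram_small_rows:
  assumes T: "T \<in> tableaux (Suc n) r"
  shows "row_diagram (small_rows n r T) = {s \<in> row_diagram r. T s < n}"
proof -
  have *: "{j. (i, j) \<in> row_diagram r \<and> T (i, j) < n} = {1..small_rows n r T i}" for i
  proof -
    let ?S = "{j. (i, j) \<in> row_diagram r \<and> T (i, j) < n}"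
    have fin: "finite ?S" by (rule finite_subset[of _ "{..r i}"]) (auto simp: row_diagram_iff)
    have down: "j \<in> ?S" if "j' \<in> ?S" "1 \<le> j" "j \<le> j'" for j j'
      using that tableaux_row[OF T, of j j' i] by (auto simp: row_diagram_iff)
    show ?thesis
    proof (cases "?S = {}")
      case True
      then have "small_rows n r T i = 0" unfolding small_rows_def by (simp only: card.empty)
      then show ?thesis using True by simp
    next
      case False
      have "?S = {1..Max ?S}"
      proof
        show "?S \<subseteq> {1..Max ?S}" using Max_ge[OF fin] by (auto simp: row_diagram_iff)
        show "{1..Max ?S} \<subseteq> ?S" using down[OF Max_in[OF fin False]] by auto
      qed
      then show ?thesis unfolding small_rows_def by (metis (no_types, lifting) card_atLeastAtMost diff_Suc_1)
    qed
  qed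
  show ?thesis
  proof (intro Set.set_eqI)
    fix s :: "nat \<times> nat"
    obtain i j where s: "s = (i, j)" by force
    have "1 \<le> i \<and> j \<in> {1..small_rows n r T i} \<longleftrightarrow> (i, j) \<in> row_diagram r \<and> T (i, j) < n"
      unfolding *[symmetric] by (auto simp: row_diagram_iff)
    then show "s \<in> row_diagram (small_rows n r T) \<longleftrightarrow> s \<in> {s \<in> row_diagram r. T s < n}"
      unfolding s by (auto simp: row_diagram_iff)
  qed
qed

lemma row_le_if_diagram_subset:
  "1 \<le> i \<Longrightarrow> (\<And>j. 1 \<le> j \<Longrightarrow> j \<le> a \<Longrightarrow> (i, j) \<in> row_diagram r) \<Longrightarrow> a \<le> r i"
  by (cases "a = 0") (auto simp: row_diagram_iff)

text \<open>A cell above another cell has an entry smaller than one that is at most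
  \<open>n\<close>, so it survives; this bounds the rows from below. Rows beyond \<open>n\<close>
  disappear because an entry in row i is at least i - 1.\<close>

lemma small_rows_interlacing:
  assumes r: "row_shape r" and T: "T \<in> tableaux (Suc n) r"
  shows "small_rows n r T \<in> interlacing n r"
  unfolding interlacing_def
proof (clarsimp, intro conjI allI impI ballI)
  note D = row_diagram_small_rows[OF T]
  fix i assume i: "i \<in> {Suc 0..n}"
  show "small_rows n r T i \<le> r i"
  proof (rule row_le_if_diagram_subset[where r = r])
    fix j assume "1 \<le> j" "j \<le> small_rows n r T i"
    then have "(i, j) \<in> row_diagram (small_rows n r T)" using i by (simp add: row_diagram_iff)
    then show "(i, j) \<in> row_diagram r" unfolding D by simp
  qed (use i in simp)
  show "r (Suc i) \<le> small_rows n r T i"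
  proof (rule row_le_if_diagram_subset[where r = "small_rows n r T"])
    fix j assume j: "1 \<le> j" "j \<le> r (Suc i)"
    then have s: "(i, j) \<in> row_diagram r" "(Suc i, j) \<in> row_diagram r"
      using i row_shape_antimono[OF r, of i "Suc i"] by (auto simp: row_diagram_iff)
    then have "T (i, j) < T (Suc i, j)" "T (Suc i, j) < Suc n" using T by (auto simp: tableaux_def)
    then show "(i, j) \<in> row_diagram (small_rows n r T)" unfolding D using s by simp
  qed (use i in simp)
next
  fix i assume i: "Suc 0 \<le> i \<longrightarrow> \<not> i \<le> n"
  have "(i, j) \<notin> row_diagram r \<or> \<not> T (i, j) < n" for j
    using tableaux_column[OF r T, of i j] i by (auto simp: row_diagram_iff)
  then have "{j. (i, j) \<in> row_diagram r \<and> T (i, j) < n} = {}" by blast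
  then show "small_rows n r T i = 0" unfolding small_rows_def by (simp only: card.empty)
qed

lemma restrict_tableau:
  assumes r: "row_shape r" and T: "T \<in> tableaux (Suc n) r"
  shows "restrict T (row_diagram (small_rows n r T)) \<in> tableaux n (small_rows n r T)"
  using T unfolding tableaux_def row_diagram_small_rows[OF T] by auto

lemma extend_tableau_in:
  assumes r: "row_shape r" "\<And>i. i > Suc n \<Longrightarrow> r i = 0"
    and r': "r' \<in> interlacing n r" and T: "T \<in> tableaux n r'"
  shows "extend_tableau n r r' T \<in> tableaux (Suc n) r"
proof -
  note sub = row_diagram_mono[OF r']
  have lt: "T s < n" if "s \<in> row_diagram r'" for s using T that by (auto simp: tableaux_def)
  have ext: "extend_tableau n r r' T s = undefined" if "s \<notin> row_diagram r" for s
    using that sub by (auto simp: extend_tableau_def)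
  have row: "extend_tableau n r r' T (i, j) \<le> extend_tableau n r r' T (i, j + 1)"
    if s: "(i, j) \<in> row_diagram r" "(i, j + 1) \<in> row_diagram r" for i j
  proof (cases "(i, j + 1) \<in> row_diagram r'")
    case True
    then have "(i, j) \<in> row_diagram r'" using s by (auto simp: row_diagram_iff)
    then show ?thesis using True T by (auto simp: extend_tableau_def tableaux_def)
  next
    case False
    then show ?thesis using s lt[of "(i, j)"] by (auto simp: extend_tableau_def)
  qed
  have col: "extend_tableau n r r' T (i, j) < extend_tableau n r r' T (i + 1, j)"
    if s: "(i, j) \<in> row_diagram r" "(i + 1, j) \<in> row_diagram r" for i j
  proof -
    have "i + 1 \<le> Suc n" using r(2)[of "i + 1"] s by (force simp: row_diagram_iff)
    then have "r (Suc i) \<le> r' i" using r' s by (auto simp: interlacing_def row_diagram_iff)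
    then have ij: "(i, j) \<in> row_diagram r'" using s by (auto simp: row_diagram_iff)
    show ?thesis
    proof (cases "(i + 1, j) \<in> row_diagram r'")
      case True
      then show ?thesis using ij T by (auto simp: extend_tableau_def tableaux_def)
    next
      case False
      then show ?thesis using ij s lt[OF ij] by (auto simp: extend_tableau_def)
    qed
  qed
  have "extend_tableau n r r' T s < Suc n" if "s \<in> row_diagram r" for s
    using that lt by (auto simp: extend_tableau_def less_SucI)
  then show ?thesis using ext row col by (auto simp: tableaux_def extensional_def)
qed

lemma small_rows_extend:
  assumes r': "r' \<in> interlacing n r" and T: "T \<in> tableaux n r'"
  shows "small_rows n r (extend_tableau n r r' T) = r'"
proof
  fix i
  have "s \<in> row_diagram r \<and> extend_tableau n r r' T s < n \<longleftrightarrow> s \<in> row_diagram r'" for s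
    using row_diagram_mono[OF r'] T by (auto simp: extend_tableau_def tableaux_def split: if_splits)
  then have "small_rows n r (extend_tableau n r r' T) i = card {j. (i, j) \<in> row_diagram r'}"
    by (simp add: small_rows_def)
  also have "\<dots> = r' i"
  proof (cases "i = 0")
    case True
    then show ?thesis using r' by (simp add: row_diagram_iff interlacing_def)
  next
    case False
    then have "{j. (i, j) \<in> row_diagram r'} = {1..r' i}" by (auto simp: row_diagram_iff)
    then show ?thesis by simp
  qed
  finally show "small_rows n r (extend_tableau n r r' T) i = r' i" .
qed

text \<open>Deleting the cells with the largest possible entry \<open>n\<close> is a bijection onto
  pairs of an interlacing shape and a tableau with entries below \<open>n\<close>; the deleted cells
  account for the power of \<open>mvar n\<close>.\<close>

lemma schur_poly_branching:
  assumes r: "row_shape r" "\<And>i. i > Suc n \<Longrightarrow> r i = 0"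
  shows "(schur_poly (Suc n) r :: 'a::comm_ring_1 mfps) = (\<Sum>r'\<in>interlacing n r.
    mvar n ^ (card (row_diagram r) - card (row_diagram r')) * schur_poly n r')"
proof -
  have "(\<Sum>r'\<in>interlacing n r. mvar n ^ (card (row_diagram r) - card (row_diagram r')) * schur_poly n r' :: 'a mfps) =
    (\<Sum>(r', T)\<in>(SIGMA r':interlacing n r. tableaux n r').
       mvar n ^ (card (row_diagram r) - card (row_diagram r')) * (\<Prod>s\<in>row_diagram r'. mvar (T s)))"
    unfolding schur_poly_def sum_distrib_left
    by (rule sum.Sigma) (auto simp: finite_interlacing intro!: finite_tableaux row_shape_interlacing)
  also have "\<dots> = (\<Sum>T\<in>tableaux (Suc n) r. \<Prod>s\<in>row_diagram r. mvar (T s))"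
  proof (rule sum.reindex_bij_witness[of _
        "\<lambda>T. (small_rows n r T, restrict T (row_diagram (small_rows n r T)))"
        "\<lambda>(r', T). extend_tableau n r r' T"])
    fix p assume "p \<in> (SIGMA r':interlacing n r. tableaux n r')"
    then obtain r' T where p: "p = (r', T)" "r' \<in> interlacing n r" "T \<in> tableaux n r'" by auto
    let ?E = "extend_tableau n r r' T"
    have sub: "row_diagram r' \<subseteq> row_diagram r" by (rule row_diagram_mono[OF p(2)])
    show "(case p of (r', T) \<Rightarrow> extend_tableau n r r' T) \<in> tableaux (Suc n) r"
      using extend_tableau_in[OF r p(2,3)] p(1) by simp
    have "restrict ?E (row_diagram r') = T"
      using p(3) by (auto simp: tableaux_def extend_tableau_def extensional_def)
    then show "(small_rows n r (case p of (r', T) \<Rightarrow> extend_tableau n r r' T),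
        restrict (case p of (r', T) \<Rightarrow> extend_tableau n r r' T) (row_diagram (small_rows n r (case p of (r', T) \<Rightarrow> extend_tableau n r r' T)))) = p"
      using small_rows_extend[OF p(2,3)] p(1) by simp
    have "(\<Prod>s\<in>row_diagram r. mvar (?E s) :: 'a mfps) = (\<Prod>s\<in>row_diagram r - row_diagram r'. mvar (?E s)) * (\<Prod>s\<in>row_diagram r'. mvar (?E s))"
      by (rule prod.subset_diff[OF sub finite_row_diagram[OF r(1)]])
    also have "(\<Prod>s\<in>row_diagram r - row_diagram r'. mvar (?E s) :: 'a mfps) = (\<Prod>s\<in>row_diagram r - row_diagram r'. mvar n)"
      by (rule prod.cong) (auto simp: extend_tableau_def)
    also have "\<dots> = mvar n ^ (card (row_diagram r) - card (row_diagram r'))"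
      using sub finite_subset[OF sub finite_row_diagram[OF r(1)]] by (simp add: card_Diff_subset)
    also have "(\<Prod>s\<in>row_diagram r'. mvar (?E s) :: 'a mfps) = (\<Prod>s\<in>row_diagram r'. mvar (T s))"
      by (rule prod.cong) (auto simp: extend_tableau_def)
    finally show "(\<Prod>s\<in>row_diagram r. mvar ((case p of (r', T) \<Rightarrow> extend_tableau n r r' T) s)) =
      (case p of (r', T) \<Rightarrow> mvar n ^ (card (row_diagram r) - card (row_diagram r')) * (\<Prod>s\<in>row_diagram r'. mvar (T s) :: 'a mfps))"
      using p(1) by simp
  next
    fix T assume T: "T \<in> tableaux (Suc n) r"
    show "(case (small_rows n r T, restrict T (row_diagram (small_rows n r T))) of (r', T) \<Rightarrow> extend_tableau n r r' T) = T"
    proof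
      fix s
      have "T \<in> extensional (row_diagram r)" "\<forall>s\<in>row_diagram r. T s < Suc n"
        using T by (simp_all add: tableaux_def)
      then have "s \<in> row_diagram r \<Longrightarrow> T s < Suc n" "s \<notin> row_diagram r \<Longrightarrow> T s = undefined"
        using extensional_arb[of T "row_diagram r" s] by blast+
      then show "(case (small_rows n r T, restrict T (row_diagram (small_rows n r T))) of (r', T) \<Rightarrow> extend_tableau n r r' T) s = T s"
        unfolding row_diagram_small_rows[OF T] by (auto simp: extend_tableau_def row_diagram_small_rows[OF T])
    qed
    show "(small_rows n r T, restrict T (row_diagram (small_rows n r T))) \<in> (SIGMA r':interlacing n r. tableaux n r')"
      using small_rows_interlacing[OF r(1) T] restrict_tableau[OF r(1) T] by simp
  qed
  finally show ?thesis by (simp add: schur_poly_def)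
qed

section \<open>Alternants and their branching rule\<close>

hide_const (open) Conjugate.conjugate Determinants.det Finite_Cartesian_Product.mat

definition alternant :: "(nat \<Rightarrow> 'a::comm_ring_1) \<Rightarrow> nat \<Rightarrow> (nat \<Rightarrow> nat) \<Rightarrow> 'a" where
  "alternant x n l = Determinant.det (Matrix.mat n n (\<lambda>(i, j). x i ^ l j))"

lemma det_columns:
  "Determinant.det (Matrix.mat n n (\<lambda>(i, j). f i j)) =
    (\<Sum>p | p permutes {0..<n}. signof p * (\<Prod>j<n. f (p j) j))" for f :: "nat \<Rightarrow> nat \<Rightarrow> 'a::comm_ring_1"
proof -
  let ?A = "Matrix.mat n n (\<lambda>(i, j). f i j)"
  have "Determinant.det ?A = Determinant.det (transpose_mat ?A)" by (rule det_transpose[of _ n, symmetric]) simp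
  also have "\<dots> = (\<Sum>p | p permutes {0..<n}. signof p * (\<Prod>i=0..<n. transpose_mat ?A $$ (i, p i)))"
    by (rule det_def') simp
  also have "\<dots> = (\<Sum>p | p permutes {0..<n}. signof p * (\<Prod>j<n. f (p j) j))"
  proof (rule sum.cong[OF refl])
    fix p assume "p \<in> {p. p permutes {0..<n}}"
    then have "p i < n" if "i < n" for i using that permutes_in_image[of p "{0..<n}" i] by simp
    then have "(\<Prod>i=0..<n. transpose_mat ?A $$ (i, p i)) = (\<Prod>j<n. f (p j) j)"
      by (intro prod.cong) auto
    then show "signof p * (\<Prod>i=0..<n. transpose_mat ?A $$ (i, p i)) = signof p * (\<Prod>j<n. f (p j) j)" by simp
  qed
  finally show ?thesis .
qed

text \<open>Multilinearity in the columns, with the scalar \<open>c i\<close> taken out of row i,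
  read off the Leibniz formula.\<close>

lemma det_column_sums:
  fixes c :: "nat \<Rightarrow> 'a::comm_ring_1"
  assumes K: "\<And>j. finite (K j)"
  shows "Determinant.det (Matrix.mat n n (\<lambda>(i, j). c i * (\<Sum>k\<in>K j. d j k * f i k))) =
    (\<Prod>i<n. c i) * (\<Sum>\<kappa>\<in>PiE {..<n} K. (\<Prod>j<n. d j (\<kappa> j)) *
       Determinant.det (Matrix.mat n n (\<lambda>(i, j). f i (\<kappa> j))))"
proof -
  have "signof p * (\<Prod>j<n. c (p j) * (\<Sum>k\<in>K j. d j k * f (p j) k)) =
      (\<Sum>\<kappa>\<in>PiE {..<n} K. (\<Prod>i<n. c i) * ((\<Prod>j<n. d j (\<kappa> j)) * (signof p * (\<Prod>j<n. f (p j) (\<kappa> j)))))"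
    if p: "p permutes {0..<n}" for p
  proof -
    have "(\<Prod>j<n. c (p j)) = (\<Prod>i<n. c i)"
      using prod.permute[OF p, of c] by (simp add: lessThan_atLeast0 comp_def)
    moreover have "(\<Prod>j<n. \<Sum>k\<in>K j. d j k * f (p j) k) = (\<Sum>\<kappa>\<in>PiE {..<n} K. \<Prod>j<n. d j (\<kappa> j) * f (p j) (\<kappa> j))"
      by (rule prod_sum_PiE) (auto simp: K)
    ultimately have "(\<Prod>j<n. c (p j) * (\<Sum>k\<in>K j. d j k * f (p j) k)) =
      (\<Prod>i<n. c i) * (\<Sum>\<kappa>\<in>PiE {..<n} K. \<Prod>j<n. d j (\<kappa> j) * f (p j) (\<kappa> j))"
      by (simp only: prod.distrib)
    then show ?thesis
      by (simp only: prod.distrib sum_distrib_left ac_simps)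
  qed
  then show ?thesis
    unfolding det_columns sum_distrib_left
    by (subst sum.swap) (auto intro!: sum.cong)
qed

text \<open>The geometric sum for x^(a-b) - z^(a-b), multiplied by x^b. The exponents k with b \<le>
  k < a later become the interlacing condition.\<close>

lemma diff_powers_interval:
  fixes x z :: "'a::comm_ring_1"
  assumes "b < a"
  shows "x ^ a - x ^ b * z ^ (a - b) = (x - z) * (\<Sum>k\<in>{b..<a}. z ^ (a - 1 - k) * x ^ k)"
  using assms
proof (induction a)
  case (Suc a)
  show ?case
  proof (cases "a = b")
    case True
    then show ?thesis by (simp add: algebra_simps)
  next
    case False
    then have ab: "b < a" using Suc.prems by simp
    have "(\<Sum>k\<in>{b..<a}. z ^ (a - k) * x ^ k) = z * (\<Sum>k\<in>{b..<a}. z ^ (a - 1 - k) * x ^ k)"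
      unfolding sum_distrib_left
    proof (rule sum.cong[OF refl])
      fix k assume "k \<in> {b..<a}"
      then have "a - k = Suc (a - 1 - k)" by auto
      then show "z ^ (a - k) * x ^ k = z * (z ^ (a - 1 - k) * x ^ k)" by (simp add: mult.assoc)
    qed
    then have sum: "(\<Sum>k\<in>{b..<Suc a}. z ^ (Suc a - 1 - k) * x ^ k) = z * (\<Sum>k\<in>{b..<a}. z ^ (a - 1 - k) * x ^ k) + x ^ a"
      using ab by (simp add: sum.atLeastLessThan_Suc)
    have "(x - z) * (z * (\<Sum>k\<in>{b..<a}. z ^ (a - 1 - k) * x ^ k)) = z * (x ^ a - x ^ b * z ^ (a - b))"
      unfolding Suc.IH[OF ab] by (simp only: ac_simps)
    then have "(x - z) * (\<Sum>k\<in>{b..<Suc a}. z ^ (Suc a - 1 - k) * x ^ k) = z * (x ^ a - x ^ b * z ^ (a - b)) + (x - z) * x ^ a"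
      unfolding sum by (simp only: distrib_left)
    moreover have "Suc a - b = Suc (a - b)" using ab by simp
    ultimately show ?thesis by (simp add: algebra_simps)
  qed
qed simp

text \<open>From each column x_n^(l_j - l_(j+1)) times the next column is subtracted. In the last
  row this leaves only the last entry, and Laplace expansion removes that row. By
  \<open>diff_powers_interval\<close> every other row i has the factor x_i - x_n, and the columns
  are sums of pure powers.\<close>

lemma alternant_branching:
  fixes x :: "nat \<Rightarrow> 'a::comm_ring_1"
  assumes l: "\<And>j. j < n \<Longrightarrow> l (Suc j) < l j"
  shows "alternant x (Suc n) l = x n ^ l n * ((\<Prod>i<n. x i - x n) *
    (\<Sum>\<kappa>\<in>PiE {..<n} (\<lambda>j. {l (Suc j)..<l j}). (\<Prod>j<n. x n ^ (l j - 1 - \<kappa> j)) * alternant x n \<kappa>))"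
    (is "_ = _ * ?R")
proof -
  let ?n = "Suc n"
  define A where "A = Matrix.mat ?n ?n (\<lambda>(i, j). x i ^ l j)"
  \<comment> \<open>The column operations as a lower bidiagonal matrix with ones on the diagonal,
    hence of determinant 1.\<close>
  define U where "U = Matrix.mat ?n ?n (\<lambda>(i, j). if i = j then 1 else if i = Suc j then - (x n ^ (l j - l (Suc j))) else 0)"
  define B where "B i j = (if j = n then x i ^ l j else x i ^ l j - x i ^ l (Suc j) * x n ^ (l j - l (Suc j)))" for i j
  have "Determinant.det U = prod_list (diag_mat U)"
    by (rule det_lower_triangular[of ?n]) (auto simp: U_def)
  also have "diag_mat U = map (\<lambda>_. 1) [0..<?n]"
    unfolding diag_mat_def by (rule map_cong) (auto simp: U_def)
  finally have detU: "Determinant.det U = 1" by (simp add: map_replicate_const)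
  have AU: "A * U = Matrix.mat ?n ?n (\<lambda>(i, j). B i j)"
  proof (rule eq_matI)
    fix i j assume "i < dim_row (Matrix.mat ?n ?n (\<lambda>(i, j). B i j))" "j < dim_col (Matrix.mat ?n ?n (\<lambda>(i, j). B i j))"
    then have ij: "i < ?n" "j < ?n" by simp_all
    have "(A * U) $$ (i, j) = (\<Sum>k=0..<?n. x i ^ l k * (if k = j then 1 else if k = Suc j then - (x n ^ (l j - l (Suc j))) else 0))"
      using ij by (simp add: A_def U_def scalar_prod_def del: sum.op_ivl_Suc)
    also have "\<dots> = (\<Sum>k=0..<?n. (if k = j then x i ^ l k else 0) + (if k = Suc j then - (x i ^ l k * x n ^ (l j - l (Suc j))) else 0))"
      by (rule sum.cong) auto
    also have "\<dots> = B i j"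
      using ij unfolding sum.distrib by (auto simp: B_def sum.delta simp del: sum.op_ivl_Suc)
    finally show "(A * U) $$ (i, j) = Matrix.mat ?n ?n (\<lambda>(i, j). B i j) $$ (i, j)" using ij by simp
  qed (auto simp: A_def U_def)
  have "alternant x ?n l = Determinant.det A" by (simp add: alternant_def A_def)
  also have "\<dots> = Determinant.det (A * U)"
    by (subst det_mult[of _ ?n]) (auto simp: A_def U_def detU[unfolded U_def])
  also have "\<dots> = (\<Sum>j<?n. (A * U) $$ (n, j) * cofactor (A * U) n j)"
    by (rule laplace_expansion_row) (auto simp: AU)
  also have "\<dots> = (A * U) $$ (n, n) * cofactor (A * U) n n"
  proof -
    have "(A * U) $$ (n, j) = 0" if "j < n" for j
    proof -
      have "l j = l (Suc j) + (l j - l (Suc j))" using l[OF that] by simp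
      then have "x n ^ l j = x n ^ l (Suc j) * x n ^ (l j - l (Suc j))" by (metis power_add)
      then show ?thesis using that by (simp add: AU B_def)
    qed
    then show ?thesis by simp
  qed
  also have "(A * U) $$ (n, n) = x n ^ l n" by (simp add: AU B_def)
  also have "cofactor (A * U) n n = Determinant.det (Matrix.mat n n (\<lambda>(i, j). B i j))"
  proof -
    have "mat_delete (A * U) n n = Matrix.mat n n (\<lambda>(i, j). B i j)"
      unfolding AU by (rule eq_matI) (auto simp: mat_delete_def)
    moreover have "even (n + n)" by simp
    ultimately show ?thesis by (simp add: cofactor_def)
  qed
  also have "Matrix.mat n n (\<lambda>(i, j). B i j) = Matrix.mat n n (\<lambda>(i, j). (x i - x n) *
     (\<Sum>k\<in>{l (Suc j)..<l j}. x n ^ (l j - 1 - k) * x i ^ k))"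
    by (rule eq_matI) (auto simp: B_def diff_powers_interval[OF l])
  also have "Determinant.det \<dots> = ?R"
    unfolding alternant_def
    by (rule det_column_sums[where c = "\<lambda>i. x i - x n" and K = "\<lambda>j. {l (Suc j)..<l j}"
          and d = "\<lambda>j k. x n ^ (l j - 1 - k)" and f = "\<lambda>i k. x i ^ k"]) simp
  finally show ?thesis .
qed

lemma alternant_cong: "(\<And>j. j < n \<Longrightarrow> l j = l' j) \<Longrightarrow> alternant x n l = alternant x n l'"
  unfolding alternant_def
  by (rule arg_cong[where f = Determinant.det]) (auto intro!: eq_matI)

lemma pair_prod_column: "pair_prod th {..<n} = (\<Prod>j<n. \<Prod>i<j. th i j)"
proof -
  have "(\<Prod>j<n. \<Prod>i<j. th i j) = (\<Prod>(j, i)\<in>(SIGMA j:{..<n}. {..<j}). th i j)"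
    by (rule prod.Sigma) auto
  also have "\<dots> = pair_prod th {..<n}"
    unfolding pair_prod_def
    by (rule prod.reindex_bij_witness[of _ prod.swap prod.swap]) (auto simp: pairs_def)
  finally show ?thesis ..
qed

lemma vandermonde_Suc: "vandermonde (Suc n) = vandermonde n * (\<Prod>i<n. mvar i - mvar n)"
  unfolding vandermonde_def pair_prod_column by (rule prod.lessThan_Suc)

lemma card_row_diagram:
  assumes "\<And>i. i > n \<Longrightarrow> r i = 0"
  shows "card (row_diagram r) = (\<Sum>i<n. r (Suc i))"
proof -
  have "row_diagram r = (SIGMA i:{1..n}. {1..r i})"
  proof (intro Set.set_eqI iffI)
    fix s assume s: "s \<in> row_diagram r"
    obtain i j where [simp]: "s = (i, j)" by force
    have "\<not> n < i" using assms[of i] s by (auto simp: row_diagram_iff)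
    then show "s \<in> (SIGMA i:{1..n}. {1..r i})" using s by (auto simp: row_diagram_iff)
  qed (auto simp: row_diagram_iff)
  then have "card (row_diagram r) = (\<Sum>i = 1..n. r i)" by simp
  also have "\<dots> = (\<Sum>i<n. r (Suc i))"
    by (rule sum.reindex_bij_witness[of _ Suc "\<lambda>i. i - 1"]) auto
  finally show ?thesis .
qed

text \<open>Both sides obey the same branching in the last variable. Adding the staircase maps
  interlacing shapes r' bijectively to the exponent vectors \<open>k\<close> with l (j+1) \<le> k j
  < l j, and the powers of the last variable agree because the exponents of both sides count the
  cells of the removed strip.\<close>

theorem schur_poly_vandermonde:
  assumes "row_shape r" "\<And>i. i > n \<Longrightarrow> r i = 0"
  shows "(schur_poly n r :: 'a::comm_ring_1 mfps) * vandermonde n = alternant mvar n (\<lambda>j. r (Suc j) + (n - 1 - j))"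
  using assms
proof (induction n arbitrary: r)
  case 0
  have D: "row_diagram r = {}" using 0(2) by (force simp: row_diagram_def)
  have "tableaux 0 r = {\<lambda>_. undefined}" by (auto simp: tableaux_def D)
  then have "schur_poly 0 r = (1 :: 'a mfps)" by (simp add: schur_poly_def D)
  moreover have "vandermonde 0 = (1 :: 'a mfps)" by (simp add: vandermonde_def pair_prod_def pairs_def)
  moreover have "alternant mvar 0 l = (1 :: 'a mfps)" for l by (simp add: alternant_def det_columns)
  ultimately show ?case by simp
next
  case (Suc n)
  note r = Suc.prems
  define l where "l j = r (Suc j) + (Suc n - 1 - j)" for j
  have l: "l (Suc j) < l j" if "j < n" for j
    using row_shape_antimono[OF r(1), of "Suc j" "Suc (Suc j)"] that by (simp add: l_def)
  let ?K = "PiE {..<n} (\<lambda>j. {l (Suc j)..<l j})"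
  define \<kappa> where "\<kappa> r' = restrict (\<lambda>j. r' (Suc j) + (n - 1 - j)) {..<n}" for r' :: "nat \<Rightarrow> nat"
  define \<rho> where "\<rho> k i = (if i \<in> {1..n} then k (i - 1) - (n - i) else 0)" for k :: "nat \<Rightarrow> nat" and i
  have summand: "mvar n ^ (card (row_diagram r) - card (row_diagram r')) * (schur_poly n r' * vandermonde n) =
      mvar n ^ l n * ((\<Prod>j<n. mvar n ^ (l j - 1 - \<kappa> r' j)) * alternant mvar n (\<kappa> r') :: 'a mfps)"
    if r': "r' \<in> interlacing n r" for r'
  proof -
    have r'0: "r' i = 0" if "i > n" for i using r' that by (simp add: interlacing_def)
    have "(schur_poly n r' :: 'a mfps) * vandermonde n = alternant mvar n (\<lambda>j. r' (Suc j) + (n - 1 - j))"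
      by (rule Suc.IH[OF row_shape_interlacing[OF r'] r'0])
    also have "\<dots> = alternant mvar n (\<kappa> r')" by (rule alternant_cong) (simp add: \<kappa>_def)
    finally have 1: "schur_poly n r' * vandermonde n = (alternant mvar n (\<kappa> r') :: 'a mfps)" .
    have "card (row_diagram r) = (\<Sum>i<n. r (Suc i)) + r (Suc n)" using card_row_diagram[of "Suc n" r] r(2) by simp
    moreover have "card (row_diagram r') = (\<Sum>i<n. r' (Suc i))" using card_row_diagram[of n r'] r'0 by simp
    moreover have "(\<Sum>i<n. r (Suc i)) = (\<Sum>i<n. r (Suc i) - r' (Suc i)) + (\<Sum>i<n. r' (Suc i))"
      unfolding sum.distrib[symmetric] by (rule sum.cong) (use interlacing_le[OF r'] in auto)
    moreover have "(\<Sum>i<n. r (Suc i) - r' (Suc i)) = (\<Sum>j<n. l j - 1 - \<kappa> r' j)"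
      by (rule sum.cong) (auto simp: l_def \<kappa>_def)
    moreover have "r (Suc n) = l n" by (simp add: l_def)
    ultimately have 2: "card (row_diagram r) - card (row_diagram r') = l n + (\<Sum>j<n. l j - 1 - \<kappa> r' j)" by simp
    show ?thesis unfolding 1 2 power_add power_sum by (simp add: mult.assoc)
  qed
  have branch: "(schur_poly (Suc n) r :: 'a mfps) = (\<Sum>r'\<in>interlacing n r.
      mvar n ^ (card (row_diagram r) - card (row_diagram r')) * schur_poly n r')"
    by (rule schur_poly_branching[OF r])
  have "schur_poly (Suc n) r * vandermonde (Suc n) = (\<Prod>i<n. mvar i - mvar n) *
    (\<Sum>r'\<in>interlacing n r. mvar n ^ (card (row_diagram r) - card (row_diagram r')) * (schur_poly n r' * vandermonde n) :: 'a mfps)"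
    unfolding branch vandermonde_Suc sum_distrib_left sum_distrib_right
    by (rule sum.cong) (simp_all add: mult_ac)
  also have "(\<Sum>r'\<in>interlacing n r. mvar n ^ (card (row_diagram r) - card (row_diagram r')) * (schur_poly n r' * vandermonde n) :: 'a mfps) =
    (\<Sum>k\<in>?K. mvar n ^ l n * ((\<Prod>j<n. mvar n ^ (l j - 1 - k j)) * alternant mvar n k))"
  proof (rule sum.reindex_bij_witness[of _ \<rho> \<kappa>])
    fix r' assume r': "r' \<in> interlacing n r"
    show "\<rho> (\<kappa> r') = r'"
      using r' by (auto simp: \<rho>_def \<kappa>_def interlacing_def fun_eq_iff)
    show "\<kappa> r' \<in> ?K"
    proof (rule PiE_I)
      fix j assume j: "j \<in> {..<n}"
      then have "Suc j \<in> {1..n}" by auto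
      then have "r (Suc (Suc j)) \<le> r' (Suc j)" "r' (Suc j) \<le> r (Suc j)" using r' by (auto simp: interlacing_def)
      then show "\<kappa> r' j \<in> {l (Suc j)..<l j}" using j by (auto simp: \<kappa>_def l_def)
    qed (simp add: \<kappa>_def)
    show "mvar n ^ l n * ((\<Prod>j<n. mvar n ^ (l j - 1 - \<kappa> r' j)) * alternant mvar n (\<kappa> r')) =
      mvar n ^ (card (row_diagram r) - card (row_diagram r')) * (schur_poly n r' * vandermonde n :: 'a mfps)"
      using summand[OF r'] by simp
  next
    fix k assume k: "k \<in> ?K"
    have kj: "r (Suc (Suc j)) + (n - 1 - j) \<le> k j" "k j < r (Suc j) + (n - j)" if "j < n" for j
      using PiE_mem[OF k, of j] that by (auto simp: l_def)
    show "\<kappa> (\<rho> k) = k"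
    proof
      fix j
      show "\<kappa> (\<rho> k) j = k j"
      proof (cases "j < n")
        case True
        then show ?thesis using kj(1)[OF True] by (simp add: \<kappa>_def \<rho>_def)
      next
        case False
        then show ?thesis using PiE_arb[OF k, of j] by (simp add: \<kappa>_def)
      qed
    qed
    have "r (Suc i) \<le> \<rho> k i \<and> \<rho> k i \<le> r i" if i: "i \<in> {1..n}" for i
    proof -
      obtain j where "i = Suc j" "j < n" using i by (cases i) auto
      then show ?thesis using kj[of j] by (auto simp: \<rho>_def)
    qed
    then show "\<rho> k \<in> interlacing n r" by (auto simp: interlacing_def \<rho>_def)
  qed
  also have "(\<Prod>i<n. mvar i - mvar n) * (\<Sum>k\<in>?K. mvar n ^ l n * ((\<Prod>j<n. mvar n ^ (l j - 1 - k j)) * alternant mvar n k)) =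
    (alternant mvar (Suc n) l :: 'a mfps)"
    by (subst alternant_branching, erule l) (simp add: sum_distrib_left mult_ac)
  finally show ?case unfolding l_def .
qed

text \<open>With \<open>a\<close> and \<open>b\<close> taken to the front, the exchange merely swaps
  their two products over the remaining indices and reverses the one factor
  \<open>th a b\<close>.\<close>

lemma pair_prod_transpose:
  fixes th :: "nat \<Rightarrow> nat \<Rightarrow> 'a::comm_ring_1"
  assumes J: "finite J" "a \<in> J" "b \<in> J" "a \<noteq> b" and anti: "\<And>i j. th j i = - th i j"
  shows "pair_prod (\<lambda>i j. th (Transposition.transpose a b i) (Transposition.transpose a b j)) J = - pair_prod th J"
proof -
  let ?t = "Transposition.transpose a b"
  define K where "K = J - {a} - {b}"
  let ?th = "\<lambda>i j. th (?t i) (?t j)"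
  have expand: "pair_prod h J = pos_sign J a * pos_sign (J - {a}) b * (h a b * ((\<Prod>i\<in>K. h a i) * (\<Prod>i\<in>K. h b i))) * pair_prod h K"
    if h: "\<And>i j. h j i = - h i j" for h :: "nat \<Rightarrow> nat \<Rightarrow> 'a"
  proof -
    have "pair_prod h J = pos_sign J a * (\<Prod>i\<in>J - {a}. h a i) * pair_prod h (J - {a})"
      by (rule pair_prod_remove[OF J(1,2) h])
    also have "pair_prod h (J - {a}) = pos_sign (J - {a}) b * (\<Prod>i\<in>K. h b i) * pair_prod h K"
      unfolding K_def by (rule pair_prod_remove[OF _ _ h]) (use J in auto)
    also have "(\<Prod>i\<in>J - {a}. h a i) = h a b * (\<Prod>i\<in>K. h a i)"
      unfolding K_def using J by (intro prod.remove) auto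
    finally show ?thesis by (simp only: ac_simps)
  qed
  have t: "?t a = b" "?t b = a" "\<And>i. i \<in> K \<Longrightarrow> ?t i = i"
    by (auto simp: K_def Transposition.transpose_def)
  have 1: "pair_prod ?th K = pair_prod th K"
    unfolding pair_prod_def by (rule prod.cong) (auto simp: pairs_def t)
  have 2: "(\<Prod>i\<in>K. ?th a i) = (\<Prod>i\<in>K. th b i)" "(\<Prod>i\<in>K. ?th b i) = (\<Prod>i\<in>K. th a i)"
    by (auto simp: t intro!: prod.cong)
  have 3: "?th a b = - th a b" unfolding t by (rule anti)
  have "pair_prod ?th J = pos_sign J a * pos_sign (J - {a}) b * (?th a b * ((\<Prod>i\<in>K. ?th a i) * (\<Prod>i\<in>K. ?th b i))) * pair_prod ?th K"
    by (rule expand) (rule anti)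
  also have "\<dots> = - (pos_sign J a * pos_sign (J - {a}) b * (th a b * ((\<Prod>i\<in>K. th a i) * (\<Prod>i\<in>K. th b i))) * pair_prod th K)"
    unfolding 1 2 3 by (simp add: mult_ac)
  also have "\<dots> = - pair_prod th J" by (subst expand[of th, OF anti]) simp
  finally show ?thesis .
qed

lemma cauchy_coeff_transpose:
  assumes "finite J" "a \<in> J" "b \<in> J" "a \<noteq> b"
  shows "cauchy_coeff W u J (l \<circ> Transposition.transpose a b) = - cauchy_coeff W u J l"
proof -
  let ?t = "Transposition.transpose a b"
  have p: "?t permutes J" using assms by (intro permutes_swap_id)
  have "(\<Sum>i\<in>J. sg (l (?t i))) = (\<Sum>i\<in>J. sg (l i))"
    using sum.permute[OF p, of "\<lambda>i. sg (l i)"] by (simp add: comp_def)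
  then have "balanced (\<lambda>i. even ((l \<circ> ?t) i)) J \<longleftrightarrow> balanced (\<lambda>i. even (l i)) J"
    unfolding comp_def sum_sg_balanced[OF assms(1)] by simp
  moreover have "(\<Prod>i\<in>J. W ((l \<circ> ?t) i)) = (\<Prod>i\<in>J. W (l i))"
    using prod.permute[OF p, of "\<lambda>i. W (l i)"] by (simp add: comp_def)
  moreover have "pair_prod (cauchy_factor (\<lambda>i. even ((l \<circ> ?t) i)) (\<lambda>i. u ((l \<circ> ?t) i))) J =
      - pair_prod (cauchy_factor (\<lambda>i. even (l i)) (\<lambda>i. u (l i))) J"
    using pair_prod_transpose[OF assms, of "cauchy_factor (\<lambda>i. even (l i)) (\<lambda>i. u (l i))", OF cauchy_factor_anti]
    by (simp add: cauchy_factor_def[abs_def])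
  ultimately show ?thesis by (simp add: cauchy_coeff_def)
qed

section \<open>Schur expansion of antisymmetric series\<close>

text \<open>Alternating functions of exponent vectors of length \<open>n\<close>, encoded on total
  functions; hence the first condition that arguments from \<open>n\<close> on have no
  influence.\<close>

definition antisym_on :: "nat \<Rightarrow> ((nat \<Rightarrow> nat) \<Rightarrow> complex) \<Rightarrow> bool" where
  "antisym_on n c \<longleftrightarrow> (\<forall>l l'. (\<forall>i<n. l i = l' i) \<longrightarrow> c l = c l') \<and>
     (\<forall>l. \<forall>a<n. \<forall>b<n. a \<noteq> b \<longrightarrow> c (l \<circ> Transposition.transpose a b) = - c l)"

lemma antisym_on_cong: "antisym_on n c \<Longrightarrow> (\<And>i. i < n \<Longrightarrow> l i = l' i) \<Longrightarrow> c l = c l'"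
  by (auto simp: antisym_on_def)

lemma antisym_on_permute:
  assumes c: "antisym_on n c" and p: "p permutes {0..<n}"
  shows "c (l \<circ> p) = signof p * c l"
  using finite_atLeastLessThan p
proof (induction arbitrary: l rule: permutes_rev_induct)
  case (swap a b p)
  have "c (l \<circ> (p \<circ> Transposition.transpose a b)) = c ((l \<circ> p) \<circ> Transposition.transpose a b)"
    by (simp add: comp_assoc)
  also have "\<dots> = - c (l \<circ> p)" using c swap.hyps by (auto simp: antisym_on_def)
  also have "\<dots> = - (signof p * c l)" by (simp only: swap.IH)
  also have "sign (p \<circ> Transposition.transpose a b) = - sign p"
    using swap.hyps permutation_permutes[of p]
    by (subst sign_compose) (auto simp: sign_swap_id permutation_swap_id)
  then have "- (signof p * c l) = signof (p \<circ> Transposition.transpose a b) * c l" by simp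
  finally show ?case .
qed simp

lemma antisym_on_eq_0:
  assumes c: "antisym_on n c" and l: "\<not> inj_on l {..<n}"
  shows "c l = 0"
proof -
  obtain a b where ab: "a < n" "b < n" "a \<noteq> b" "l a = l b" using l by (auto simp: inj_on_def)
  have "l \<circ> Transposition.transpose a b = l" using ab by (auto simp: fun_eq_iff Transposition.transpose_def)
  moreover have "c (l \<circ> Transposition.transpose a b) = - c l" using c ab by (auto simp: antisym_on_def)
  ultimately show ?thesis by simp
qed

section \<open>Coefficients of alternants, and partitions from their beta numbers\<close>

lemma mcoeff_monomial:
  "finite A \<Longrightarrow> mcoeff (\<Prod>s\<in>A. mvar (f s)) m = (if (\<Sum>s\<in>A. Poly_Mapping.single (f s) 1) = m then 1 else 0 :: 'a::comm_ring_1)"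
proof (induction A arbitrary: m rule: finite_induct)
  case (insert s A)
  have "mcoeff (\<Prod>s\<in>insert s A. mvar (f s)) m = mcoeff (mvar (f s) * (\<Prod>s\<in>A. mvar (f s)) :: 'a mfps) m"
    using insert by simp
  also have "\<dots> = (if \<exists>b. Poly_Mapping.single (f s) 1 + b = m then 1 * mcoeff (\<Prod>s\<in>A. mvar (f s) :: 'a mfps) (m - Poly_Mapping.single (f s) 1) else 0)"
    by (rule mcoeff_single_times) (simp add: mcoeff_mvar)
  also have "\<dots> = (if (\<Sum>s\<in>insert s A. Poly_Mapping.single (f s) 1) = m then 1 else 0)"
    using insert by auto
  finally show ?case .
qed (auto simp: mcoeff_one)

lemma mcoeff_prod_powers:
  "mcoeff (\<Prod>i<n. mvar i ^ l i) m = (if keys m \<subseteq> {..<n} \<and> (\<forall>i<n. lookup m i = l i) then 1 else (0 :: 'a::comm_ring_1))"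
proof -
  have "mvar i ^ k = (univar i (\<lambda>j. if j = k then 1 else 0) :: 'a mfps)" for i k
  proof (induction k)
    case 0
    have "m = 0 \<longleftrightarrow> keys m \<subseteq> {i} \<and> lookup m i = 0" for m :: "nat \<Rightarrow>\<^sub>0 nat"
      by (auto simp: in_keys_iff intro!: poly_mapping_eqI)
    then show ?case by (intro mfps_eqI) (auto simp: mcoeff_one mcoeff_univar)
  next
    case (Suc k)
    show ?case
      unfolding power_Suc Suc
      by (rule mfps_eqI) (auto simp: mcoeff_mvar_times mcoeff_univar keys_minus_single lookup_minus lookup_single)
  qed
  then have *: "(\<Prod>i<n. mvar i ^ l i :: 'a mfps) = (\<Prod>i<n. univar i (\<lambda>j. if j = l i then 1 else 0))" by simp
  have "mcoeff (\<Prod>i<n. univar i (\<lambda>j. if j = l i then 1 else 0) :: 'a mfps) m =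
      (if keys m \<subseteq> {..<n} then \<Prod>i<n. if lookup m i = l i then 1 else 0 else 0)" for n m
  proof (induction n arbitrary: m)
    case (Suc n)
    let ?P = "\<Prod>i<n. univar i (\<lambda>j. if j = l i then 1 else 0) :: 'a mfps"
    have v: "vars_in {..<n} ?P"
      by (intro vars_in_prod) (auto intro: vars_in_mono[OF vars_in_univar])
    have "mcoeff (?P * univar n (\<lambda>j. if j = l n then 1 else 0)) m = (if keys m \<subseteq> {..<n} \<union> {n}
        then mcoeff ?P (mrestr {..<n} m) * mcoeff (univar n (\<lambda>j. if j = l n then 1 else 0)) (mrestr {n} m) else 0)"
      by (rule mcoeff_times_disjoint[OF v vars_in_univar]) auto
    moreover have "mcoeff ?P (mrestr {..<n} m) = (\<Prod>i<n. if lookup m i = l i then 1 else 0)"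
      unfolding Suc.IH by (auto simp: keys_mrestr lookup_mrestr intro!: prod.cong)
    moreover have "{..<n} \<union> {n} = {..<Suc n}" by auto
    ultimately show ?case by (simp add: mcoeff_univar keys_mrestr lookup_mrestr)
  qed (auto simp: mcoeff_one)
  moreover have "(\<Prod>i<n. if lookup m i = l i then 1 else 0) = (if \<forall>i<n. lookup m i = l i then 1 else (0 :: 'a))"
    by (induction n) (auto simp: less_Suc_eq)
  ultimately show ?thesis unfolding * by simp
qed

lemma mcoeff_alternant:
  "mcoeff (alternant mvar n l) m = (if keys m \<subseteq> {..<n}
     then \<Sum>p | p permutes {0..<n} \<and> (\<forall>i<n. lookup m i = l (p i)). signof p else (0 :: 'a::comm_ring_1))"
proof -
  have "alternant mvar n l = (\<Sum>p | p permutes {0..<n}. signof p * (\<Prod>i<n. mvar i ^ l (p i)) :: 'a mfps)"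
    unfolding alternant_def by (subst det_def'[of _ n]) (auto simp: lessThan_atLeast0 intro!: sum.cong prod.cong)
  moreover have s: "mcoeff (signof p * f) m = signof p * mcoeff f m" for p :: "nat \<Rightarrow> nat" and f :: "'a mfps"
    by (simp add: sign_def)
  ultimately have "mcoeff (alternant mvar n l) m = (\<Sum>p | p permutes {0..<n}.
      if keys m \<subseteq> {..<n} \<and> (\<forall>i<n. lookup m i = l (p i)) then signof p else (0 :: 'a))"
    by (simp add: mcoeff_prod_powers mult_delta_right if_distrib cong: if_cong)
  also have "\<dots> = (if keys m \<subseteq> {..<n}
     then \<Sum>p | p permutes {0..<n} \<and> (\<forall>i<n. lookup m i = l (p i)). signof p else (0 :: 'a))"
    by (auto simp: sum.inter_filter[symmetric] finite_permutations)
  finally show ?thesis .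
qed

lemma strictly_decreasing_unique:
  fixes f g :: "nat \<Rightarrow> nat"
  assumes f: "\<And>i j. i < j \<Longrightarrow> j < n \<Longrightarrow> f j < f i" and g: "\<And>i j. i < j \<Longrightarrow> j < n \<Longrightarrow> g j < g i"
    and image: "f ` {..<n} = g ` {..<n}" and i: "i < n"
  shows "f i = g i"
proof -
  have *: "sorted (rev (map h [0..<n])) \<and> distinct (rev (map h [0..<n]))"
    if h: "\<And>i j. i < j \<Longrightarrow> j < n \<Longrightarrow> h j < h i" for h :: "nat \<Rightarrow> nat"
  proof -
    have "sorted_wrt (>) (map h [0..<n])" using h by (simp add: sorted_wrt_iff_nth_less)
    then have "sorted_wrt (<) (rev (map h [0..<n]))" by (simp add: sorted_wrt_rev)
    then show ?thesis by (simp only: strict_sorted_iff)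
  qed
  have "rev (map f [0..<n]) = rev (map g [0..<n])"
    by (rule sorted_distinct_set_unique) (use * f g image in \<open>auto simp: lessThan_atLeast0\<close>)
  then have "map f [0..<n] = map g [0..<n]" by simp
  then show ?thesis using i by (simp add: map_eq_conv)
qed

lemma partition_eqI:
  assumes la: "is_partition la" "is_partition la'" and eq: "\<And>i. part la (Suc i) = part la' (Suc i)"
  shows "la = la'"
proof -
  have *: "i < length la \<longleftrightarrow> part la (Suc i) \<noteq> 0" if "is_partition la" for la i
    using that by (auto simp: part_def is_partition_def in_set_conv_nth)
  have "i < length la \<longleftrightarrow> i < length la'" for i using * la eq by simp
  then have "length la = length la'" by (metis less_irrefl linorder_neqE_nat)
  moreover have "la ! i = la' ! i" if "i < length la" for i
    using eq[of i] that calculation by (simp add: part_def)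
  ultimately show ?thesis by (intro nth_equalityI)
qed

text \<open>A strictly decreasing sequence dominates the staircase, l_i \<ge> n - 1 - i, so the
  staircase can be subtracted.\<close>

lemma partition_of_beta:
  assumes l: "\<And>i j. i < j \<Longrightarrow> j < n \<Longrightarrow> l j < (l i :: nat)"
  shows "\<exists>la. is_partition la \<and> length la \<le> n \<and> (\<forall>i<n. beta n la i = l i)"
proof -
  define mu where "mu i = l i - (n - 1 - i)" for i
  have ge: "k \<le> l (n - 1 - k)" if "k < n" for k
    using that
  proof (induction k)
    case (Suc k)
    then have "k \<le> l (n - 1 - k)" by simp
    moreover have "l (n - 1 - k) < l (n - 1 - Suc k)" using Suc.prems by (intro l) auto
    ultimately show ?case by simp
  qed simp
  have mu: "mu i + (n - 1 - i) = l i" if "i < n" for i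
    using ge[of "n - 1 - i"] that by (simp add: mu_def)
  have mono: "mu j \<le> mu i" if "i \<le> j" "j < n" for i j
    using that
  proof (induction j rule: dec_induct)
    case (step j)
    have "l (Suc j) < l j" using step by (intro l) auto
    then have "mu (Suc j) \<le> mu j" using mu[of j] mu[of "Suc j"] step by simp
    then show ?case using step by simp
  qed simp
  \<comment> \<open>Cutting at the first zero loses nothing since \<open>mu\<close> is weakly
    decreasing, and it removes the trailing zeros that a partition must not contain.\<close>
  define la where "la = takeWhile ((\<noteq>) 0) (map mu [0..<n])"
  have len: "length la \<le> n" unfolding la_def using length_takeWhile_le[of "(\<noteq>) 0" "map mu [0..<n]"] by simp
  have nth: "la ! i = mu i" if "i < length la" for i
    using takeWhile_nth[of i "(\<noteq>) 0" "map mu [0..<n]"] that len unfolding la_def[symmetric] by simp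
  have part: "part la (Suc i) = mu i" if "i < n" for i
  proof (cases "i < length la")
    case True
    then show ?thesis by (simp add: part_def nth)
  next
    case False
    then have "length la < n" using that by simp
    then have "mu (length la) = 0"
      using nth_length_takeWhile[of "(\<noteq>) 0" "map mu [0..<n]"] unfolding la_def[symmetric] by simp
    then have "mu i = 0" using mono[of "length la" i] False that by simp
    then show ?thesis using False by (simp add: part_def)
  qed
  have "0 \<notin> set la" unfolding la_def by (auto dest: set_takeWhileD)
  moreover have "sorted_wrt (\<ge>) la"
    using nth mono len by (simp add: sorted_wrt_iff_nth_less)
  ultimately have "is_partition la" by (simp add: is_partition_def)
  then show ?thesis using len part mu by (intro exI[of _ la]) (simp add: beta_def)
qed

lemma has_sum_finite_support:
  fixes f :: "'i \<Rightarrow> 'a::{comm_monoid_add, topological_space}"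
  assumes "finite F" "F \<subseteq> S" "\<And>x. x \<in> S - F \<Longrightarrow> f x = 0"
  shows "(f has_sum sum f F) S"
proof -
  have "(f has_sum sum f F) F" using assms(1) by (rule has_sum_finite)
  then show ?thesis using assms by (subst has_sum_cong_neutral[of F S f f]) auto
qed

text \<open>At most one partition contributes to a given monomial. If its exponents are distinct,
  sorting them gives the beta numbers of a unique partition, and the sign of the sorting permutation
  appears both in the alternant and in \<open>c\<close>. If two exponents agree, no alternant
  contains the monomial, and \<open>c\<close> vanishes there.\<close>

lemma alternant_expansion:
  assumes c: "antisym_on n c"
  shows "((\<lambda>la. c (beta n la) * mcoeff (alternant mvar n (beta n la)) m) has_sum
    (if keys m \<subseteq> {..<n} then c (lookup m) else 0)) {la. is_partition la \<and> length la \<le> n}"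
    (is "(?f has_sum _) ?S")
proof (cases "keys m \<subseteq> {..<n}")
  case False
  then show ?thesis by (simp add: mcoeff_alternant)
next
  case True
  define P where "P la = {p. p permutes {0..<n} \<and> (\<forall>i<n. lookup m i = beta n la (p i))}" for la
  have f: "?f la = c (beta n la) * (\<Sum>p\<in>P la. signof p)" for la
    using True by (simp add: mcoeff_alternant P_def)
  have image: "lookup m ` {..<n} = beta n la ` {..<n}" if "p \<in> P la" for p la
  proof -
    have p: "p permutes {..<n}" using that by (simp add: P_def lessThan_atLeast0)
    have "lookup m ` {..<n} = (\<lambda>i. beta n la (p i)) ` {..<n}" using that by (auto simp: P_def)
    also have "\<dots> = beta n la ` p ` {..<n}" by (simp add: image_image)
    finally show ?thesis by (simp add: permutes_image[OF p])
  qed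
  have beta_inj: "inj_on (beta n la) {..<n}" if "is_partition la" for la
    using beta_less[OF that, of _ _ n]
    by (intro linorder_inj_onI) (auto dest: less_not_refl2 intro: less_imp_neq not_sym)
  show ?thesis
  proof (cases "inj_on (lookup m) {..<n}")
    case False
    have "P la = {}" if la: "is_partition la" for la
    proof (rule ccontr)
      assume "P la \<noteq> {}"
      then obtain p where "p \<in> P la" by blast
      from image[OF this] have "card (lookup m ` {..<n}) = n"
        using card_image[OF beta_inj[OF la]] by simp
      then show False using False by (simp add: eq_card_imp_inj_on)
    qed
    then have "?f la = 0" if "la \<in> ?S" for la using that unfolding f by simp
    then have "(?f has_sum 0) ?S" by (rule has_sum_0)
    moreover have "c (lookup m) = 0" by (rule antisym_on_eq_0[OF c False])
    ultimately show ?thesis using True by simp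
  next
    case inj: True
    define A where "A = lookup m ` {..<n}"
    have A: "finite A" "card A = n" using inj by (simp_all add: A_def card_image)
    define xs where "xs = rev (sorted_list_of_set A)"
    have xs: "length xs = n" "set xs = A" "sorted_wrt (>) xs"
      using A by (auto simp: xs_def sorted_wrt_rev)
    have dec: "xs ! j < xs ! i" if "i < j" "j < n" for i j
      using xs that by (simp add: sorted_wrt_iff_nth_less)
    obtain la0 where la0: "is_partition la0" "length la0 \<le> n" "\<And>i. i < n \<Longrightarrow> beta n la0 i = xs ! i"
      using partition_of_beta[of n "nth xs"] dec by blast
    have im0: "beta n la0 ` {..<n} = A"
    proof -
      have "beta n la0 ` {..<n} = nth xs ` {..<n}" using la0(3) by auto
      also have "\<dots> = set xs" using xs(1) by (auto simp: set_conv_nth)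
      finally show ?thesis using xs(2) by simp
    qed
    define p0 where "p0 i = (if i < n then inv_into {..<n} (beta n la0) (lookup m i) else i)" for i
    have bp: "beta n la0 (p0 i) = lookup m i" "p0 i < n" if "i < n" for i
    proof -
      have mem: "lookup m i \<in> beta n la0 ` {..<n}" unfolding im0 A_def using that by simp
      show "beta n la0 (p0 i) = lookup m i" "p0 i < n"
        using f_inv_into_f[OF mem] inv_into_into[OF mem] that by (simp_all add: p0_def)
    qed
    have "inj_on p0 {0..<n}"
    proof (rule inj_onI)
      fix i j assume "i \<in> {0..<n}" "j \<in> {0..<n}" "p0 i = p0 j"
      then have "lookup m i = lookup m j" "i < n" "j < n" using bp(1)[of i] bp(1)[of j] by auto
      then show "i = j" using inj by (auto simp: inj_on_def)
    qed
    moreover have "p0 ` {0..<n} \<subseteq> {0..<n}" using bp(2) by auto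
    ultimately have "p0 ` {0..<n} = {0..<n}" by (intro endo_inj_surj) auto
    then have "bij_betw p0 {0..<n} {0..<n}" using \<open>inj_on p0 {0..<n}\<close> by (simp add: bij_betw_def)
    then have p0: "p0 permutes {0..<n}" by (rule bij_imp_permutes) (simp add: p0_def)
    have P0: "P la0 = {p0}"
    proof
      show "{p0} \<subseteq> P la0" using p0 bp by (simp add: P_def)
      show "P la0 \<subseteq> {p0}"
      proof
        fix p assume p: "p \<in> P la0"
        have "p i = p0 i" for i
        proof (cases "i < n")
          case True
          have "p i < n" using p True permutes_in_image[of p "{0..<n}" i] by (simp add: P_def)
          moreover have "beta n la0 (p i) = beta n la0 (p0 i)" using p bp[OF True] True by (simp add: P_def)
          ultimately show ?thesis using beta_inj[OF la0(1)] bp(2)[OF True] by (auto simp: inj_on_def)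
        next
          case False
          have "p permutes {0..<n}" using p by (simp add: P_def)
          then have "p i = i" using False by (intro permutes_not_in) auto
          then show ?thesis using False by (simp add: p0_def)
        qed
        then show "p \<in> {p0}" by (simp add: fun_eq_iff)
      qed
    qed
    have other: "?f la = 0" if la: "la \<in> ?S - {la0}" for la
    proof (rule ccontr)
      assume "?f la \<noteq> 0"
      then obtain p where "p \<in> P la" unfolding f by fastforce
      then have im: "beta n la ` {..<n} = beta n la0 ` {..<n}" using image im0 A_def by metis
      have eq: "beta n la i = beta n la0 i" if "i < n" for i
        by (rule strictly_decreasing_unique[OF beta_less beta_less im that]) (use la la0(1) in auto)
      have "part la (Suc i) = part la0 (Suc i)" for i
      proof (cases "i < n")
        case True
        then show ?thesis using eq[OF True] unfolding beta_def by linarith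
      next
        case False
        then show ?thesis using part_beyond[of la "Suc i"] part_beyond[of la0 "Suc i"] la la0(2) by simp
      qed
      then have "la = la0" using la la0(1) by (intro partition_eqI) auto
      then show False using la by simp
    qed
    have "(?f has_sum sum ?f {la0}) ?S"
      by (rule has_sum_finite_support) (use la0 other in auto)
    moreover have "sum ?f {la0} = c (lookup m)"
    proof -
      have "c (lookup m) = c (beta n la0 \<circ> p0)" by (rule antisym_on_cong[OF c]) (simp add: bp)
      also have "\<dots> = signof p0 * c (beta n la0)" by (rule antisym_on_permute[OF c p0])
      finally show ?thesis by (simp add: f P0)
    qed
    ultimately show ?thesis using True by simp
  qed
qed

section \<open>Schur functions restricted to finitely many variables\<close>

lemma lookup_content:
  "lookup (Defs.content la T) k = card {s \<in> diagram la. T s = k}"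
proof -
  have "lookup (Defs.content la T) k = (\<Sum>s\<in>diagram la. if T s = k then 1 else 0)"
    unfolding Defs.content_def lookup_sum by (rule sum.cong) (auto simp: lookup_single when_def)
  also have "\<dots> = card {s \<in> diagram la. T s = k}"
    using finite_diagram[of la] by (simp add: sum.If_cases Int_def)
  finally show ?thesis .
qed

lemma keys_content: "keys (Defs.content la T) = T ` diagram la"
proof (intro Set.set_eqI)
  fix k
  show "k \<in> keys (Defs.content la T) \<longleftrightarrow> k \<in> T ` diagram la"
    using finite_diagram[of la] by (auto simp: in_keys_iff lookup_content card_gt_0_iff)
qed

lemma mtrunc_schur:
  "mtrunc {..<n} (schur la) = (schur_poly n (part la) :: 'a::comm_ring_1 mfps)"
proof (rule mfps_eqI)
  fix m :: "nat \<Rightarrow>\<^sub>0 nat"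
  let ?T = "tableaux n (part la)"
  have T: "T \<in> ?T \<longleftrightarrow> T \<in> ssyt la \<and> keys (Defs.content la T) \<subseteq> {..<n}" for T
    unfolding keys_content by (auto simp: tableaux_def ssyt_def diagram_eq)
  have "finite ?T"
    by (rule finite_subset[of _ "diagram la \<rightarrow>\<^sub>E {..<n}"])
      (auto simp: T ssyt_def keys_content PiE_iff extensional_def image_subset_iff intro!: finite_PiE finite_diagram)
  then have "mcoeff (schur_poly n (part la) :: 'a mfps) m = of_nat (card {T \<in> ?T. Defs.content la T = m})"
    unfolding schur_poly_def diagram_eq[symmetric] mcoeff_sum mcoeff_monomial[OF finite_diagram] Defs.content_def[symmetric]
    by (simp add: sum.If_cases Int_def)
  also have "{T \<in> ?T. Defs.content la T = m} = (if keys m \<subseteq> {..<n} then {T \<in> ssyt la. Defs.content la T = m} else {})"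
    using T by auto
  finally show "mcoeff (mtrunc {..<n} (schur la)) m = mcoeff (schur_poly n (part la) :: 'a mfps) m"
    by (simp add: mcoeff_mtrunc schur_def)
qed

lemma partition_nth_nonzero: "is_partition la \<Longrightarrow> i < length la \<Longrightarrow> la ! i \<noteq> 0"
  unfolding is_partition_def by (metis nth_mem)

text \<open>The first column would have more than \<open>n\<close> cells with strictly increasing
  entries below \<open>n\<close>.\<close>

lemma schur_poly_eq_0:
  assumes "is_partition la" "n < length la"
  shows "schur_poly n (part la) = 0"
proof -
  have "la ! n \<noteq> 0" using assms by (rule partition_nth_nonzero)
  then have s: "(Suc n, 1) \<in> row_diagram (part la)"
    using assms(2) by (simp add: row_diagram_iff part_def Suc_le_eq)
  have "T \<notin> tableaux n (part la)" for T
  proof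
    assume T: "T \<in> tableaux n (part la)"
    have "Suc n \<le> Suc (T (Suc n, 1))" by (rule tableaux_column[OF row_shape_part[OF assms(1)] T s])
    moreover have "T (Suc n, 1) < n" using T s unfolding tableaux_def by blast
    ultimately show False by simp
  qed
  then have "tableaux n (part la) = {}" by blast
  then show ?thesis by (simp add: schur_poly_def)
qed

text \<open>A tableau of content m has as many cells as the degree of m, and there are finitely many
  partitions of that size. This makes every sum over Schur functions finite in each
  coefficient.\<close>

lemma finite_schur_support:
  "finite {la. is_partition la \<and> mcoeff (schur la) m \<noteq> (0 :: 'a::comm_ring_1)}"
proof (rule finite_subset)
  define d where "d = (\<Sum>k\<in>keys m. lookup m k)"
  show "finite {xs :: nat list. set xs \<subseteq> {..d} \<and> length xs \<le> d}"
    by (rule finite_lists_length_le) simp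
  show "{la. is_partition la \<and> mcoeff (schur la) m \<noteq> (0 :: 'a)} \<subseteq> {xs. set xs \<subseteq> {..d} \<and> length xs \<le> d}"
  proof clarify
    fix la assume la: "is_partition la" "mcoeff (schur la) m \<noteq> (0 :: 'a)"
    have "{T \<in> ssyt la. Defs.content la T = m} \<noteq> {}"
    proof
      assume "{T \<in> ssyt la. Defs.content la T = m} = {}"
      then have "mcoeff (schur la :: 'a mfps) m = of_nat (card ({} :: (nat \<times> nat \<Rightarrow> nat) set))"
        unfolding schur_def mcoeff_Abs by (simp only:)
      then show False using la by simp
    qed
    then obtain T where T: "Defs.content la T = m" by blast
    have d: "d = card (diagram la)"
    proof -
      have "d = (\<Sum>k\<in>T ` diagram la. card {s \<in> diagram la. T s = k})"
        unfolding d_def T[symmetric] keys_content lookup_content ..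
      also have "\<dots> = card (diagram la)"
        using sum.image_gen[OF finite_diagram, of "\<lambda>_. 1::nat" la T] by simp
      finally show ?thesis .
    qed
    have "x \<le> d" if x: "x \<in> set la" for x
    proof -
      obtain i where i: "i < length la" "x = la ! i" using x by (auto simp: in_set_conv_nth)
      have "(\<lambda>j. (Suc i, j)) ` {1..x} \<subseteq> diagram la" using i by (auto simp: diagram_def part_def)
      then have "card ((\<lambda>j. (Suc i, j)) ` {1..x}) \<le> d" unfolding d by (rule card_mono[OF finite_diagram])
      then show ?thesis by (simp add: card_image inj_on_def)
    qed
    moreover have "length la \<le> d"
    proof -
      have "(\<lambda>i. (i, 1)) ` {1..length la} \<subseteq> diagram la"
      proof clarify
        fix i assume i: "i \<in> {1..length la}"
        then have "la ! (i - 1) \<noteq> 0" using la(1) by (intro partition_nth_nonzero) auto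
        then show "(i, 1) \<in> diagram la" using i by (auto simp: diagram_def part_def)
      qed
      then have "card ((\<lambda>i. (i, 1::nat)) ` {1..length la}) \<le> d" unfolding d by (rule card_mono[OF finite_diagram])
      then show ?thesis by (simp add: card_image inj_on_def)
    qed
    ultimately show "set la \<subseteq> {..d} \<and> length la \<le> d" by auto
  qed
qed

lemma vandermonde_nonzero: "vandermonde n \<noteq> (0 :: 'a::idom mfps)"
proof -
  have "mvar i - mvar j \<noteq> (0 :: 'a mfps)" if "i < j" for i j
    using mvar_inj[of i j, where 'a = 'a] that by auto
  then have "(case p of (i, j) \<Rightarrow> mvar i - mvar j) \<noteq> (0 :: 'a mfps)" if "p \<in> pairs {..<n}" for p
    using that by (auto simp: pairs_def)
  then show ?thesis
    unfolding vandermonde_def pair_prod_def using prod_zero_iff[OF finite_pairs[OF finite_lessThan]] by blast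
qed

text \<open>The series has a sum \<open>L\<close> since each coefficient is a finite sum. For even
  \<open>n\<close>, truncating \<open>L\<close> and multiplying by the Vandermonde product turns
  Schur functions into alternants, so \<open>alternant_expansion\<close> evaluates all coefficients;
  the Vandermonde product is then cancelled. Truncations to 2n variables determine a series.\<close>

lemma schur_expansion:
  fixes g :: "nat \<Rightarrow> complex" and c :: "nat list \<Rightarrow> complex"
  assumes g: "g 0 = 1"
    and antisym: "\<And>n. even n \<Longrightarrow> antisym_on n (C n)"
    and coeff: "\<And>n m. even n \<Longrightarrow> mcoeff ((\<Prod>i<n. univar i g) * pair_prod antisym_factor {..<n}) m =
      (if keys m \<subseteq> {..<n} then C n (lookup m) else 0)"
    and beta: "\<And>n la. even n \<Longrightarrow> is_partition la \<Longrightarrow> length la \<le> n \<Longrightarrow>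
      C n (beta n la) = (if empty_2core la then c la else 0)"
  shows "((\<lambda>la. mconst (c la) * schur la) has_sum
     (prodinf (\<lambda>i. univar i g) * infprod (\<lambda>(i, j). 1 / (1 - mvar i * mvar j)) {(i, j). i < j}))
     {la. is_partition la \<and> empty_2core la}"
    (is "(?f has_sum ?R) ?S")
proof -
  define F where "F m = {la. is_partition la \<and> mcoeff (schur la) m \<noteq> (0 :: complex)} \<inter> ?S" for m
  define L where "L = Abs_mfps (\<lambda>m. \<Sum>la\<in>F m. mcoeff (?f la) m)"
  have L: "(?f has_sum L) ?S"
    unfolding has_sum_mfps_iff L_def mcoeff_Abs
    by (intro allI has_sum_finite_support) (auto simp: F_def finite_schur_support)
  have "mtrunc {..<n} L = mtrunc {..<n} ?R" if n: "even n" for n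
  proof -
    let ?V = "vandermonde n :: complex mfps"
    have "((\<lambda>la. mtrunc {..<n} (?f la)) has_sum mtrunc {..<n} L) ?S"
      using L unfolding has_sum_mfps_iff mcoeff_mtrunc by (auto simp: has_sum_0)
    then have L_V: "((\<lambda>la. mtrunc {..<n} (?f la) * ?V) has_sum mtrunc {..<n} L * ?V) ?S"
      by (rule has_sum_mult_mfps)
    have "mtrunc {..<n} L * ?V = (\<Prod>i<n. univar i g) * pair_prod antisym_factor {..<n}"
    proof (rule mfps_eqI)
      fix m
      have 1: "((\<lambda>la. mcoeff (mtrunc {..<n} (?f la) * ?V) m) has_sum mcoeff (mtrunc {..<n} L * ?V) m) ?S"
        using L_V unfolding has_sum_mfps_iff by blast
      have summand: "mcoeff (mtrunc {..<n} (?f la) * ?V) m =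
          c la * mcoeff (schur_poly n (part la) * ?V) m" for la
      proof -
        have "mtrunc {..<n} (mconst (c la)) = mconst (c la)"
          by (rule mtrunc_ident) (auto simp: vars_in_def mcoeff_mconst split: if_splits)
        then show ?thesis by (simp add: mtrunc_times mtrunc_schur mult.assoc)
      qed
      have bialternant: "schur_poly n (part la) * ?V = alternant mvar n (beta n la)"
        if "is_partition la" "length la \<le> n" for la
        unfolding beta_def using that
        by (intro schur_poly_vandermonde row_shape_part part_beyond) auto
      have "((\<lambda>la. C n (beta n la) * mcoeff (alternant mvar n (beta n la)) m) has_sum
        (if keys m \<subseteq> {..<n} then C n (lookup m) else 0)) {la. is_partition la \<and> length la \<le> n}"
        by (rule alternant_expansion[OF antisym[OF n]])
      then have 2: "((\<lambda>la. mcoeff (mtrunc {..<n} (?f la) * ?V) m) has_sum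
        (if keys m \<subseteq> {..<n} then C n (lookup m) else 0)) ?S"
      \<comment> \<open>The two index sets differ only in zero terms: \<open>beta\<close> gives 0
        for a nonempty 2-core, and Schur polynomials with more than \<open>n\<close> rows
        vanish.\<close>
      proof (subst has_sum_cong_neutral)
        fix la assume "la \<in> {la. is_partition la \<and> length la \<le> n} - ?S"
        then show "C n (beta n la) * mcoeff (alternant mvar n (beta n la)) m = 0" using beta[OF n] by auto
      next
        fix la assume "la \<in> ?S - {la. is_partition la \<and> length la \<le> n}"
        then show "mcoeff (mtrunc {..<n} (?f la) * ?V) m = 0"
          unfolding summand by (auto simp: schur_poly_eq_0)
      next
        fix la assume "la \<in> ?S \<inter> {la. is_partition la \<and> length la \<le> n}"
        then show "mcoeff (mtrunc {..<n} (?f la) * ?V) m = C n (beta n la) * mcoeff (alternant mvar n (beta n la)) m"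
          unfolding summand using beta[OF n, of la] by (auto simp: bialternant)
      qed
      show "mcoeff (mtrunc {..<n} L * ?V) m = mcoeff ((\<Prod>i<n. univar i g) * pair_prod antisym_factor {..<n}) m"
        unfolding coeff[OF n] by (rule has_sum_unique[OF 1 2])
    qed
    also have "\<dots> = mtrunc {..<n} ?R * ?V" by (rule truncated_product[where g = g, OF g, symmetric])
    finally show ?thesis using vandermonde_nonzero[of n, where 'a = complex] by simp
  qed
  then have trunc: "mtrunc {..<2 * n} L = mtrunc {..<2 * n} ?R" for n by simp
  have "L = ?R"
  proof (rule mfps_eqI)
    fix m :: "nat \<Rightarrow>\<^sub>0 nat"
    obtain n where "keys m \<subseteq> {..<n}" by (meson finite_keys finite_nat_iff_bounded)
    then have "keys m \<subseteq> {..<2 * n}" by auto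
    then show "mcoeff L m = mcoeff ?R m"
      using arg_cong[OF trunc[of n], of "\<lambda>f. mcoeff f m"] by (simp add: mcoeff_mtrunc)
  qed
  then show ?thesis using L by simp
qed

section \<open>Hook quotients and the limit at zero\<close>

definition hook_quotient :: "complex \<Rightarrow> nat list \<Rightarrow> complex" where
  "hook_quotient q la = (\<Prod>h\<in>#odd_hook_lengths la. 1 - q ^ h) / (\<Prod>h\<in>#even_hook_lengths la. 1 - q ^ h)"

lemma cauchy_coeff_hook_quotient:
  fixes q :: complex
  assumes q: "q \<noteq> 0" "norm q < 1" and la: "is_partition la" and n: "length la \<le> n" "even n"
    and b: "(\<Sum>i<n. sg (beta n la i)) = 0 \<Longrightarrow> b = (\<Sum>i<n. int (w (beta n la i))) + pair_stat n (beta n la)"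
  shows "cauchy_coeff (\<lambda>l. q ^ w l * hook_fact q l) (\<lambda>l. q ^ l) {..<n} (beta n la) =
    (if empty_2core la then q powi b * hook_quotient q la else 0)"
proof (cases "empty_2core la")
  case True
  then have bal: "balanced (\<lambda>i. even (beta n la i)) {..<n}"
    using empty_2core_iff_balanced[OF la n] by simp
  then have "(\<Sum>i<n. sg (beta n la i)) = 0" by (simp add: sum_sg_balanced)
  have "q ^ h \<noteq> 1" if "h \<ge> 1" for h using power_inj_norm[OF q, of h 0] that by simp
  then show ?thesis
    using True cauchy_coeff_beta[OF q(1) _ la n(1) bal, of w] b[OF \<open>(\<Sum>i<n. sg (beta n la i)) = 0\<close>]
    by (simp add: hook_quotient_def hook_ratio)
next
  case False
  then show ?thesis using empty_2core_iff_balanced[OF la n] by (simp add: cauchy_coeff_def)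
qed

lemma isCont_mcoeff_times:
  fixes f g :: "complex \<Rightarrow> complex mfps"
  assumes "\<And>m. isCont (\<lambda>q. mcoeff (f q) m) x" "\<And>m. isCont (\<lambda>q. mcoeff (g q) m) x"
  shows "isCont (\<lambda>q. mcoeff (f q * g q) m) x"
  unfolding mcoeff_times case_prod_unfold using assms by (intro continuous_intros) auto

lemma isCont_mcoeff_prod:
  fixes f :: "'i \<Rightarrow> complex \<Rightarrow> complex mfps"
  assumes "\<And>i m. i \<in> I \<Longrightarrow> isCont (\<lambda>q. mcoeff (f i q) m) x"
  shows "isCont (\<lambda>q. mcoeff (\<Prod>i\<in>I. f i q) m) x"
  using assms
proof (induction I arbitrary: m rule: infinite_finite_induct)
  case (insert i I)
  then show ?case by (simp add: isCont_mcoeff_times)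
qed auto

lemma isCont_mcoeff_univar:
  assumes "\<And>l. isCont (\<lambda>q. g q l) x"
  shows "isCont (\<lambda>q. mcoeff (univar i (g q)) m) x"
  unfolding mcoeff_univar using assms by (cases "keys m \<subseteq> {i}") simp_all

lemma isCont_qbinom_coeff: "isCont (\<lambda>q :: complex. qbinom_coeff q n) 0"
proof (induction n)
  case (Suc n)
  have "(0 :: complex) ^ (2 * n + 2) \<noteq> 1" by simp
  then show ?case unfolding qbinom_coeff.simps using Suc by (intro continuous_intros) auto
qed simp

lemma hook_pos: "h \<in># hook_lengths la \<Longrightarrow> h \<noteq> 0"
  by (auto simp: hook_lengths_def hook_def)

lemma isCont_hook_quotient: "isCont (\<lambda>q. hook_quotient q la) 0" and hook_quotient_0: "hook_quotient 0 la = 1"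
proof -
  have *: "isCont (\<lambda>q :: complex. \<Prod>h\<in>#M. 1 - q ^ h) 0 \<and> (\<Prod>h\<in>#M. 1 - (0 :: complex) ^ h) = 1"
    if "\<And>h. h \<in># M \<Longrightarrow> h \<noteq> 0" for M :: "nat multiset"
    using that
  proof (induction M)
    case (add h M)
    then show ?case by (simp add: power_0_left)
  qed simp
  have odd: "h \<noteq> 0" if "h \<in># odd_hook_lengths la" for h using that hook_pos by (auto simp: odd_hook_lengths_def)
  have even: "h \<noteq> 0" if "h \<in># even_hook_lengths la" for h using that hook_pos by (auto simp: even_hook_lengths_def)
  show "isCont (\<lambda>q. hook_quotient q la) 0" "hook_quotient 0 la = 1"
    unfolding hook_quotient_def using *[OF odd] *[OF even] by (simp_all add: continuous_divide)
qed

text \<open>The case \<open>q = 0\<close> is obtained as a limit. Since \<open>0 powi b = 0\<close> also for negative \<open>b\<close>, this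
  uses that \<open>b\<close> cannot be negative, as the limit of \<open>q powi b\<close> exists.\<close>

lemma powi_limit:
  fixes f h :: "complex \<Rightarrow> complex"
  assumes f: "isCont f 0" and h: "isCont h 0" "h 0 = 1"
    and eq: "\<And>q. q \<noteq> 0 \<Longrightarrow> norm q < 1 \<Longrightarrow> f q = q powi b * h q"
  shows "f 0 = 0 powi b * h 0"
proof -
  have ev: "eventually (\<lambda>q :: complex. q \<noteq> 0 \<and> norm q < 1) (at 0)"
    unfolding eventually_at by (intro exI[of _ 1]) auto
  have f0: "(f \<longlongrightarrow> f 0) (at 0)" and h0: "(h \<longlongrightarrow> 1) (at 0)" using f h by (simp_all add: isCont_def)
  show ?thesis
  proof (cases "b \<ge> 0")
    case True
    define k where "k = nat b"
    have b: "b = int k" using True by (simp add: k_def)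
    have "((\<lambda>q. q ^ k * h q) \<longlongrightarrow> 0 ^ k * 1) (at 0)"
      by (intro tendsto_mult h0 tendsto_power tendsto_ident_at)
    moreover have "eventually (\<lambda>q. q ^ k * h q = f q) (at 0)"
      using ev by (rule eventually_mono) (simp add: eq b)
    ultimately have "(f \<longlongrightarrow> 0 ^ k * 1) (at 0)" by (rule Lim_transform_eventually)
    then show ?thesis using f0 h(2) tendsto_unique[of "at (0::complex)" f] by (simp add: b)
  next
    case False
    define k where "k = nat (- b)"
    have b: "b = - int k" "k > 0" using False by (simp_all add: k_def)
    have "((\<lambda>q. f q * q ^ k) \<longlongrightarrow> f 0 * 0 ^ k) (at 0)"
      by (intro tendsto_mult f0 tendsto_power tendsto_ident_at)
    moreover have "eventually (\<lambda>q. f q * q ^ k = h q) (at 0)"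
      using ev by (rule eventually_mono) (simp add: eq b power_int_minus)
    ultimately have "(h \<longlongrightarrow> f 0 * 0 ^ k) (at 0)" by (rule Lim_transform_eventually)
    then have "1 = f 0 * 0 ^ k" by (intro tendsto_unique[OF _ h0]) simp_all
    then show ?thesis by (simp add: zero_power[OF b(2)])
  qed
qed

section \<open>Both identities from their two-variable recurrences\<close>

definition monomial :: "nat \<Rightarrow> (nat \<Rightarrow> nat) \<Rightarrow> (nat \<Rightarrow>\<^sub>0 nat)" where
  "monomial n l = (\<Sum>i<n. Poly_Mapping.single i (l i))"

lemma lookup_monomial: "lookup (monomial n l) k = (if k < n then l k else 0)"
  unfolding monomial_def lookup_sum lookup_single when_def by (simp add: sum.delta')

lemma keys_monomial: "keys (monomial n l) \<subseteq> {..<n}"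
  by (auto simp: in_keys_iff lookup_monomial split: if_splits)

lemma monomial_lookup: "keys m \<subseteq> {..<n} \<Longrightarrow> monomial n (lookup m) = m"
  by (rule poly_mapping_eqI) (auto simp: lookup_monomial in_keys_iff)

text \<open>The part common to both identities: \<open>w\<close> is the weight in the formula for b
  by beta numbers, and \<open>A q\<close> lists the coefficients of the quotient of q-products in
  x_i^2. For q \<noteq> 0 the coefficients are given by \<open>mcoeff_antisym_product\<close>;
  antisymmetry and the values at beta numbers pass to q = 0 as limits.\<close>

lemma littlewood_identity_of_recurrence:
  fixes A :: "complex \<Rightarrow> nat \<Rightarrow> complex" and w :: "nat \<Rightarrow> nat" and b :: "nat list \<Rightarrow> int"
  assumes q: "norm q < 1"
    and A: "\<And>q. A q 0 = 1" "\<And>l. isCont (\<lambda>q. A q l) 0"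
    and rec: "\<And>q a b. q \<noteq> 0 \<Longrightarrow> norm q < 1 \<Longrightarrow>
      cauchy_entry (\<lambda>l. q ^ w l * hook_fact q l) (\<lambda>l. q ^ l) a b -
      (if a = 0 \<or> b = 0 then 0 else cauchy_entry (\<lambda>l. q ^ w l * hook_fact q l) (\<lambda>l. q ^ l) (a - 1) (b - 1)) =
      (if a = 0 then 0 else even_series (A q) (a - 1) * even_series (A q) b) -
      (if b = 0 then 0 else even_series (A q) a * even_series (A q) (b - 1))"
    and b: "\<And>n la. is_partition la \<Longrightarrow> length la \<le> n \<Longrightarrow> (\<Sum>i<n. sg (beta n la i)) = 0 \<Longrightarrow>
      b la = (\<Sum>i<n. int (w (beta n la i))) + pair_stat n (beta n la)"
  shows "((\<lambda>la. mconst (q powi b la * hook_quotient q la) * schur la) has_sum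
     (prodinf (\<lambda>i. univar i (even_series (A q))) * infprod (\<lambda>(i, j). 1 / (1 - mvar i * mvar j)) {(i, j). i < j}))
     {la. is_partition la \<and> empty_2core la}"
proof -
  define G where "G q n = (\<Prod>i<n. univar i (even_series (A q))) * pair_prod antisym_factor {..<n}" for q n
  \<comment> \<open>Taken from the product itself and not from \<open>cauchy_coeff\<close>: these
    coefficients are continuous at q = 0, where the values 0^l no longer separate even from odd
    exponents.\<close>
  define C where "C q n l = mcoeff (G q n) (monomial n l)" for q n l
  have G_vars: "vars_in {..<n} (G q n)" for q n
    unfolding G_def pair_prod_def
    by (intro vars_in_times vars_in_prod)
      (auto simp: pairs_def intro: vars_in_mono[OF vars_in_univar] vars_in_mono[OF vars_in_antisym_factor])
  have coeff: "mcoeff (G q n) m = (if keys m \<subseteq> {..<n} then C q n (lookup m) else 0)" for q n m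
    using vars_inD[OF G_vars] by (simp add: C_def monomial_lookup)
  have C: "C q n l = cauchy_coeff (\<lambda>l. q ^ w l * hook_fact q l) (\<lambda>l. q ^ l) {..<n} l"
    if q: "q \<noteq> 0" "norm q < 1" and n: "even n" for q n l
  proof -
    have "mcoeff (G q n) (monomial n l) = (if keys (monomial n l) \<subseteq> {..<n}
        then cauchy_coeff (\<lambda>l. q ^ w l * hook_fact q l) (\<lambda>l. q ^ l) {..<n} (lookup (monomial n l)) else 0)"
      unfolding G_def
    proof (rule mcoeff_antisym_product)
      show "q ^ a \<noteq> q ^ b" if "even a \<noteq> even b" for a b
        using that by (intro power_inj_norm[OF q]) auto
    qed (use rec[OF q] n in simp_all)
    then show ?thesis
      using keys_monomial by (auto simp: C_def lookup_monomial intro: cauchy_coeff_cong)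
  qed
  have "isCont (\<lambda>q. even_series (A q) l) 0" for l
    using A(2) by (cases "even l") (simp_all add: even_series_def)
  then have cont: "isCont (\<lambda>q. C q n l) 0" for n l
    unfolding C_def G_def
    by (intro isCont_mcoeff_times isCont_mcoeff_prod isCont_mcoeff_univar) simp_all
  have lim: "((\<lambda>q. C q n l) \<longlongrightarrow> C 0 n l) (at 0)" for n l using cont by (simp add: isCont_def)
  have ev: "eventually (\<lambda>q :: complex. q \<noteq> 0 \<and> norm q < 1) (at 0)"
    unfolding eventually_at by (intro exI[of _ 1]) auto
  have antisym: "antisym_on n (C q n)" if n: "even n" for n
    unfolding antisym_on_def
  proof (intro conjI allI impI)
    fix l l' :: "nat \<Rightarrow> nat" assume "\<forall>i<n. l i = l' i"
    then have "monomial n l = monomial n l'" unfolding monomial_def by simp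
    then show "C q n l = C q n l'" by (simp add: C_def)
  next
    fix l :: "nat \<Rightarrow> nat" and a b assume ab: "a < n" "b < n" "a \<noteq> b"
    let ?l = "l \<circ> Transposition.transpose a b"
    have nz: "C q n ?l = - C q n l" if "q \<noteq> 0" "norm q < 1" for q
      unfolding C[OF that n] using ab by (intro cauchy_coeff_transpose) auto
    show "C q n ?l = - C q n l"
    proof (cases "q = 0")
      case True
      have "eventually (\<lambda>q. - C q n l = C q n ?l) (at 0)"
        using ev by (rule eventually_mono) (simp add: nz)
      then have "((\<lambda>q. C q n ?l) \<longlongrightarrow> - C 0 n l) (at 0)"
        using tendsto_minus[OF lim] by (rule Lim_transform_eventually[rotated])
      then show ?thesis using tendsto_unique[OF _ lim, of n ?l] True by simp
    qed (use nz q in blast)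
  qed
  have beta: "C q n (beta n la) = (if empty_2core la then q powi b la * hook_quotient q la else 0)"
    if n: "even n" and la: "is_partition la" "length la \<le> n" for n la
  proof -
    have nz: "C q n (beta n la) = (if empty_2core la then q powi b la * hook_quotient q la else 0)"
      if "q \<noteq> 0" "norm q < 1" for q
      unfolding C[OF that n] by (rule cauchy_coeff_hook_quotient[OF that la n b[OF la]])
    show ?thesis
    proof (cases "q = 0")
      case True
      show ?thesis
      proof (cases "empty_2core la")
        case core: True
        have "C 0 n (beta n la) = 0 powi b la * hook_quotient 0 la"
          by (rule powi_limit[OF cont isCont_hook_quotient hook_quotient_0]) (use nz core in auto)
        then show ?thesis using True core by simp
      next
        case False
        have "eventually (\<lambda>q. 0 = C q n (beta n la)) (at 0)"
          using ev by (rule eventually_mono) (use nz False in simp)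
        then have "((\<lambda>q. C q n (beta n la)) \<longlongrightarrow> 0) (at 0)"
          using tendsto_const by (rule Lim_transform_eventually[rotated])
        then show ?thesis using tendsto_unique[OF _ lim, of n "beta n la"] True False by simp
      qed
    qed (use nz q in blast)
  qed
  show ?thesis
    by (rule schur_expansion[where C = "C q"])
      (use A(1) antisym beta coeff[of q, unfolded G_def] in \<open>auto simp: even_series_def\<close>)
qed

theorem theorem1p1:
  fixes q :: complex
  assumes "norm q < 1"
  shows
    "((\<lambda>la. mconst (q powi b_stat la *
          ((\<Prod>h\<in>#odd_hook_lengths la. 1 - q ^ h) / (\<Prod>h\<in>#even_hook_lengths la. 1 - q ^ h)))
        * schur la)
      has_sum
        (prodinf (\<lambda>i. qpochhammer_inf (mconst q * mvar i ^ 2) (mconst (q ^ 2)) /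
               qpochhammer_inf (mvar i ^ 2) (mconst (q ^ 2))) *
         infprod (\<lambda>(i, j). 1 / (1 - mvar i * mvar j)) {(i, j). i < j}))
      {la. is_partition la \<and> empty_2core la}
    \<and>
     ((\<lambda>la. mconst (q powi b_stat (conjugate la) *
          ((\<Prod>h\<in>#odd_hook_lengths la. 1 - q ^ h) / (\<Prod>h\<in>#even_hook_lengths la. 1 - q ^ h)))
        * schur la)
      has_sum
        (prodinf (\<lambda>i. qpochhammer_inf (mconst (q ^ 2) * mvar i ^ 2) (mconst (q ^ 2)) /
               qpochhammer_inf (mconst q * mvar i ^ 2) (mconst (q ^ 2))) *
         infprod (\<lambda>(i, j). 1 / (1 - mvar i * mvar j)) {(i, j). i < j}))
      {la. is_partition la \<and> empty_2core la}"
proof -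
  have q2: "norm (q ^ 2) < 1" using assms by (simp add: norm_power power_less_one_iff)
  have A: "qbinom_coeff q (Suc n) * (1 - (q ^ 2) ^ Suc n) = qbinom_coeff q n * (1 - q * (q ^ 2) ^ n)" for n
  proof -
    have "(q ^ 2) ^ Suc n = q ^ (2 * n + 2)" by (subst power_mult[symmetric]) simp
    moreover have "q * (q ^ 2) ^ n = q ^ (2 * n + 1)" by (simp add: power_mult)
    ultimately show ?thesis by (simp only: qbinom_coeff_Suc[OF assms])
  qed
  \<comment> \<open>The q-binomial theorem in base q^2 with \<open>a = q\<close> and
    \<open>b = 1\<close>, whence the explicit \<open>mconst 1\<close>.\<close>
  have "qpochhammer_inf (mconst q * mvar i ^ 2) (mconst (q ^ 2)) / qpochhammer_inf (mconst 1 * mvar i ^ 2) (mconst (q ^ 2)) =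
      univar i (even_series (qbinom_coeff q))" for i
    by (rule qpochhammer_inf_quotient[OF q2]) (use A in simp_all)
  then have 1: "qpochhammer_inf (mconst q * mvar i ^ 2) (mconst (q ^ 2)) / qpochhammer_inf (mvar i ^ 2) (mconst (q ^ 2)) =
      univar i (even_series (qbinom_coeff q))" for i by simp
  \<comment> \<open>Base q^2 with \<open>a = q^2\<close> and \<open>b = q\<close>: the previous
    quotient with x_i^2 replaced by q x_i^2, which explains the factor q^n in the
    coefficients.\<close>
  have 2: "qpochhammer_inf (mconst (q ^ 2) * mvar i ^ 2) (mconst (q ^ 2)) / qpochhammer_inf (mconst q * mvar i ^ 2) (mconst (q ^ 2)) =
      univar i (even_series (\<lambda>n. q ^ n * qbinom_coeff q n))" for i
  proof (rule qpochhammer_inf_quotient[OF q2])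
    fix n
    have "q ^ Suc n * qbinom_coeff q (Suc n) * (1 - (q ^ 2) ^ Suc n) =
      q ^ Suc n * (qbinom_coeff q n * (1 - q * (q ^ 2) ^ n))"
      by (simp only: mult.assoc A)
    also have "\<dots> = q ^ n * qbinom_coeff q n * (q - q ^ 2 * (q ^ 2) ^ n)"
      by (simp add: algebra_simps power2_eq_square)
    finally show "q ^ Suc n * qbinom_coeff q (Suc n) * (1 - (q ^ 2) ^ Suc n) =
      q ^ n * qbinom_coeff q n * (q - q ^ 2 * (q ^ 2) ^ n)" .
  qed simp
  have "((\<lambda>la. mconst (q powi b_stat la * hook_quotient q la) * schur la) has_sum
     (prodinf (\<lambda>i. univar i (even_series (qbinom_coeff q))) * infprod (\<lambda>(i, j). 1 / (1 - mvar i * mvar j)) {(i, j). i < j}))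
     {la. is_partition la \<and> empty_2core la}"
  proof (rule littlewood_identity_of_recurrence[where w = "\<lambda>l. if even l then l else 0" and A = qbinom_coeff])
    show "b_stat la = (\<Sum>i<n. int (if even (beta n la i) then beta n la i else 0)) + pair_stat n (beta n la)"
      if "is_partition la" "length la \<le> n" "(\<Sum>i<n. sg (beta n la i)) = 0" for n la
      unfolding b_stat_beta[OF that] by (intro arg_cong2[of _ _ _ _ "(+)"] sum.cong) auto
  qed (use assms isCont_qbinom_coeff cauchy_entry_recurrence_even_weight in auto)
  moreover have "((\<lambda>la. mconst (q powi b_stat (conjugate la) * hook_quotient q la) * schur la) has_sum
     (prodinf (\<lambda>i. univar i (even_series (\<lambda>n. q ^ n * qbinom_coeff q n))) * infprod (\<lambda>(i, j). 1 / (1 - mvar i * mvar j)) {(i, j). i < j}))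
     {la. is_partition la \<and> empty_2core la}"
  proof (rule littlewood_identity_of_recurrence[where w = "\<lambda>l. l div 2" and A = "\<lambda>q n. q ^ n * qbinom_coeff q n" and b = "\<lambda>la. b_stat (conjugate la)"])
    show "b_stat (conjugate la) = (\<Sum>i<n. int (beta n la i div 2)) + pair_stat n (beta n la)"
      if "is_partition la" "length la \<le> n" "(\<Sum>i<n. sg (beta n la i)) = 0" for n la
      by (rule b_stat_conjugate_beta[OF that])
    show "isCont (\<lambda>q :: complex. q ^ l * qbinom_coeff q l) 0" for l
      by (intro continuous_mult continuous_power isCont_qbinom_coeff) simp
  qed (use assms cauchy_entry_recurrence_half_weight in auto)
  ultimately show ?thesis unfolding 1 2 hook_quotient_def by blast
qed

end
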